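(* Let $\ell\geq1$, let $\eta\in V'(\mathbb{R})$ with $\eta\neq0$, and let $F$ be a generalized Whittaker function of type $\eta$. If $(\eta,\eta)<0$ then $F$ is identically $0$. If $(\eta,\eta)\geq0$ then there is a constant $C\in\mathbb{C}$ with $F(t,m)=C\,\mathcal{W}_\eta(t,m)$ for all $t\in\mathbb{R}^\times$, $m\in\mathrm{SO}(V')(\mathbb{R})$, where $F(t,m):=F(\mathrm{diag}(t,m,t^{-1}))$.
   Context: Let $n\geq 1$, $(V',q')$ a non-degenerate real quadratic space of signature $(2,n)$, $V=\mathbb{R}e\oplus V'\oplus\mathbb{R}f$ with $q(\alpha e+v'+\beta f)=\alpha\beta+q'(v')$, bilinear form $(x,y)=q(x+y)-q(x)-q(y)$ (extended $\mathbb{C}$-bilinearly), $G=\mathrm{SO}(V)$ acting on the left. Fix $V'=V_2\oplus V_n$ orthogonal with $V_2$ positive definite of dimension 2, $V_n$ negative definite, $v_1,v_2$ an orthonormal basis of $V_2$. Let $\iota(\alpha e+x+y+\beta f)=\beta e+x-y+\alpha f$ ($x\in V_2,y\in V_n$), $K$ the subgroup of $G$ commuting with $\iota$. Put $u_\pm=e\pm f$, $V_3=V_2\oplus\mathbb{R}u_+$, $V_{n+1}=V_n\oplus\mathbb{R}u_-$. Let $Y_2$ have basis $x,y$; identify $V_3\otimes\mathbb{C}\cong S^2(Y_2)$ via $x^2\leftrightarrow iv_1-v_2$, $xy\leftrightarrow u_+/\sqrt2$, $y^2\leftrightarrow iv_1+v_2$ (an isometry for $ax^2+bxy+cy^2\mapsto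 b^2-4ac$). $\mathbb{V}_\ell=S^{2\ell}(Y_2)$ is a $K$-representation through $K\to O(V_3)=\mathrm{SO}(V_3)\times\{\pm1\}$, $\mathrm{SO}(V_3)\cong\mathrm{SL}(Y_2)/\{\pm1\}$ acting via $S^{2\ell}$, $-1$ by $(-1)^\ell$. $[x^j]=x^j/j!$, $[y^j]=y^j/j!$. Identify $\mathfrak{so}(V)$ with $\wedge^2V$ via $(a\wedge b)(v)=(b,v)a-(a,v)b$, $\mathfrak p=(V_3\wedge V_{n+1})\otimes\mathbb{C}\cong S^2(Y_2)\otimes V_{n+1}$. For smooth $F:G\to\mathbb{V}_\ell$ with $F(gk)=k^{-1}F(g)$, $\widetilde D_\ell F=\sum_\gamma X_\gamma F\otimes X_\gamma^\vee$ (basis $X_\gamma$ of $\mathfrak p$, dual basis $X_\gamma^\vee$, right-regular derivatives), valued in $\mathbb{V}_\ell\otimes\mathfrak p^\vee\cong (S^{2\ell+2}\oplus S^{2\ell}\oplus S^{2\ell-2})(Y_2)\otimes V_{n+1}$; $D_\ell=\mathrm{pr}\circ\widetilde D_\ell$ with $\mathrm{pr}$ the $K$-equivariant projection onto $(S^{2\ell}\oplus S^{2\ell-2})(Y_2)\otimes V_{n+1}$. For $x\in V'$, $n(x)\in G$: $e\mapsto e$, $v\mapsto v+(x,v)e$ ($v\in V'$), $f\mapsto f-x-q'(x)e$. $\mathrm{diag}(t,m,t^{-1})$ acts by $t$ on $e$, $m\in\mathrm{SO}(V')$ on $V'$, $t^{-1}$ on $f$. A generalized Whittaker function of type $\eta$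 is a smooth $F:G\to\mathbb{V}_\ell$ of moderate growth with $F(n(x)g)=e^{i(\eta,x)}F(g)$, $F(gk)=k^{-1}F(g)$, $D_\ell F=0$ for all $g\in G$, $k\in K$, $x\in V'$. For $\eta\neq0$ with $(\eta,\eta)\ge0$: $u_\eta(t,m)=\sqrt2\,t\,i(\eta,m(iv_1-v_2))$ (nonzero) and $\mathcal{W}_\eta(t,m)=t^\ell|t|\sum_{v=-\ell}^{\ell}\left(\frac{|u_\eta(t,m)|}{u_\eta(t,m)}\right)^vK_v(|u_\eta(t,m)|)[x^{\ell+v}][y^{\ell-v}]$, with $K_v(y)=\frac12\int_0^\infty e^{-y(u+u^{-1})/2}u^v\frac{du}{u}$. *)

theory Defs
  imports "HOL-Analysis.Analysis" "HOL-Computational_Algebra.Polynomial"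
begin

section \<open>Quadratic spaces\<close>

definition polar :: "('v::real_vector \<Rightarrow> real) \<Rightarrow> 'v \<Rightarrow> 'v \<Rightarrow> real" where
  "polar q x y = q (x + y) - q x - q y"

definition quadratic_form :: "('v::real_vector \<Rightarrow> real) \<Rightarrow> bool" where
  "quadratic_form q \<longleftrightarrow> (\<forall>c x. q (c *\<^sub>R x) = c\<^sup>2 * q x) \<and> bilinear (polar q)"

text \<open>
  \<open>signature_split q n V2 Vn v1 v2\<close>: the form \<open>q\<close> on \<open>V' = \<real>\<^sup>m\<close> is non-degenerate of signature
  \<open>(2,n)\<close>, witnessed by a chosen orthogonal decomposition \<open>V' = V2 \<oplus> Vn\<close>; the basis \<open>v1, v2\<close> of
  \<open>V2\<close> is orthonormal for the bilinear form \<open>polar q\<close> (so \<open>q v1 = q v2 = 1/2\<close>).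
\<close>
definition signature_split ::
  "(real^'m \<Rightarrow> real) \<Rightarrow> nat \<Rightarrow> (real^'m) set \<Rightarrow> (real^'m) set \<Rightarrow> real^'m \<Rightarrow> real^'m \<Rightarrow> bool" where
  "signature_split q n V2 Vn v1 v2 \<longleftrightarrow>
     quadratic_form q \<and>
     subspace V2 \<and> dim V2 = 2 \<and> (\<forall>x\<in>V2. x \<noteq> 0 \<longrightarrow> q x > 0) \<and>
     subspace Vn \<and> dim Vn = n \<and> (\<forall>y\<in>Vn. y \<noteq> 0 \<longrightarrow> q y < 0) \<and>
     (\<forall>x\<in>V2. \<forall>y\<in>Vn. polar q x y = 0) \<and>
     (\<forall>z. \<exists>x\<in>V2. \<exists>y\<in>Vn. z = x + y) \<and>
     v1 \<in> V2 \<and> v2 \<in> V2 \<and> V2 = span {v1, v2} \<and>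
     polar q v1 v1 = 1 \<and> polar q v2 v2 = 1 \<and> polar q v1 v2 = 0"

text \<open>
  \<open>V = \<real>e \<oplus> V' \<oplus> \<real>f\<close> is \<open>real^('m::finite + bool)\<close>: \<open>Inl i\<close> indexes the coordinates of \<open>V'\<close>,
  \<open>Inr True\<close> that of \<open>e\<close> and \<open>Inr False\<close> that of \<open>f\<close>.  Thus \<open>vec_of \<alpha> v \<beta>\<close> is \<open>\<alpha>e + v + \<beta>f\<close>.
\<close>
definition vec_of :: "real \<Rightarrow> real^'m \<Rightarrow> real \<Rightarrow> real^('m::finite + bool)" where
  "vec_of a v b = (\<chi> k. case k of Inl i \<Rightarrow> v $ i | Inr c \<Rightarrow> if c then a else b)"

definition e_coord :: "real^('m::finite + bool) \<Rightarrow> real" where "e_coord w = w $ Inr True"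
definition f_coord :: "real^('m::finite + bool) \<Rightarrow> real" where "f_coord w = w $ Inr False"
definition mid :: "real^('m::finite + bool) \<Rightarrow> real^'m" where "mid w = (\<chi> i. w $ Inl i)"

definition hyp :: "(real^'m \<Rightarrow> real) \<Rightarrow> real^('m::finite + bool) \<Rightarrow> real" where
  "hyp q w = e_coord w * f_coord w + q (mid w)"

definition SO :: "(real^'k \<Rightarrow> real) \<Rightarrow> (real^'k^'k) set" where
  "SO q = {g. det g = 1 \<and> (\<forall>v. q (g *v v) = q v)}"

text \<open>On \<open>V' = V2 \<oplus> Vn\<close> the map \<open>x + y \<mapsto> x - y\<close> is \<open>z \<mapsto> 2 pr z - z\<close>, where \<open>pr\<close> is the orthogonal
  projection onto \<open>V2\<close>, written in the orthonormal basis \<open>v1, v2\<close>.\<close>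
definition iota :: "(real^'m \<Rightarrow> real) \<Rightarrow> real^'m \<Rightarrow> real^'m \<Rightarrow> real^('m::finite + bool) \<Rightarrow> real^('m::finite + bool)" where
  "iota q v1 v2 w =
     vec_of (f_coord w)
       (2 *\<^sub>R (polar q (mid w) v1 *\<^sub>R v1 + polar q (mid w) v2 *\<^sub>R v2) - mid w)
       (e_coord w)"

definition Kgroup :: "(real^'m \<Rightarrow> real) \<Rightarrow> real^'m \<Rightarrow> real^'m \<Rightarrow> (real^('m::finite + bool)^('m::finite + bool)) set" where
  "Kgroup q v1 v2 =
     {k \<in> SO (hyp q). \<forall>w. k *v iota q v1 v2 w = iota q v1 v2 (k *v w)}"

text \<open>\<open>V\<^bsub>n+1\<^esub> = Vn \<oplus> \<real>u\<^sub>-\<close>, with \<open>u\<^sub>- = e - f\<close>.\<close>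
definition Vminus :: "(real^'m) set \<Rightarrow> (real^('m::finite + bool)) set" where
  "Vminus Vn = {vec_of s y (- s) | s y. y \<in> Vn}"

definition nmat :: "(real^'m \<Rightarrow> real) \<Rightarrow> real^'m \<Rightarrow> real^('m::finite + bool)^('m::finite + bool)" where
  "nmat q x = matrix (\<lambda>w. vec_of
      (e_coord w + polar q x (mid w) - f_coord w * q x)
      (mid w - f_coord w *\<^sub>R x)
      (f_coord w))"

definition diag_mat :: "real \<Rightarrow> real^'m^'m \<Rightarrow> real^('m::finite + bool)^('m::finite + bool)" where
  "diag_mat t m = matrix (\<lambda>w. vec_of (t * e_coord w) (m *v mid w) (inverse t * f_coord w))"


section \<open>Complexification\<close>

definition cvec :: "real^'k \<Rightarrow> complex^'k" where "cvec v = (\<chi> i. complex_of_real (v $ i))"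
definition cmat :: "real^'k^'k \<Rightarrow> complex^'k^'k" where "cmat g = (\<chi> i j. complex_of_real (g $ i $ j))"
definition Re_vec :: "complex^'k \<Rightarrow> real^'k" where "Re_vec w = (\<chi> i. Re (w $ i))"
definition Im_vec :: "complex^'k \<Rightarrow> real^'k" where "Im_vec w = (\<chi> i. Im (w $ i))"

text \<open>The \<open>\<complex>\<close>-bilinear extension of \<open>polar q\<close>.\<close>
definition cpolar :: "(real^'k \<Rightarrow> real) \<Rightarrow> complex^'k \<Rightarrow> complex^'k \<Rightarrow> complex" where
  "cpolar q w z =
     Complex (polar q (Re_vec w) (Re_vec z) - polar q (Im_vec w) (Im_vec z))
             (polar q (Re_vec w) (Im_vec z) + polar q (Im_vec w) (Re_vec z))"


section \<open>Binary forms and the representation of \<open>K\<close>\<close>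

text \<open>
  \<open>S\<^sup>k(Y\<^sub>2)\<close>, the binary forms of degree \<open>k\<close> in \<open>x, y\<close>, is encoded by the polynomials \<open>p\<close> of degree
  at most \<open>k\<close>, setting \<open>y = 1\<close>: \<open>p\<close> stands for \<open>\<Sum>j\<le>k. coeff p j x\<^sup>j y\<^bsup>k-j\<^esup>\<close>.  Products of forms are
  products of polynomials.  \<open>form_dx\<close> and \<open>form_dy k\<close> are the partial derivatives \<open>\<partial>/\<partial>x\<close>, \<open>\<partial>/\<partial>y\<close>
  from \<open>S\<^sup>k\<close> to \<open>S\<^bsup>k-1\<^esup>\<close> in this encoding (the latter by Euler's identity).
\<close>
definition forms :: "nat \<Rightarrow> complex poly set" where
  "forms k = {p. degree p \<le> k}"

definition form_dx :: "complex poly \<Rightarrow> complex poly" where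
  "form_dx p = pderiv p"

definition form_dy :: "nat \<Rightarrow> complex poly \<Rightarrow> complex poly" where
  "form_dy k p = smult (of_nat k) p - [:0, 1:] * pderiv p"

text \<open>The action of \<open>A\<close> on \<open>S\<^sup>k(Y\<^sub>2)\<close>: it sends \<open>x \<mapsto> A\<^sub>1\<^sub>1 x + A\<^sub>2\<^sub>1 y\<close> and \<open>y \<mapsto> A\<^sub>1\<^sub>2 x + A\<^sub>2\<^sub>2 y\<close>.\<close>
definition sym_act :: "nat \<Rightarrow> complex^2^2 \<Rightarrow> complex poly \<Rightarrow> complex poly" where
  "sym_act k A p =
     (\<Sum>j\<le>k. smult (coeff p j) ([:A$2$1, A$1$1:] ^ j * [:A$2$2, A$1$2:] ^ (k - j)))"

text \<open>The identification \<open>S\<^sup>2(Y\<^sub>2) \<cong> V\<^sub>3 \<otimes> \<complex>\<close>, with \<open>u\<^sub>+ = e + f\<close>.\<close>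
definition S2_to_V3 :: "real^'m \<Rightarrow> real^'m \<Rightarrow> complex poly \<Rightarrow> complex^('m::finite + bool)" where
  "S2_to_V3 v1 v2 p =
     coeff p 2 *s (\<i> *s cvec (vec_of 0 v1 0) - cvec (vec_of 0 v2 0)) +
     coeff p 1 *s (complex_of_real (1 / sqrt 2) *s cvec (vec_of 1 0 1)) +
     coeff p 0 *s (\<i> *s cvec (vec_of 0 v1 0) + cvec (vec_of 0 v2 0))"

text \<open>
  \<open>spin_lift v1 v2 k A \<epsilon>\<close>: the image of \<open>k\<close> in \<open>O(V\<^sub>3) = SO(V\<^sub>3) \<times> {\<plusminus>1}\<close> is \<open>(h, \<epsilon>)\<close>, and \<open>A \<in> SL(Y\<^sub>2)\<close>
  is one of the two lifts of \<open>h \<in> SO(V\<^sub>3) \<hookrightarrow> SL(Y\<^sub>2)/{\<plusminus>1}\<close>.  For \<open>k \<in> K\<close> such a pair exists, \<open>\<epsilon>\<close> is unique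
  and \<open>A\<close> is unique up to sign, and \<open>k\<close> acts on \<open>S\<^bsup>2l\<^esup>(Y\<^sub>2)\<close> by \<open>\<epsilon>\<^sup>l\<close> times the action of \<open>A\<close>, which
  does not depend on the sign.
\<close>
definition spin_lift ::
  "real^'m \<Rightarrow> real^'m \<Rightarrow> real^('m::finite + bool)^('m::finite + bool) \<Rightarrow> complex^2^2 \<Rightarrow> complex \<Rightarrow> bool" where
  "spin_lift v1 v2 k A \<epsilon> \<longleftrightarrow>
     (\<epsilon> = 1 \<or> \<epsilon> = -1) \<and> det A = 1 \<and>
     (\<forall>p\<in>forms 2. cmat k *v S2_to_V3 v1 v2 p = \<epsilon> *s S2_to_V3 v1 v2 (sym_act 2 A p))"

text \<open>\<open>F(gk) = k\<^sup>-\<^sup>1 F(g)\<close>\<close>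
definition K_equivariant ::
  "(real^'m \<Rightarrow> real) \<Rightarrow> real^'m \<Rightarrow> real^'m \<Rightarrow> nat \<Rightarrow>
   (real^('m::finite + bool)^('m::finite + bool) \<Rightarrow> complex poly) \<Rightarrow> bool" where
  "K_equivariant q v1 v2 l F \<longleftrightarrow>
     (\<forall>g\<in>SO (hyp q). \<forall>k\<in>Kgroup q v1 v2. \<forall>A \<epsilon>. spin_lift v1 v2 (matrix_inv k) A \<epsilon> \<longrightarrow>
        F (g ** k) = smult (\<epsilon> ^ l) (sym_act (2 * l) A (F g)))"


section \<open>Smoothness and moderate growth\<close>

primrec Ck_on :: "nat \<Rightarrow> 'a::real_normed_vector set \<Rightarrow> ('a \<Rightarrow> 'b::real_normed_vector) \<Rightarrow> bool" where
  "Ck_on 0 S f \<longleftrightarrow> continuous_on S f"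
| "Ck_on (Suc k) S f \<longleftrightarrow>
     (\<forall>x\<in>S. f differentiable (at x)) \<and> (\<forall>v. Ck_on k S (\<lambda>x. frechet_derivative f (at x) v))"

text \<open>Smooth functions on a closed subgroup \<open>G\<close> of \<open>GL(V)\<close> (an embedded submanifold of the space of
  matrices) are those that extend locally to smooth functions on open sets of matrices.\<close>
definition smooth_fun_on ::
  "'a::real_normed_vector set \<Rightarrow> ('a \<Rightarrow> 'b::real_normed_vector) \<Rightarrow> bool" where
  "smooth_fun_on G f \<longleftrightarrow>
     (\<forall>g\<in>G. \<exists>U h. open U \<and> g \<in> U \<and> (\<forall>k. Ck_on k U h) \<and> (\<forall>x\<in>U \<inter> G. h x = f x))"

text \<open>The norm of \<open>g\<^sup>-\<^sup>1\<close> need not be mentioned: it is bounded by a multiple of that of \<open>g\<close> on \<open>SO(V)\<close>.\<close>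
definition moderate_growth_on :: "'a::real_normed_vector set \<Rightarrow> ('a \<Rightarrow> complex poly) \<Rightarrow> bool" where
  "moderate_growth_on G F \<longleftrightarrow> (\<exists>(C::real) (N::nat). \<forall>g\<in>G. \<forall>j. cmod (coeff (F g) j) \<le> C * norm g ^ N)"


section \<open>The operator \<open>D\<^sub>l\<close>\<close>

definition mexp :: "real^'k^'k \<Rightarrow> real^'k^'k" where
  "mexp X = (\<Sum>j. (((**) X) ^^ j) (mat 1) /\<^sub>R fact j)"

definition wedge :: "(real^'k \<Rightarrow> real) \<Rightarrow> real^'k \<Rightarrow> real^'k \<Rightarrow> real^'k^'k" where
  "wedge q a b = matrix (\<lambda>v. polar q b v *\<^sub>R a - polar q a v *\<^sub>R b)"

text \<open>The right-regular derivative \<open>(XF)(g)\<close>, taken coefficientwise in \<open>S\<^bsup>2l\<^esup>(Y\<^sub>2)\<close>.\<close>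
definition right_deriv ::
  "nat \<Rightarrow> real^'k^'k \<Rightarrow> (real^'k^'k \<Rightarrow> complex poly) \<Rightarrow> real^'k^'k \<Rightarrow> complex poly" where
  "right_deriv l X F g =
     (\<Sum>j\<le>2 * l. monom (vector_derivative (\<lambda>s. coeff (F (g ** mexp (s *\<^sub>R X))) j) (at 0)) j)"

text \<open>\<open>((w \<and> b)F)(g)\<close> for \<open>w \<in> V\<^sub>3 \<otimes> \<complex>\<close> and \<open>b \<in> V\<^bsub>n+1\<^esub>\<close>.\<close>
definition p_deriv ::
  "(real^'k \<Rightarrow> real) \<Rightarrow> nat \<Rightarrow> complex^'k \<Rightarrow> real^'k \<Rightarrow>
   (real^'k^'k \<Rightarrow> complex poly) \<Rightarrow> real^'k^'k \<Rightarrow> complex poly" where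
  "p_deriv q l w b F g =
     right_deriv l (wedge q (Re_vec w) b) F g + smult \<i> (right_deriv l (wedge q (Im_vec w) b) F g)"

text \<open>
  Elements of \<open>S\<^bsup>2l\<^esup>(Y\<^sub>2) \<otimes> \<pp>\<^sup>\<or>\<close>, where \<open>\<pp> = S\<^sup>2(Y\<^sub>2) \<otimes> V\<^bsub>n+1\<^esub>\<close>, are given by their contractions with each
  \<open>b \<in> V\<^bsub>n+1\<^esub>\<close>.  The contraction lies in \<open>S\<^bsup>2l\<^esup>(Y\<^sub>2) \<otimes> S\<^sup>2(Y\<^sub>2)\<^sup>\<or> \<cong> S\<^bsup>2l\<^esup>(Y\<^sub>2) \<otimes> S\<^sup>2(Y\<^sub>2)\<close>, and the triple
  \<open>(P, Q, R)\<close> stands for \<open>P \<otimes> x\<^sup>2 + Q \<otimes> xy + R \<otimes> y\<^sup>2\<close>.  Under the invariant bilinear form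
  \<open>(ax\<^sup>2 + bxy + cy\<^sup>2, a'x\<^sup>2 + b'xy + c'y\<^sup>2) = bb' - 2ac' - 2a'c\<close>, the basis dual to \<open>x\<^sup>2, xy, y\<^sup>2\<close> is
  \<open>-y\<^sup>2/2, xy, -x\<^sup>2/2\<close>; hence the contraction of \<open>\<Sum>\<^sub>\<gamma> X\<^sub>\<gamma>F \<otimes> X\<^sub>\<gamma>\<^sup>\<or>\<close> with \<open>b\<close> is
  \<open>(x\<^sup>2 \<and> b)F \<otimes> (-y\<^sup>2/2) + (xy \<and> b)F \<otimes> xy + (y\<^sup>2 \<and> b)F \<otimes> (-x\<^sup>2/2)\<close>.
\<close>
definition D_tilde ::
  "(real^'m \<Rightarrow> real) \<Rightarrow> real^'m \<Rightarrow> real^'m \<Rightarrow> nat \<Rightarrow>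
   (real^('m::finite + bool)^('m::finite + bool) \<Rightarrow> complex poly) \<Rightarrow> real^('m::finite + bool)^('m::finite + bool) \<Rightarrow>
   real^('m::finite + bool) \<Rightarrow> complex poly \<times> complex poly \<times> complex poly" where
  "D_tilde q v1 v2 l F g b =
     (smult (- 1 / 2) (p_deriv (hyp q) l (S2_to_V3 v1 v2 (monom 1 0)) b F g),
      p_deriv (hyp q) l (S2_to_V3 v1 v2 (monom 1 1)) b F g,
      smult (- 1 / 2) (p_deriv (hyp q) l (S2_to_V3 v1 v2 (monom 1 2)) b F g))"

text \<open>
  The projections of \<open>S\<^sup>k \<otimes> S\<^sup>2 \<cong> S\<^bsup>k+2\<^esup> \<oplus> S\<^sup>k \<oplus> S\<^bsup>k-2\<^esup>\<close> onto \<open>S\<^sup>k\<close> and \<open>S\<^bsup>k-2\<^esup>\<close> are, up to nonzero scalars,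
  the transvectants \<open>P\<^sub>x Q\<^sub>y - P\<^sub>y Q\<^sub>x\<close> and \<open>P\<^sub>x\<^sub>x Q\<^sub>y\<^sub>y - 2 P\<^sub>x\<^sub>y Q\<^sub>x\<^sub>y + P\<^sub>y\<^sub>y Q\<^sub>x\<^sub>x\<close>.
\<close>
definition transvectant1 :: "nat \<Rightarrow> complex poly \<Rightarrow> complex poly \<Rightarrow> complex poly" where
  "transvectant1 k P Q = form_dx P * form_dy 2 Q - form_dy k P * form_dx Q"

definition transvectant2 :: "nat \<Rightarrow> complex poly \<Rightarrow> complex poly \<Rightarrow> complex poly" where
  "transvectant2 k P Q =
     form_dx (form_dx P) * form_dy 1 (form_dy 2 Q)
     - 2 * form_dx (form_dy k P) * form_dx (form_dy 2 Q)
     + form_dy (k - 1) (form_dy k P) * form_dx (form_dx Q)"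

definition pr :: "nat \<Rightarrow> complex poly \<times> complex poly \<times> complex poly \<Rightarrow> complex poly \<times> complex poly" where
  "pr k = (\<lambda>(P, Q, R).
     (transvectant1 k P (monom 1 2) + transvectant1 k Q (monom 1 1) + transvectant1 k R (monom 1 0),
      transvectant2 k P (monom 1 2) + transvectant2 k Q (monom 1 1) + transvectant2 k R (monom 1 0)))"

definition D_op ::
  "(real^'m \<Rightarrow> real) \<Rightarrow> real^'m \<Rightarrow> real^'m \<Rightarrow> nat \<Rightarrow>
   (real^('m::finite + bool)^('m::finite + bool) \<Rightarrow> complex poly) \<Rightarrow> real^('m::finite + bool)^('m::finite + bool) \<Rightarrow>
   real^('m::finite + bool) \<Rightarrow> complex poly \<times> complex poly" where
  "D_op q v1 v2 l F g b = pr (2 * l) (D_tilde q v1 v2 l F g b)"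


section \<open>Generalized Whittaker functions\<close>

text \<open>Only the values of \<open>F\<close> on \<open>G = SO(V)\<close> matter.\<close>
definition gen_whittaker ::
  "(real^'m \<Rightarrow> real) \<Rightarrow> (real^'m) set \<Rightarrow> real^'m \<Rightarrow> real^'m \<Rightarrow> nat \<Rightarrow> real^'m \<Rightarrow>
   (real^('m::finite + bool)^('m::finite + bool) \<Rightarrow> complex poly) \<Rightarrow> bool" where
  "gen_whittaker q Vn v1 v2 l \<eta> F \<longleftrightarrow>
     (\<forall>g\<in>SO (hyp q). F g \<in> forms (2 * l)) \<and>
     (\<forall>j. smooth_fun_on (SO (hyp q)) (\<lambda>g. coeff (F g) j)) \<and>
     moderate_growth_on (SO (hyp q)) F \<and>
     (\<forall>x. \<forall>g\<in>SO (hyp q). F (nmat q x ** g) = smult (exp (\<i> * complex_of_real (polar q \<eta> x))) (F g)) \<and>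
     K_equivariant q v1 v2 l F \<and>
     (\<forall>g\<in>SO (hyp q). \<forall>b\<in>Vminus Vn. D_op q v1 v2 l F g b = (0, 0))"

definition bessel_K :: "int \<Rightarrow> real \<Rightarrow> real" where
  "bessel_K v y = 1 / 2 * integral {0<..} (\<lambda>u. exp (- y * (u + inverse u) / 2) * (u powi v) / u)"

definition u_eta ::
  "(real^'m \<Rightarrow> real) \<Rightarrow> real^'m \<Rightarrow> real^'m \<Rightarrow> real^'m \<Rightarrow> real \<Rightarrow> real^'m^'m \<Rightarrow> complex" where
  "u_eta q v1 v2 \<eta> t m =
     complex_of_real (sqrt 2 * t) * \<i> * cpolar q (cvec \<eta>) (cmat m *v (\<i> *s cvec v1 - cvec v2))"

definition W_eta ::
  "(real^'m \<Rightarrow> real) \<Rightarrow> real^'m \<Rightarrow> real^'m \<Rightarrow> nat \<Rightarrow> real^'m \<Rightarrow> real \<Rightarrow> real^'m^'m \<Rightarrow> complex poly" where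
  "W_eta q v1 v2 l \<eta> t m =
     smult (complex_of_real (t ^ l * \<bar>t\<bar>))
       (\<Sum>v\<in>{- int l..int l}.
          smult ((complex_of_real (cmod (u_eta q v1 v2 \<eta> t m)) / u_eta q v1 v2 \<eta> t m) powi v
                  * complex_of_real (bessel_K v (cmod (u_eta q v1 v2 \<eta> t m))))
            (monom (1 / (fact (nat (int l + v)) * fact (nat (int l - v)))) (nat (int l + v))))"

end

theory Submission
  imports Defs
begin

text \<open>
  Put \<open>\<phi>\<^sub>j = j! (2l-j)!\<close> times the \<open>j\<close>-th coefficient of \<open>F(diag(t, m, 1/t))\<close>.  Contracted with \<open>b = u\<^sub>-\<close>, the
  equation \<open>D\<^sub>l F = 0\<close> becomes \<open>t d\<phi>\<^sub>j/dt = (j+1) \<phi>\<^sub>j - u \<phi>\<^bsub>j+1\<^esub> = (2l-j+1) \<phi>\<^sub>j - u' \<phi>\<^bsub>j-1\<^esub>\<close>, where \<open>u'\<close> is the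
  conjugate of \<open>u = u\<^sub>\<eta>(t, m)\<close>.  If \<open>u \<noteq> 0\<close>, then \<open>(\<phi>\<^sub>l, \<phi>\<^bsub>l+1\<^esub>)\<close>, suitably rescaled, solves the first-order
  Bessel system and moderate growth leaves only multiples of \<open>(K\<^sub>0, K\<^sub>1)\<close>; the remaining \<open>\<phi>\<^sub>j\<close> follow from the
  three-term recurrence, so \<open>F = C(m) W\<^sub>\<eta>\<close> on the ray.  Contracted with \<open>b \<in> V\<^sub>n\<close>, the equation says that \<open>C\<close> is
  constant along the one-parameter groups generated by \<open>V\<^sub>2 \<and> V\<^sub>n\<close>, and \<open>K \<inter> M\<close>-equivariance makes it constant on
  \<open>SO(V')\<close>.  If \<open>(\<eta>, \<eta>) < 0\<close>, such a one-parameter group reaches a zero of \<open>u\<close>, where \<open>K\<^sub>1(|u|)\<close> is unbounded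
  but \<open>F\<close> is not; hence \<open>C = 0\<close>, and \<open>F = 0\<close> by continuity and the Iwasawa decomposition.
\<close>

section \<open>The Bessel functions \<open>K\<^sub>v\<close>\<close>

text \<open>Removing the components in degrees 2l and 2l-2 leaves only degree 2l+2: for each
  \<open>b\<close> the derivatives along \<open>x^2 \<and> b\<close>, \<open>xy \<and> b\<close>,
  \<open>y^2 \<and> b\<close> are, up to scalars, the second partials of one form
  \<open>\<Phi>\<close> of degree 2l+2. The relations behind all equations are
  \<open>\<partial>_y \<Phi>_xx = \<partial>_x \<Phi>_xy\<close> and
  \<open>\<partial>_x \<Phi>_yy = \<partial>_y \<Phi>_xy\<close>, so each couples only two of the
  three derivatives. They become ordinary differential equations because e is proportional to
  \<open>U + W\<close>. A generator in \<open>V3 \<and> W\<close> thus splits into a part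
  \<open>e \<and> V'\<close>, where the character gives the derivative, and a part in the Lie
  algebra of K, where equivariance gives it; only \<open>U \<and> W\<close>, which generates the
  torus, still differentiates. \<open>K \<inter> M\<close> is disconnected: elements reversing the
  orientation of V2 exchange the outer coefficients of F. The constant C(m) is therefore read off
  the middle coefficient, which every component fixes. All one-parameter groups in use have closed
  forms of degree 2 in their generator, so membership in SO and derivatives are checked by direct
  algebra.\<close>

definition bessel_integrand :: "int \<Rightarrow> real \<Rightarrow> real \<Rightarrow> real" where
  "bessel_integrand v y u = exp (- y * (u + inverse u) / 2) * (u powi v) / u"

lemma power_le_fact_exp:
  fixes x :: real assumes "0 \<le> x" shows "x ^ k \<le> fact k * exp x"
proof -
  have "x ^ k /\<^sub>R fact k \<le> (\<Sum>j. x ^ j /\<^sub>R fact j)"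
    using sum_le_suminf[OF summable_exp_generic[of x], of "{k}"] assms by (auto simp: zero_le_divide_iff)
  thus ?thesis by (simp add: exp_def field_simps)
qed

text \<open>For v >= 0 half of the decay \<open>exp (- y u / 2)\<close> absorbs the power of
  \<open>u\<close>; for v < 0 the factor \<open>exp (- y / (2 u))\<close> absorbs the pole at 0. The
  one bound serves integrability and both boundary limits.\<close>

lemma exp_powi_bound:
  assumes "y > 0"
  obtains M where "M \<ge> 0" "\<And>u::real. u > 0 \<Longrightarrow> exp (- y * (u + inverse u) / 2) * u powi v \<le> M * exp (- (y / 4) * u)"
proof (cases "v \<ge> 0")
  case True
  define k where "k = nat v"
  have v: "v = int k" using True by (simp add: k_def)
  show ?thesis
  proof (rule that[of "(4 / y) ^ k * fact k"])
    fix u :: real assume u: "u > 0"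
    have "u ^ k * y ^ k \<le> 4 ^ k * (fact k * exp (y * u / 4))"
      using power_le_fact_exp[of "y * u / 4" k] assms u by (simp add: power_divide power_mult_distrib field_simps)
    hence 1: "u ^ k \<le> (4 / y) ^ k * fact k * exp (y * u / 4)"
      using assms by (simp add: power_divide field_simps)
    have "exp (- y * (u + inverse u) / 2) * u powi v \<le> exp (- y * u / 2) * u ^ k"
      using assms u by (auto simp: v intro!: mult_right_mono)
    also have "\<dots> \<le> exp (- y * u / 2) * ((4 / y) ^ k * fact k * exp (y * u / 4))"
      using 1 by (intro mult_left_mono) auto
    also have "\<dots> = (4 / y) ^ k * fact k * (exp (- y * u / 2) * exp (y * u / 4))" by simp
    also have "exp (- y * u / 2) * exp (y * u / 4) = exp (- (y / 4) * u)"
      by (simp flip: exp_add)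
    finally show "exp (- y * (u + inverse u) / 2) * u powi v \<le> (4 / y) ^ k * fact k * exp (- (y / 4) * u)" .
  qed (use assms in auto)
next
  case False
  define k where "k = nat (-v)"
  have v: "v = - int k" using False by (simp add: k_def)
  show ?thesis
  proof (rule that[of "(2 / y) ^ k * fact k"])
    fix u :: real assume u: "u > 0"
    have "y ^ k \<le> (2 * u) ^ k * (fact k * exp (y * inverse u / 2))"
      using power_le_fact_exp[of "y * inverse u / 2" k] assms u by (simp add: power_divide power_mult_distrib field_simps)
    hence 1: "inverse u ^ k \<le> (2 / y) ^ k * fact k * exp (y * inverse u / 2)"
      using assms u by (simp add: power_divide power_mult_distrib field_simps)
    have "exp (- y * (u + inverse u) / 2) * u powi v = exp (- y * u / 2) * exp (- y * inverse u / 2) * inverse u ^ k"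
      using u by (simp add: v power_int_minus power_inverse distrib_left add_divide_distrib diff_divide_distrib flip: exp_add)
    also have "\<dots> \<le> exp (- y * u / 2) * exp (- y * inverse u / 2) * ((2 / y) ^ k * fact k * exp (y * inverse u / 2))"
      using 1 by (intro mult_left_mono) auto
    also have "\<dots> = (2 / y) ^ k * fact k * exp (- y * u / 2) * (exp (- y * inverse u / 2) * exp (y * inverse u / 2))" by simp
    also have "exp (- y * inverse u / 2) * exp (y * inverse u / 2) = 1"
      by (simp flip: exp_add)
    also have "(2 / y) ^ k * fact k * exp (- y * u / 2) * 1 \<le> (2 / y) ^ k * fact k * exp (- (y / 4) * u)"
      using assms u by (auto intro!: mult_left_mono)
    finally show "exp (- y * (u + inverse u) / 2) * u powi v \<le> (2 / y) ^ k * fact k * exp (- (y / 4) * u)" .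
  qed (use assms in auto)
qed

lemma bessel_integrand_alt: "u > 0 \<Longrightarrow> bessel_integrand v y u = exp (- y * (u + inverse u) / 2) * u powi (v - 1)"
  by (simp add: bessel_integrand_def power_int_diff)

lemma bessel_integrand_pos: "u > 0 \<Longrightarrow> bessel_integrand v y u > 0"
  by (simp add: bessel_integrand_def)

lemma bessel_integrand_continuous: "continuous_on {0<..} (bessel_integrand v y)"
  unfolding bessel_integrand_def by (intro continuous_intros) auto

lemma set_integrable_bessel_integrand:
  assumes "y > 0" shows "set_integrable lborel {0<..} (bessel_integrand v y)"
proof -
  obtain M where M: "M \<ge> 0" "\<And>u::real. u > 0 \<Longrightarrow> exp (- y * (u + inverse u) / 2) * u powi (v - 1) \<le> M * exp (- (y / 4) * u)"
    using exp_powi_bound[OF assms] by blast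
  have "(\<lambda>u. M * exp (- (y / 4) * u)) integrable_on {0..}"
    using integrable_on_exp_minus_to_infinity[of "y/4" 0] assms by (intro integrable_on_mult_right) auto
  hence "(\<lambda>u. M * exp (- (y / 4) * u)) integrable_on {0<..}"
    by (rule integrable_spike_set) (rule negligible_subset[of "{0}"], auto)+
  hence "bessel_integrand v y absolutely_integrable_on {0<..}"
  proof (rule measurable_bounded_by_integrable_imp_absolutely_integrable[rotated 2])
    show "bessel_integrand v y \<in> borel_measurable (lebesgue_on {0<..})"
      by (intro continuous_imp_measurable_on_sets_lebesgue bessel_integrand_continuous) auto
    show "norm (bessel_integrand v y u) \<le> M * exp (- (y / 4) * u)" if "u \<in> {0<..}" for u
      using bessel_integrand_pos[of u v y] M(2)[of u] that by (simp add: bessel_integrand_alt[of u v y])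
  qed auto
  moreover have "set_borel_measurable borel {0<..} (bessel_integrand v y)"
    by (rule borel_measurable_continuous_on_indicator[unfolded set_borel_measurable_def[symmetric]])
       (auto simp: bessel_integrand_continuous)
  ultimately show ?thesis
    using integrable_completion[of "\<lambda>u. indicator {0<..} u *\<^sub>R bessel_integrand v y u" lborel]
    by (simp add: set_integrable_def set_borel_measurable_def)
qed

text \<open>Passes from the gauge integral of the definition to the Lebesgue integral, whose
  calculus is used from here on.\<close>

lemma bessel_K_eq: "y > 0 \<Longrightarrow> bessel_K v y = 1 / 2 * (LINT u:{0<..}|lborel. bessel_integrand v y u)"
  unfolding bessel_K_def bessel_integrand_def[symmetric]
  by (subst set_borel_integral_eq_integral(2)) (auto simp: set_integrable_bessel_integrand)

lemma bessel_K_pos: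
  assumes "y > 0" shows "bessel_K v y > 0"
proof -
  have "(LINT u:{0<..}|lborel. bessel_integrand v y u) \<ge> 0"
    unfolding set_lebesgue_integral_def
    by (intro integral_nonneg_AE) (auto simp: indicator_def less_imp_le[OF bessel_integrand_pos])
  moreover have "(LINT u:{0<..}|lborel. bessel_integrand v y u) \<noteq> 0"
  proof
    assume "(LINT u:{0<..}|lborel. bessel_integrand v y u) = 0"
    hence "AE u in lborel. indicator {0<..} u *\<^sub>R bessel_integrand v y u = 0"
      using set_integrable_bessel_integrand[OF assms, of v]
      by (subst (asm) set_lebesgue_integral_def, subst (asm) integral_nonneg_eq_0_iff_AE)
         (auto simp: set_integrable_def indicator_def less_imp_le[OF bessel_integrand_pos])
    hence "AE u in lborel. (u::real) \<notin> {0<..}"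
      by eventually_elim (use bessel_integrand_pos[of _ v y] in \<open>fastforce simp: indicator_def split: if_splits\<close>)
    \<comment> \<open>A bounded interval already gives the contradiction, since its measure is
      1.\<close>
    hence "AE u in lborel. (u::real) \<notin> {0<..<1}" by eventually_elim auto
    hence "emeasure lborel {0<..<1::real} = 0"
      by (subst (asm) AE_iff_measurable[of "{0<..<1}"]) auto
    thus False by simp
  qed
  ultimately show ?thesis by (simp add: bessel_K_eq assms)
qed

text \<open>Since u + 1/u >= 2, raising the argument from 1 to y multiplies the integrand by at most
  \<open>exp (1 - y)\<close>. This decay will beat the polynomial growth of F.\<close>

lemma bessel_K_decay:
  assumes "y \<ge> 1" shows "bessel_K v y \<le> exp (1 - y) * bessel_K v 1"
proof -
  have "(LINT u:{0<..}|lborel. bessel_integrand v y u) \<le> (LINT u:{0<..}|lborel. exp (1 - y) * bessel_integrand v 1 u)"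
  proof (rule set_integral_mono)
    fix u :: real assume "u \<in> {0<..}"
    hence u: "u > 0" by simp
    have "(u - 1)\<^sup>2 / u \<ge> 0" using u by simp
    hence "u + inverse u \<ge> 2" using u by (simp add: power2_eq_square field_simps)
    hence "(y - 1) * (u + inverse u) \<ge> (y - 1) * 2" using assms by (intro mult_left_mono) auto
    hence "- y * (u + inverse u) / 2 \<le> (1 - y) + - 1 * (u + inverse u) / 2"
      by (simp add: left_diff_distrib add_divide_distrib diff_divide_distrib)
    hence "exp (- y * (u + inverse u) / 2) \<le> exp (1 - y) * exp (- 1 * (u + inverse u) / 2)"
      by (subst exp_add[symmetric], subst exp_le_cancel_iff)
    thus "bessel_integrand v y u \<le> exp (1 - y) * bessel_integrand v 1 u"
      using u unfolding bessel_integrand_def times_divide_eq_right mult.assoc[symmetric]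
      by (intro divide_right_mono mult_right_mono) auto
  qed (use assms in \<open>auto intro!: set_integrable_bessel_integrand\<close>)
  thus ?thesis using assms by (simp add: bessel_K_eq)
qed

text \<open>The derivative of \<open>exp (- y (u + 1/u) / 2) u^v\<close> integrates to 0 over the
  half line, because the function vanishes at both ends.\<close>

lemma bessel_K_recurrence:
  assumes "y > 0" shows "y * (bessel_K (v + 1) y - bessel_K (v - 1) y) = 2 * v * bessel_K v y"
proof -
  define G where "G = (\<lambda>u::real. exp (- y * (u + inverse u) / 2) * u powi v)"
  define G' where "G' = (\<lambda>u. v * bessel_integrand v y u - y / 2 * (bessel_integrand (v + 1) y u - bessel_integrand (v - 1) y u))"
  note int = set_integrable_bessel_integrand[OF assms]
  have I: "set_integrable lborel {0<..} G'"
    unfolding G'_def by (intro set_integral_diff set_integrable_mult_right impI int)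
  have ei: "einterval 0 \<infinity> = {0<..}" by (auto simp: einterval_def)
  have "(LBINT u=0..\<infinity>. G' u) = 0 - 0"
  proof (rule interval_integral_FTC_integrable[where F = G])
    show "(G has_vector_derivative G' u) (at u)" if "0 < ereal u" for u
    proof -
      have u: "u > 0" using that by simp
      have "(G has_real_derivative (exp (- y * (u + inverse u) / 2) * (- y * (1 - inverse u ^ 2) / 2) * u powi v
           + exp (- y * (u + inverse u) / 2) * (v * u powi (v - 1)))) (at u)"
        unfolding G_def using u
        by (auto intro!: derivative_eq_intros simp: power2_eq_square algebra_simps add_divide_distrib diff_divide_distrib)
      moreover have "exp (- y * (u + inverse u) / 2) * (- y * (1 - inverse u ^ 2) / 2) * u powi v
           + exp (- y * (u + inverse u) / 2) * (v * u powi (v - 1)) = G' u"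
        using u unfolding G'_def bessel_integrand_alt[OF u]
        by (simp add: power_int_diff power_int_add field_simps power2_eq_square)
      ultimately show ?thesis by (simp add: has_real_derivative_iff_has_vector_derivative)
    qed
    show "isCont G' u" if "0 < ereal u" for u
      using that unfolding G'_def bessel_integrand_def by (auto intro!: continuous_intros)
    show "set_integrable lborel (einterval 0 \<infinity>) G'" using I by (simp add: ei)
    obtain M where M: "M \<ge> 0" "\<And>u::real. u > 0 \<Longrightarrow> exp (- y * (u + inverse u) / 2) * u powi v \<le> M * exp (- (y / 4) * u)"
      using exp_powi_bound[OF assms] by blast
    obtain M' where M': "M' \<ge> 0" "\<And>u::real. u > 0 \<Longrightarrow> exp (- y * (u + inverse u) / 2) * u powi (v - 1) \<le> M' * exp (- (y / 4) * u)"
      using exp_powi_bound[OF assms] by blast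
    \<comment> \<open>\<open>G\<close> is \<open>u\<close> times the same expression with exponent v
      - 1, which is bounded.\<close>
    have "(G \<longlongrightarrow> 0) (at_right 0)"
    proof (rule Lim_null_comparison)
      have "norm (G u) \<le> M' * u" if u: "u > 0" for u
      proof -
        have "norm (G u) = u * (exp (- y * (u + inverse u) / 2) * u powi (v - 1))"
          using u by (simp add: G_def power_int_diff)
        also have "\<dots> \<le> u * (M' * exp (- (y / 4) * u))" using M'(2)[OF u] u by (intro mult_left_mono) auto
        also have "\<dots> \<le> u * (M' * 1)" using u M'(1) assms by (intro mult_left_mono) auto
        finally show ?thesis by (simp add: mult.commute)
      qed
      thus "\<forall>\<^sub>F u in at_right 0. norm (G u) \<le> M' * u"
        by (auto simp: eventually_at_right_field intro!: exI[of _ 1])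
      show "((\<lambda>u. M' * u) \<longlongrightarrow> 0) (at_right 0)"
        by (rule tendsto_eq_intros refl tendsto_ident_at)+ simp
    qed
    thus "((G \<circ> real_of_ereal) \<longlongrightarrow> 0) (at_right 0)"
      unfolding zero_ereal_def by (simp add: ereal_tendsto_simps)
    have "(G \<longlongrightarrow> 0) at_top"
    proof (rule Lim_null_comparison)
      show "\<forall>\<^sub>F u in at_top. norm (G u) \<le> M * exp (- (y / 4) * u)"
        using eventually_gt_at_top[of 0] by eventually_elim (use M(2) in \<open>simp add: G_def\<close>)
      have "filterlim (\<lambda>u. - (y / 4) * u) at_bot at_top"
        using assms by (intro filterlim_tendsto_neg_mult_at_bot[OF tendsto_const] filterlim_ident) auto
      from filterlim_compose[OF exp_at_bot this]
      show "((\<lambda>u. M * exp (- (y / 4) * u)) \<longlongrightarrow> 0) at_top"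
        by (rule tendsto_mult_right_zero)
    qed
    thus "((G \<circ> real_of_ereal) \<longlongrightarrow> 0) (at_left \<infinity>)"
      by (simp add: ereal_tendsto_simps)
  qed auto
  hence "(LINT u:{0<..}|lborel. G' u) = 0"
    by (simp add: interval_lebesgue_integral_def ei)
  hence "v * (LINT u:{0<..}|lborel. bessel_integrand v y u) = y / 2 * ((LINT u:{0<..}|lborel. bessel_integrand (v+1) y u) - (LINT u:{0<..}|lborel. bessel_integrand (v-1) y u))"
    unfolding G'_def using int by (simp add: set_integral_diff)
  thus ?thesis by (simp add: bessel_K_eq[OF assms] algebra_simps)
qed

lemma exp_minus_second_order:
  fixes x :: real shows "\<bar>exp x - 1 - x\<bar> \<le> x\<^sup>2 * exp \<bar>x\<bar>"
proof (cases "x = 0")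
  case False
  then obtain t where t: "\<bar>t\<bar> \<le> \<bar>x\<bar>" "exp x = (\<Sum>m<2. x ^ m / fact m) + exp t / fact 2 * x ^ 2"
    using Maclaurin_exp_le[of x 2] by blast
  have "\<bar>exp x - 1 - x\<bar> = exp t / 2 * x\<^sup>2"
    using t(2) by (simp add: numeral_2_eq_2 abs_mult)
  also have "\<dots> \<le> exp \<bar>x\<bar> * x\<^sup>2"
    using t(1) by (intro mult_right_mono) (auto intro!: order_trans[of "exp t" "exp \<bar>x\<bar>" "exp \<bar>x\<bar> * 2"])
  finally show ?thesis by (simp add: mult.commute)
qed auto

text \<open>Differentiation under the integral sign with an explicit error: for |h| < y/2 the
  second-order remainder of the integrand is at most h^2 times an integrable function, so the
  difference quotient is within O(h) of \<open>D\<close>.\<close>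

lemma bessel_K_deriv:
  assumes y: "y > 0"
  shows "((\<lambda>y. bessel_K v y) has_real_derivative - (bessel_K (v + 1) y + bessel_K (v - 1) y) / 2) (at y)"
proof -
  define D where "D = - (bessel_K (v + 1) y + bessel_K (v - 1) y) / 2"
  \<comment> \<open>With z = (u + 1/u)/2 this is \<open>4 z^2 exp (- (y/2) z) u^(v-1)\<close>
    expanded into Bessel integrands; the argument y/2 is what remains of \<open>exp (- y z)\<close>
    after the loss of \<open>exp (|h| z)\<close>.\<close>
  define R where "R = (\<lambda>u. bessel_integrand (v + 2) (y/2) u + 2 * bessel_integrand v (y/2) u + bessel_integrand (v - 2) (y/2) u)"
  define M where "M = (LINT u:{0<..}|lborel. R u) / 8"
  have y2: "y / 2 > 0" using y by simp
  have RI: "set_integrable lborel {0<..} R"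
    unfolding R_def by (intro set_integral_add set_integrable_mult_right impI set_integrable_bessel_integrand y2)
  have est: "\<bar>bessel_K v (y + h) - bessel_K v y - h * D\<bar> \<le> M * h\<^sup>2" if h: "\<bar>h\<bar> < y / 2" for h
  proof -
    have yh: "y + h > 0" using h by linarith
    define E where "E = (\<lambda>u. bessel_integrand v (y+h) u - bessel_integrand v y u + h / 2 * (bessel_integrand (v+1) y u + bessel_integrand (v-1) y u))"
    have EI: "set_integrable lborel {0<..} E"
      unfolding E_def by (intro set_integral_add set_integral_diff set_integrable_mult_right impI set_integrable_bessel_integrand y yh)
    have "2 * (bessel_K v (y + h) - bessel_K v y - h * D) = (LINT u:{0<..}|lborel. E u)"
      unfolding E_def D_def bessel_K_eq[OF y] bessel_K_eq[OF yh] using set_integrable_bessel_integrand[OF y] set_integrable_bessel_integrand[OF yh]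
      by (simp add: set_integral_add set_integral_diff field_simps)
    hence "2 * \<bar>bessel_K v (y + h) - bessel_K v y - h * D\<bar> = \<bar>LINT u:{0<..}|lborel. E u\<bar>"
      by (metis abs_mult abs_numeral)
    also have "\<dots> \<le> (LINT u:{0<..}|lborel. \<bar>E u\<bar>)"
      using set_integral_norm_bound[OF EI] by simp
    also have "\<dots> \<le> (LINT u:{0<..}|lborel. h\<^sup>2 / 4 * R u)"
    proof (rule set_integral_mono)
      show "set_integrable lborel {0<..} (\<lambda>x. \<bar>E x\<bar>)" using set_integrable_abs[OF EI] .
      show "set_integrable lborel {0<..} (\<lambda>x. h\<^sup>2 / 4 * R x)" using RI by auto
      fix u :: real assume "u \<in> {0<..}"
      hence u: "u > 0" by simp
      define z where "z = (u + inverse u) / 2"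
      have z: "z > 0" using u by (simp add: z_def add_pos_pos)
      define B where "B = u powi v / u"
      have B: "B > 0" using u by (simp add: B_def)
      have b: "bessel_integrand w x u = exp (- x * z) * (u powi w / u)" for w x
        by (simp add: bessel_integrand_def z_def)
      have "bessel_integrand (v+1) y u + bessel_integrand (v-1) y u = 2 * z * exp (- y * z) * B"
        using u unfolding b z_def B_def by (simp add: power_int_add power_int_diff field_simps)
      hence "E u = (exp (- (y + h) * z) - exp (- y * z) + h * z * exp (- y * z)) * B"
        unfolding E_def b[of v] B_def[symmetric] by (simp add: algebra_simps)
      also have "exp (- (y + h) * z) = exp (- y * z) * exp (- h * z)" by (simp add: algebra_simps flip: exp_add)
      finally have "E u = exp (- y * z) * (exp (- h * z) - 1 - (- h * z)) * B" by (simp add: algebra_simps)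
      hence "\<bar>E u\<bar> = exp (- y * z) * \<bar>exp (- h * z) - 1 - (- h * z)\<bar> * B" using B by (simp add: abs_mult)
      also have "\<dots> \<le> exp (- y * z) * ((- h * z)\<^sup>2 * exp \<bar>- h * z\<bar>) * B"
        using B by (intro mult_right_mono mult_left_mono exp_minus_second_order) auto
      also have "\<dots> \<le> exp (- y * z) * ((- h * z)\<^sup>2 * exp (y / 2 * z)) * B"
        using B h z by (intro mult_right_mono mult_left_mono) (auto simp: abs_mult)
      also have "\<dots> = h\<^sup>2 * (z\<^sup>2 * (exp (- y * z) * exp (y / 2 * z)) * B)"
        by (simp add: power_mult_distrib)
      also have "exp (- y * z) * exp (y / 2 * z) = exp (- (y / 2) * z)" by (simp flip: exp_add)
      also have "z\<^sup>2 * exp (- (y / 2) * z) * B = R u / 4"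
        using u unfolding R_def b B_def z_def by (simp add: power_int_add power_int_diff power2_eq_square field_simps)
      finally show "\<bar>E u\<bar> \<le> h\<^sup>2 / 4 * R u" by simp
    qed
    finally show ?thesis by (simp add: M_def mult.commute)
  qed
  have "((\<lambda>h. (bessel_K v (y + h) - bessel_K v y) / h) \<longlongrightarrow> D) (at 0)"
  proof (rule LIM_zero_cancel, rule Lim_null_comparison)
    show "\<forall>\<^sub>F h in at 0. norm ((bessel_K v (y + h) - bessel_K v y) / h - D) \<le> M * \<bar>h\<bar>"
      unfolding eventually_at
    proof (intro exI[of _ "y/2"] conjI ballI impI)
      fix h :: real assume h: "h \<noteq> 0 \<and> dist h 0 < y / 2"
      have "norm ((bessel_K v (y + h) - bessel_K v y) / h - D) = \<bar>bessel_K v (y + h) - bessel_K v y - h * D\<bar> / \<bar>h\<bar>"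
        using h by (simp add: field_simps flip: abs_divide)
      also have "\<dots> \<le> M * h\<^sup>2 / \<bar>h\<bar>" using est[of h] h by (intro divide_right_mono) auto
      also have "\<dots> = M * \<bar>h\<bar>" using h by (simp add: power2_eq_square field_simps abs_if)
      finally show "norm ((bessel_K v (y + h) - bessel_K v y) / h - D) \<le> M * \<bar>h\<bar>" .
    qed (use y in auto)
    show "((\<lambda>h. M * \<bar>h\<bar>) \<longlongrightarrow> 0) (at 0)"
      by (rule tendsto_eq_intros refl tendsto_ident_at)+ simp
  qed
  thus ?thesis unfolding D_def DERIV_def .
qed

lemma bessel_K1_neg: "y > 0 \<Longrightarrow> bessel_K (-1) y = bessel_K 1 y"
  using bessel_K_recurrence[of y 0] by simp

lemma bessel_K0_deriv: "y > 0 \<Longrightarrow> (bessel_K 0 has_real_derivative - bessel_K 1 y) (at y)"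
  using bessel_K_deriv[of y 0] bessel_K1_neg[of y] by simp

lemma bessel_K1_deriv:
  assumes "y > 0" shows "(bessel_K 1 has_real_derivative - bessel_K 0 y - bessel_K 1 y / y) (at y)"
proof -
  have "bessel_K 2 y = bessel_K 0 y + 2 / y * bessel_K 1 y"
    using bessel_K_recurrence[OF assms, of 1] assms by (simp add: field_simps)
  hence *: "- (bessel_K (1 + 1) y + bessel_K (1 - 1) y) / 2 = - bessel_K 0 y - bessel_K 1 y / y" by simp
  show ?thesis using bessel_K_deriv[OF assms, of 1] unfolding * .
qed

text \<open>The derivative of \<open>y K_1(y)\<close> is \<open>- y K_0(y) < 0\<close>, so
  \<open>y K_1(y)\<close> decreases. This is the blow-up at 0 that forces F to vanish when
  \<open>\<eta>\<close> is negative.\<close>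

lemma bessel_K1_lower:
  assumes "0 < y" "y \<le> 1" shows "bessel_K 1 y \<ge> bessel_K 1 1 / y"
proof -
  have "1 * bessel_K 1 1 \<le> y * bessel_K 1 y"
  proof (rule DERIV_nonpos_imp_nonincreasing[OF assms(2)])
    fix x assume "y \<le> x" "x \<le> 1"
    hence x: "x > 0" using assms by simp
    have "((\<lambda>x. x * bessel_K 1 x) has_real_derivative - x * bessel_K 0 x) (at x)"
      using x by (auto intro!: derivative_eq_intros bessel_K1_deriv[OF x] simp: field_simps)
    moreover have "- x * bessel_K 0 x \<le> 0" using x bessel_K_pos[OF x, of 0] by simp
    ultimately show "\<exists>y. ((\<lambda>x. x * bessel_K 1 x) has_real_derivative y) (at x) \<and> y \<le> 0" by blast
  qed
  thus ?thesis using assms by (simp add: field_simps)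
qed

section \<open>Boosts and rotations of a quadratic space\<close>

lemma matrix_eqI:
  fixes A B :: "real^'n^'m" assumes "\<And>v. A *v v = B *v v" shows "A = B"
  using assms matrix_eq by blast

lemma matrix_mult_algebra:
  fixes A A' :: "real^'k^'m" and B B' :: "real^'n^'k"
  shows "(A + A') ** B = A ** B + A' ** B" "A ** (B + B') = A ** B + A ** B'"
    "(A - A') ** B = A ** B - A' ** B" "A ** (B - B') = A ** B - A ** B'"
    "(c *\<^sub>R A) ** B = c *\<^sub>R (A ** B)" "A ** (c *\<^sub>R B) = c *\<^sub>R (A ** B)"
    "A ** 0 = 0" "0 ** B = 0"
  by (simp_all add: matrix_matrix_mult_def vec_eq_iff algebra_simps sum.distrib sum_subtractf sum_distrib_left)

lemma matrix_vector_algebra: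
  fixes A A' :: "real^'k^'m"
  shows "(A + A') *v v = A *v v + A' *v v" "(A - A') *v v = A *v v - A' *v v"
    "(c *\<^sub>R A) *v v = c *\<^sub>R (A *v v)" "(- A) *v v = - (A *v v)"
    "A *v (v + w) = A *v v + A *v w" "A *v (v - w) = A *v v - A *v w"
    "A *v (c *\<^sub>R v) = c *\<^sub>R (A *v v)" "A *v (- v) = - (A *v v)"
  by (simp_all add: matrix_vector_mult_def vec_eq_iff algebra_simps sum.distrib sum_subtractf sum_distrib_left sum_negf)

lemma linear_matrix_mult_left: "linear (\<lambda>X :: real^'n^'k. (A :: real^'k^'m) ** X)"
  by (rule linearI) (simp_all add: matrix_mult_algebra)

text \<open>Interpreted twice, for \<open>q\<close> on V' and for \<open>hyp q\<close> on V, so that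
  boosts and rotations are developed once for both.\<close>

locale qform =
  fixes q :: "real^'k \<Rightarrow> real"
  assumes qf: "quadratic_form q"
    and nondeg: "\<And>x. (\<And>y. polar q x y = 0) \<Longrightarrow> x = 0"
begin

lemma polar_bilinear: "bilinear (polar q)" using qf by (simp add: quadratic_form_def)

lemma polar_commute: "polar q x y = polar q y x" by (simp add: polar_def add.commute)

lemmas polar_simps =
  bilinear_ladd[OF polar_bilinear] bilinear_radd[OF polar_bilinear]
  bilinear_lsub[OF polar_bilinear] bilinear_rsub[OF polar_bilinear]
  bilinear_lmul[OF polar_bilinear] bilinear_rmul[OF polar_bilinear]
  bilinear_lneg[OF polar_bilinear] bilinear_rneg[OF polar_bilinear]
  bilinear_lzero[OF polar_bilinear] bilinear_rzero[OF polar_bilinear]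

lemma q_scale: "q (c *\<^sub>R x) = c\<^sup>2 * q x" using qf by (simp add: quadratic_form_def)

lemma polar_self: "polar q x x = 2 * q x"
  using q_scale[of 2 x] by (simp add: polar_def scaleR_2)

lemma q_polar: "q x = polar q x x / 2" by (simp add: polar_self)

lemma linear_polar: "linear (polar q x)" using polar_bilinear by (simp add: bilinear_def)

lemma wedge_mult: "wedge q a b *v v = polar q b v *\<^sub>R a - polar q a v *\<^sub>R b"
proof -
  have "linear (\<lambda>v. polar q b v *\<^sub>R a - polar q a v *\<^sub>R b)"
    by (rule linearI) (simp_all add: polar_simps algebra_simps)
  thus ?thesis by (simp add: wedge_def matrix_works)
qed

lemma wedge_add_left: "wedge q (a + a') b = wedge q a b + wedge q a' b"
  by (rule matrix_eqI) (simp add: wedge_mult matrix_vector_algebra polar_simps algebra_simps)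

lemma wedge_scale_left: "wedge q (c *\<^sub>R a) b = c *\<^sub>R wedge q a b"
  by (rule matrix_eqI) (simp add: wedge_mult matrix_vector_algebra polar_simps algebra_simps)

lemma wedge_scale_right: "wedge q a (c *\<^sub>R b) = c *\<^sub>R wedge q a b"
  by (rule matrix_eqI) (simp add: wedge_mult matrix_vector_algebra polar_simps algebra_simps)

text \<open>With J the Gram matrix, invariance of the form reads \<open>g^T J g = J\<close>, and
  non-degeneracy makes J invertible. The sign of the determinant stays open here;
  \<open>SO_square\<close> settles it where needed.\<close>

lemma det_square_eq_1:
  assumes "\<And>v. q (g *v v) = q v" shows "(det g)\<^sup>2 = 1"
proof -
  define J :: "real^'k^'k" where "J = (\<chi> i j. polar q (axis i 1) (axis j 1))"
  have lin1: "linear (\<lambda>x. polar q x y)" for y using polar_bilinear by (simp add: bilinear_def)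
  have J: "polar q x y = x \<bullet> (J *v y)" for x y
  proof -
    have "polar q x y = polar q (\<Sum>i\<in>UNIV. x $ i *\<^sub>R axis i 1) (\<Sum>j\<in>UNIV. y $ j *\<^sub>R axis j 1)"
      using basis_expansion[of x] basis_expansion[of y] by (simp add: scalar_mult_eq_scaleR)
    also have "\<dots> = (\<Sum>i\<in>UNIV. x $ i * (\<Sum>j\<in>UNIV. y $ j * polar q (axis i 1) (axis j 1)))"
      by (simp only: linear_sum[OF lin1]) (simp add: linear_sum[OF linear_polar] polar_simps sum_distrib_left mult.left_commute)
    also have "\<dots> = x \<bullet> (J *v y)"
      by (simp add: inner_vec_def matrix_vector_mult_def J_def mult.commute)
    finally show ?thesis .
  qed
  have "invertible J"
    unfolding invertible_left_inverse matrix_left_invertible_ker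
  proof (intro allI impI)
    fix y assume "J *v y = 0"
    hence "polar q y x = 0" for x using J[of x y] by (simp add: polar_commute)
    thus "y = 0" by (rule nondeg)
  qed
  hence dJ: "det J \<noteq> 0" by (simp add: invertible_det_nz)
  have pr: "polar q (g *v x) (g *v y) = polar q x y" for x y
    using assms[of "x + y"] assms[of x] assms[of y] by (simp add: polar_def matrix_vector_right_distrib)
  have "transpose g ** J ** g = J"
  proof (rule matrix_eqI)
    fix y
    have "x \<bullet> ((transpose g ** J ** g) *v y) = x \<bullet> (J *v y)" for x
    proof -
      have "x \<bullet> ((transpose g ** J ** g) *v y) = x \<bullet> (transpose g *v (J *v (g *v y)))"
        by (simp add: matrix_vector_mul_assoc matrix_mul_assoc)
      also have "\<dots> = (g *v x) \<bullet> (J *v (g *v y))"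
        using dot_lmul_matrix[of x "transpose g" "J *v (g *v y)"]
        by (simp add: vector_transpose_matrix)
      finally show ?thesis by (simp add: pr J[symmetric])
    qed
    thus "(transpose g ** J ** g) *v y = J *v y" by (metis vector_eq_rdot inner_commute)
  qed
  hence "det (transpose g ** J ** g) = det J" by simp
  thus ?thesis using dJ by (simp add: det_mul power2_eq_square)
qed

lemma SO_polar: "g \<in> SO q \<Longrightarrow> polar q (g *v x) (g *v y) = polar q x y"
  by (simp add: SO_def polar_def flip: matrix_vector_right_distrib)

lemma SO_mult: "g \<in> SO q \<Longrightarrow> h \<in> SO q \<Longrightarrow> g ** h \<in> SO q"
  by (simp add: SO_def det_mul flip: matrix_vector_mul_assoc)

lemma SO_one: "mat 1 \<in> SO q" by (simp add: SO_def)

lemma SO_inv: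
  assumes "g \<in> SO q"
  shows "matrix_inv g \<in> SO q" "matrix_inv g ** g = mat 1" "g ** matrix_inv g = mat 1"
proof -
  have "invertible g" using assms by (simp add: SO_def invertible_det_nz)
  hence "\<exists>h. g ** h = mat 1 \<and> h ** g = mat 1" by (simp add: invertible_def)
  from someI_ex[OF this] show 1: "matrix_inv g ** g = mat 1" "g ** matrix_inv g = mat 1"
    by (simp_all add: matrix_inv_def)
  have "det (matrix_inv g) * det g = 1" by (simp add: 1 flip: det_mul)
  moreover have "q (matrix_inv g *v v) = q v" for v
  proof -
    have "q (g *v (matrix_inv g *v v)) = q (matrix_inv g *v v)" using assms by (simp add: SO_def)
    thus ?thesis by (simp add: matrix_vector_mul_assoc 1)
  qed
  ultimately show "matrix_inv g \<in> SO q" using assms by (simp add: SO_def)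
qed

text \<open>Replaces a connectedness argument: a member of a one-parameter group is the square of
  the member at half the parameter, so its determinant is a square of 1 or -1.\<close>

lemma SO_square:
  assumes "\<And>v. q (g *v v) = q v" shows "g ** g \<in> SO q"
  using assms det_square_eq_1[of g]
  by (simp add: SO_def det_mul power2_eq_square flip: matrix_vector_mul_assoc)

text \<open>Since \<open>(a \<and> b)\<^sup>3 = - (a, a)(b, b) (a \<and> b)\<close> for orthogonal \<open>a, b\<close>, the exponentials of
  multiples of \<open>a \<and> b\<close> all have this shape.\<close>
definition rot :: "real^'k \<Rightarrow> real^'k \<Rightarrow> real \<Rightarrow> real \<Rightarrow> real^'k^'k" where
  "rot a b \<sigma> \<kappa> = mat 1 + \<sigma> *\<^sub>R wedge q a b + \<kappa> *\<^sub>R (wedge q a b ** wedge q a b)"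

lemma rot_mult:
  assumes "polar q a b = 0"
  shows "rot a b \<sigma> \<kappa> *v v = v + \<sigma> *\<^sub>R (polar q b v *\<^sub>R a - polar q a v *\<^sub>R b)
     - \<kappa> *\<^sub>R ((polar q a a * polar q b v) *\<^sub>R b + (polar q b b * polar q a v) *\<^sub>R a)"
  using assms
  by (simp add: rot_def matrix_vector_algebra matrix_vector_algebra
      matrix_vector_mul_assoc[symmetric] wedge_mult polar_simps polar_commute[of b a] algebra_simps)

text \<open>One condition covers three cases: it is \<open>cosh^2 - sinh^2 = 1\<close> when
  \<open>(a,a)(b,b) = -1\<close>, \<open>cos^2 + sin^2 = 1\<close> when the product is 1, and
  \<open>\<kappa> = \<sigma>^2 / 2\<close> when it is 0, as for \<open>nmat\<close>.\<close>

lemma rot_polar: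
  assumes "polar q a b = 0" "2 * \<kappa> - polar q a a * polar q b b * \<kappa>\<^sup>2 = \<sigma>\<^sup>2"
  shows "polar q (rot a b \<sigma> \<kappa> *v v) (rot a b \<sigma> \<kappa> *v v) = polar q v v"
proof -
  define A where "A = polar q a v"
  define C where "C = polar q b v"
  define \<alpha> where "\<alpha> = polar q a a"
  define \<beta> where "\<beta> = polar q b b"
  have "rot a b \<sigma> \<kappa> *v v = v + (\<sigma> * C - \<kappa> * \<beta> * A) *\<^sub>R a + (- \<sigma> * A - \<kappa> * \<alpha> * C) *\<^sub>R b"
    by (simp add: rot_mult[OF assms(1)] A_def C_def \<alpha>_def \<beta>_def algebra_simps)
  moreover have "polar q (v + x *\<^sub>R a + y *\<^sub>R b) (v + x *\<^sub>R a + y *\<^sub>R b)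
      = polar q v v + x * (2 * A + x * \<alpha>) + y * (2 * C + y * \<beta>)" for x y
    using assms(1)
    by (simp add: polar_simps polar_commute[of b a] polar_commute[of v a] polar_commute[of v b] A_def C_def \<alpha>_def \<beta>_def distrib_left)
  ultimately have "polar q (rot a b \<sigma> \<kappa> *v v) (rot a b \<sigma> \<kappa> *v v) = polar q v v
     + (\<sigma> * C - \<kappa> * \<beta> * A) * (2 * A + (\<sigma> * C - \<kappa> * \<beta> * A) * \<alpha>)
     + (- \<sigma> * A - \<kappa> * \<alpha> * C) * (2 * C + (- \<sigma> * A - \<kappa> * \<alpha> * C) * \<beta>)"
    by simp
  also have "\<dots> = polar q v v + (\<sigma>\<^sup>2 - (2 * \<kappa> - \<alpha> * \<beta> * \<kappa>\<^sup>2)) * (\<alpha> * C\<^sup>2 + \<beta> * A\<^sup>2)"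
    by algebra
  finally show ?thesis using assms(2) by (simp add: \<alpha>_def \<beta>_def)
qed

lemma wedge_cube:
  assumes "polar q a b = 0"
  shows "wedge q a b ** wedge q a b ** wedge q a b = (- (polar q a a * polar q b b)) *\<^sub>R wedge q a b"
  using assms
  by (intro matrix_eqI) (simp add: matrix_vector_mul_assoc[symmetric] wedge_mult polar_simps polar_commute[of b a]
      matrix_vector_algebra algebra_simps)

lemma rot_compose:
  fixes a b
  defines "\<mu> \<equiv> - (polar q a a * polar q b b)"
  assumes "polar q a b = 0"
  shows "rot a b s1 k1 ** rot a b s2 k2
    = rot a b (s1 + s2 + \<mu> * (s1 * k2 + k1 * s2)) (k1 + k2 + s1 * s2 + \<mu> * k1 * k2)"
proof -
  let ?X = "wedge q a b"
  have 3: "?X ** ?X ** ?X = \<mu> *\<^sub>R ?X" "?X ** (?X ** ?X) = \<mu> *\<^sub>R ?X"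
    using wedge_cube[OF assms(2)] by (simp_all add: \<mu>_def matrix_mul_assoc)
  have 4: "(?X ** ?X) ** (?X ** ?X) = \<mu> *\<^sub>R (?X ** ?X)"
    by (simp add: matrix_mul_assoc 3 matrix_mult_algebra)
  show ?thesis
    by (simp add: rot_def matrix_mult_algebra 3 4 algebra_simps)
qed

lemma rot_zero: "rot a b 0 0 = mat 1" by (simp add: rot_def)

definition boost :: "real^'k \<Rightarrow> real^'k \<Rightarrow> real \<Rightarrow> real^'k^'k" where
  "boost a b s = rot a b (sinh s) (cosh s - 1)"

definition turn :: "real^'k \<Rightarrow> real^'k \<Rightarrow> real \<Rightarrow> real^'k^'k" where
  "turn a b s = rot a b (sin s) (1 - cos s)"

lemma boost_zero: "boost a b 0 = mat 1" by (simp add: boost_def rot_zero)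
lemma turn_zero: "turn a b 0 = mat 1" by (simp add: turn_def rot_zero)

lemma boost_add:
  assumes "polar q a b = 0" "polar q a a * polar q b b = -1"
  shows "boost a b s ** boost a b t = boost a b (s + t)"
  using assms by (simp add: boost_def rot_compose sinh_add cosh_add algebra_simps)

lemma turn_add:
  assumes "polar q a b = 0" "polar q a a * polar q b b = 1"
  shows "turn a b s ** turn a b t = turn a b (s + t)"
proof -
  have *: "sin s + sin t + - 1 * (sin s * (1 - cos t) + (1 - cos s) * sin t) = sin (s + t)"
    "(1 - cos s) + (1 - cos t) + sin s * sin t + - 1 * (1 - cos s) * (1 - cos t) = 1 - cos (s + t)"
    unfolding sin_add cos_add by algebra+
  show ?thesis unfolding turn_def rot_compose[OF assms(1)] assms(2) * ..
qed

lemma boost_SO: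
  assumes "polar q a b = 0" "polar q a a * polar q b b = -1"
  shows "boost a b s \<in> SO q"
proof -
  have d2: "(sinh (s/2))\<^sup>2 = (cosh (s/2))\<^sup>2 - 1" by (simp only: cosh_square_eq)
  have "2 * (c - 1) - -1 * (c - 1)\<^sup>2 = c\<^sup>2 - 1" for c :: real by (simp add: power2_diff)
  hence "2 * (cosh (s/2) - 1) - polar q a a * polar q b b * (cosh (s/2) - 1)\<^sup>2 = (sinh (s/2))\<^sup>2"
    by (simp only: assms(2) d2)
  hence "q (rot a b (sinh (s/2)) (cosh (s/2) - 1) *v v) = q v" for v
    using rot_polar[OF assms(1)] by (simp only: q_polar)
  hence "boost a b (s/2) ** boost a b (s/2) \<in> SO q"
    unfolding boost_def by (rule SO_square)
  thus ?thesis by (simp only: boost_add[OF assms] field_sum_of_halves)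
qed

lemma turn_SO:
  assumes "polar q a b = 0" "polar q a a * polar q b b = 1"
  shows "turn a b s \<in> SO q"
proof -
  have d2: "(sin (s/2))\<^sup>2 = 1 - (cos (s/2))\<^sup>2" by (rule sin_squared_eq)
  have "2 * (1 - c) - 1 * (1 - c)\<^sup>2 = 1 - c\<^sup>2" for c :: real by (simp add: power2_diff)
  hence "2 * (1 - cos (s/2)) - polar q a a * polar q b b * (1 - cos (s/2))\<^sup>2 = (sin (s/2))\<^sup>2"
    by (simp only: assms(2) d2)
  hence "q (rot a b (sin (s/2)) (1 - cos (s/2)) *v v) = q v" for v
    using rot_polar[OF assms(1)] by (simp only: q_polar)
  hence "turn a b (s/2) ** turn a b (s/2) \<in> SO q"
    unfolding turn_def by (rule SO_square)
  thus ?thesis by (simp only: turn_add[OF assms] field_sum_of_halves)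
qed

lemma boost_deriv:
  assumes "polar q a b = 0" "polar q a a * polar q b b = -1"
  shows "(boost a b has_vector_derivative boost a b s ** wedge q a b) (at s)"
proof -
  let ?X = "wedge q a b"
  have 3: "?X ** ?X ** ?X = ?X" using wedge_cube[OF assms(1)] by (simp add: assms(2))
  have "(boost a b has_vector_derivative cosh s *\<^sub>R ?X + sinh s *\<^sub>R (?X ** ?X)) (at s)"
    unfolding boost_def rot_def
    by (auto intro!: derivative_eq_intros simp: has_vector_derivative_def scaleR_add_right mult.commute)
  moreover have "cosh s *\<^sub>R ?X + sinh s *\<^sub>R (?X ** ?X) = boost a b s ** ?X"
    by (simp add: boost_def rot_def matrix_mult_algebra 3 algebra_simps)
  ultimately show ?thesis by simp
qed

lemma turn_deriv0: "(turn a b has_vector_derivative wedge q a b) (at 0)"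
  unfolding turn_def rot_def
  by (auto intro!: derivative_eq_intros simp: has_vector_derivative_def)

text \<open>Since X^3 = X, the eigenvalues are 0, 1, -1 with spectral projections
  \<open>1 - X^2\<close>, \<open>(X^2 + X)/2\<close>, \<open>(X^2 - X)/2\<close>. Powers of sX are
  then explicit, and the series reduces to those of \<open>exp s\<close> and
  \<open>exp (- s)\<close>.\<close>

lemma mexp_wedge_unit:
  assumes "polar q a b = 0" "polar q a a * polar q b b = -1"
  shows "mexp (s *\<^sub>R wedge q a b) = boost a b s"
proof -
  let ?X = "wedge q a b"
  have 3: "?X ** (?X ** ?X) = ?X" using wedge_cube[OF assms(1)] by (simp add: assms(2) matrix_mul_assoc)
  have pw: "(((**) (s *\<^sub>R ?X)) ^^ j) (mat 1) =
      (if j = 0 then mat 1 - ?X ** ?X else 0)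
      + (s ^ j - (- s) ^ j) *\<^sub>R (?X /\<^sub>R 2) + (s ^ j + (- s) ^ j) *\<^sub>R ((?X ** ?X) /\<^sub>R 2)" for j
  proof (induction j)
    case (Suc j)
    have "(((**) (s *\<^sub>R ?X)) ^^ Suc j) (mat 1) = (s *\<^sub>R ?X) ** (((**) (s *\<^sub>R ?X)) ^^ j) (mat 1)" by simp
    also have "\<dots> = (s ^ Suc j - (- s) ^ Suc j) *\<^sub>R (?X /\<^sub>R 2) + (s ^ Suc j + (- s) ^ Suc j) *\<^sub>R ((?X ** ?X) /\<^sub>R 2)"
      unfolding Suc by (simp add: matrix_mult_algebra 3 algebra_simps)
    finally show ?case by simp
  qed simp
  have "(\<lambda>j. (if j = 0 then mat 1 - ?X ** ?X else 0)
      + (s ^ j /\<^sub>R fact j - (- s) ^ j /\<^sub>R fact j) *\<^sub>R (?X /\<^sub>R 2) + (s ^ j /\<^sub>R fact j + (- s) ^ j /\<^sub>R fact j) *\<^sub>R ((?X ** ?X) /\<^sub>R 2))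
     sums ((mat 1 - ?X ** ?X) + (exp s - exp (- s)) *\<^sub>R (?X /\<^sub>R 2) + (exp s + exp (- s)) *\<^sub>R ((?X ** ?X) /\<^sub>R 2))"
    by (intro sums_add sums_scaleR_left sums_diff exp_converges) (use sums_single[of 0 "\<lambda>_. mat 1 - ?X ** ?X"] in simp)
  also have "(\<lambda>j. (if j = 0 then mat 1 - ?X ** ?X else 0)
      + (s ^ j /\<^sub>R fact j - (- s) ^ j /\<^sub>R fact j) *\<^sub>R (?X /\<^sub>R 2) + (s ^ j /\<^sub>R fact j + (- s) ^ j /\<^sub>R fact j) *\<^sub>R ((?X ** ?X) /\<^sub>R 2))
     = (\<lambda>j. (((**) (s *\<^sub>R ?X)) ^^ j) (mat 1) /\<^sub>R fact j)"
    unfolding pw by (rule ext) (simp add: algebra_simps)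
  finally have "mexp (s *\<^sub>R ?X) = (mat 1 - ?X ** ?X) + (exp s - exp (- s)) *\<^sub>R (?X /\<^sub>R 2) + (exp s + exp (- s)) *\<^sub>R ((?X ** ?X) /\<^sub>R 2)"
    by (simp add: mexp_def sums_iff)
  also have "exp s - exp (- s) = 2 * sinh s" by (simp add: sinh_def)
  also have "exp s + exp (- s) = 2 * cosh s" by (simp add: cosh_def)
  also have "mat 1 - ?X ** ?X + (2 * sinh s) *\<^sub>R (?X /\<^sub>R 2) + (2 * cosh s) *\<^sub>R ((?X ** ?X) /\<^sub>R 2) = boost a b s"
    by (simp add: boost_def rot_def scaleR_diff_left)
  finally show ?thesis .
qed

text \<open>Scaling \<open>b\<close> to norm -1 makes the generator a multiple of that of a boost.
  The case \<open>b = 0\<close> is included because the operator is contracted with all of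
  \<open>Vminus Vn\<close>.\<close>

lemma mexp_wedge:
  assumes "polar q a b = 0" "polar q a a = 1" "b = 0 \<or> polar q b b < 0"
  shows "mexp (s *\<^sub>R wedge q a b) \<in> SO q" "mexp (0 *\<^sub>R wedge q a b) = mat 1"
    "((\<lambda>s. mexp (s *\<^sub>R wedge q a b)) has_vector_derivative wedge q a b) (at 0)"
proof -
  have "\<exists>c a' b'. polar q a' b' = 0 \<and> polar q a' a' * polar q b' b' = -1 \<and> wedge q a b = c *\<^sub>R wedge q a' b'
     \<or> wedge q a b = 0"
  proof (cases "b = 0")
    case True
    have "wedge q a b = 0" unfolding True by (rule matrix_eqI) (simp add: wedge_mult polar_simps)
    thus ?thesis by blast
  next
    case False
    define c where "c = sqrt (- polar q b b)"
    have c: "c > 0" "polar q b b = - c\<^sup>2" using False assms(3) by (auto simp: c_def)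
    define b' where "b' = (1/c) *\<^sub>R b"
    have "polar q a b' = 0" using assms(1) by (simp add: b'_def polar_simps)
    moreover have "polar q a a * polar q b' b' = -1"
      using c assms(2) by (simp add: b'_def polar_simps field_simps power2_eq_square)
    moreover have "wedge q a b = c *\<^sub>R wedge q a b'"
      using c by (simp add: b'_def wedge_scale_right)
    ultimately show ?thesis by blast
  qed
  then consider (unit) c a' b' where "polar q a' b' = 0" "polar q a' a' * polar q b' b' = -1" "wedge q a b = c *\<^sub>R wedge q a' b'"
    | (zero) "wedge q a b = 0" by blast
  hence "mexp (s *\<^sub>R wedge q a b) \<in> SO q \<and> mexp (0 *\<^sub>R wedge q a b) = mat 1 \<and>
    ((\<lambda>s. mexp (s *\<^sub>R wedge q a b)) has_vector_derivative wedge q a b) (at 0)"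
  proof cases
    case unit
    have e: "mexp (s *\<^sub>R wedge q a b) = boost a' b' (c * s)" for s
      using mexp_wedge_unit[OF unit(1,2), of "c * s"] by (simp add: unit(3) mult.commute)
    have "((boost a' b' \<circ> (\<lambda>s. c * s)) has_vector_derivative c *\<^sub>R (boost a' b' (c * 0) ** wedge q a' b')) (at 0)"
      by (rule vector_diff_chain_at[OF _ boost_deriv[OF unit(1,2)]])
         (auto intro!: derivative_eq_intros simp: has_real_derivative_iff_has_vector_derivative[symmetric])
    thus ?thesis using boost_SO[OF unit(1,2)]
      unfolding e by (simp add: boost_zero unit(3) o_def)
  next
    case zero
    have "mexp (0 :: real^'k^'k) = mat 1"
    proof -
      have "(((**) (0 :: real^'k^'k)) ^^ j) (mat 1) /\<^sub>R fact j = (if j = 0 then mat 1 else 0)" for j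
        by (cases j) (simp_all add: matrix_matrix_mult_def zero_vec_def vec_eq_iff)
      thus ?thesis using sums_single[of 0 "\<lambda>_. mat 1 :: real^'k^'k"] by (simp add: mexp_def sums_iff)
    qed
    thus ?thesis using zero SO_one by simp
  qed
  thus "mexp (s *\<^sub>R wedge q a b) \<in> SO q" "mexp (0 *\<^sub>R wedge q a b) = mat 1"
    "((\<lambda>s. mexp (s *\<^sub>R wedge q a b)) has_vector_derivative wedge q a b) (at 0)" by auto
qed

end

section \<open>The hyperbolic extension\<close>

lemma coord_simps [simp]:
  "e_coord (vec_of a v b) = a" "f_coord (vec_of a v b) = b" "mid (vec_of a v b) = v"
  "vec_of (e_coord w) (mid w) (f_coord w) = w"
  by (auto simp: e_coord_def f_coord_def mid_def vec_of_def vec_eq_iff split: sum.split)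

lemma vec_of_eq_iff [simp]: "vec_of a v b = vec_of a' v' b' \<longleftrightarrow> a = a' \<and> v = v' \<and> b = b'"
  by (metis coord_simps(1-3))

lemma vec_of_linear:
  "vec_of a v b + vec_of a' v' b' = vec_of (a + a') (v + v') (b + b')"
  "vec_of a v b - vec_of a' v' b' = vec_of (a - a') (v - v') (b - b')"
  "c *\<^sub>R vec_of a v b = vec_of (c * a) (c *\<^sub>R v) (c * b)"
  "- vec_of a v b = vec_of (- a) (- v) (- b)"
  "vec_of 0 0 0 = 0"
  by (auto simp: vec_of_def vec_eq_iff split: sum.split)

lemma coord_linear [simp]:
  "e_coord (w + w') = e_coord w + e_coord w'" "f_coord (w + w') = f_coord w + f_coord w'" "mid (w + w') = mid w + mid w'"
  "e_coord (w - w') = e_coord w - e_coord w'" "f_coord (w - w') = f_coord w - f_coord w'" "mid (w - w') = mid w - mid w'"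
  "e_coord (c *\<^sub>R w) = c * e_coord w" "f_coord (c *\<^sub>R w) = c * f_coord w" "mid (c *\<^sub>R w) = c *\<^sub>R mid w"
  "e_coord (- w) = - e_coord w" "f_coord (- w) = - f_coord w" "mid (- w) = - mid w"
  "e_coord 0 = 0" "f_coord 0 = 0" "mid 0 = 0"
  by (auto simp: e_coord_def f_coord_def mid_def vec_eq_iff)

lemma vec_eqI: "e_coord w = e_coord w' \<Longrightarrow> mid w = mid w' \<Longrightarrow> f_coord w = f_coord w' \<Longrightarrow> w = w'"
  by (metis coord_simps(4))

lemma diag_mat_mult: "diag_mat t m *v w = vec_of (t * e_coord w) (m *v mid w) (inverse t * f_coord w)"
proof -
  have "linear (\<lambda>w. vec_of (t * e_coord w) (m *v mid w) (inverse t * f_coord w))"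
    by (rule linearI) (simp_all add: vec_of_linear algebra_simps matrix_vector_algebra)
  thus ?thesis by (simp add: diag_mat_def matrix_works)
qed

lemma diag_mat_compose: "diag_mat t m ** diag_mat t' m' = diag_mat (t * t') (m ** m')"
  by (rule matrix_eqI) (simp add: diag_mat_mult flip: matrix_vector_mul_assoc)

lemma diag_mat_one: "diag_mat 1 (mat 1) = mat 1"
  by (rule matrix_eqI) (simp add: diag_mat_mult)

lemma diag_mat_entries:
  "diag_mat t m $ Inl i $ Inl j = m $ i $ j"
  "diag_mat t m $ Inr c $ Inl j = 0" "diag_mat t m $ Inl i $ Inr c = 0"
  "diag_mat t m $ Inr c $ Inr c' = (if c = c' then (if c then t else inverse t) else 0)"
proof -
  have *: "diag_mat t m $ r $ s = vec_of (t * e_coord (axis s 1)) (m *v mid (axis s 1)) (inverse t * f_coord (axis s 1)) $ r" for r s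
    unfolding diag_mat_mult[symmetric] by (simp add: matrix_vector_mult_basis column_def)
  have m: "mid (axis (Inl j) 1 :: real^('a+bool)) = axis j 1" "mid (axis (Inr c) 1 :: real^('a+bool)) = 0" for j c
    by (auto simp: mid_def axis_def vec_eq_iff)
  show "diag_mat t m $ Inl i $ Inl j = m $ i $ j"
    unfolding * by (simp add: vec_of_def m matrix_vector_mult_basis column_def)
  show "diag_mat t m $ Inr c $ Inl j = 0"
    unfolding * by (simp add: vec_of_def e_coord_def f_coord_def axis_def)
  show "diag_mat t m $ Inl i $ Inr c = 0"
    unfolding * by (simp add: vec_of_def m)
  show "diag_mat t m $ Inr c $ Inr c' = (if c = c' then (if c then t else inverse t) else 0)"
    unfolding * by (auto simp add: vec_of_def e_coord_def f_coord_def axis_def)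
qed

text \<open>In the Leibniz expansion the rows indexed by \<open>Inr\<close> are diagonal, so only
  permutations fixing both extra indices contribute. They extend the permutations of the index set
  of V', and the two extra factors are t and 1/t.\<close>

lemma det_diag_mat:
  fixes m :: "real^'m^'m"
  assumes "t \<noteq> 0"
  shows "det (diag_mat t m) = det m"
proof -
  let ?U = "UNIV :: ('m + bool) set" and ?R = "range (Inl :: 'm \<Rightarrow> 'm + bool)"
  let ?A = "diag_mat t m"
  let ?\<phi> = "map_permutation UNIV (Inl :: 'm \<Rightarrow> 'm + bool)"
  have inj: "inj (Inl :: 'm \<Rightarrow> 'm + bool)" by simp
  have \<phi>Inl: "?\<phi> p (Inl i) = Inl (p i)" if "p permutes UNIV" for p i
    using that by (simp add: map_permutation_def restrict_id_def)
  have \<phi>Inr: "?\<phi> p (Inr c) = Inr c" for p c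
    by (auto simp: map_permutation_def restrict_id_def)
  have "det ?A = (\<Sum>p\<in>{p. p permutes ?U}. of_int (sign p) * (\<Prod>i\<in>?U. ?A $ i $ p i))" by (simp add: det_def)
  also have "\<dots> = (\<Sum>p\<in>{p. p permutes ?R}. of_int (sign p) * (\<Prod>i\<in>?U. ?A $ i $ p i))"
  proof (rule sum.mono_neutral_right)
    show "{p. p permutes ?R} \<subseteq> {p. p permutes ?U}" using permutes_subset by blast
    show "\<forall>p\<in>{p. p permutes ?U} - {p. p permutes ?R}. of_int (sign p) * (\<Prod>i\<in>?U. ?A $ i $ p i) = 0"
    proof
      fix p assume p: "p \<in> {p. p permutes ?U} - {p. p permutes ?R}"
      have "\<exists>c. p (Inr c) \<noteq> Inr c"
      proof (rule ccontr)
        assume "\<not> (\<exists>c. p (Inr c) \<noteq> Inr c)"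
        hence "p x = x" if "x \<notin> ?R" for x using that by (cases x) auto
        hence "p permutes ?R" using p permutes_bij[of p ?U] by (auto simp: permutes_def)
        thus False using p by simp
      qed
      then obtain c where "p (Inr c) \<noteq> Inr c" by blast
      hence "?A $ Inr c $ p (Inr c) = 0" by (cases "p (Inr c)") (auto simp: diag_mat_entries)
      hence "(\<Prod>i\<in>?U. ?A $ i $ p i) = 0" by (intro prod_zero) auto
      thus "of_int (sign p) * (\<Prod>i\<in>?U. ?A $ i $ p i) = 0" by simp
    qed
  qed simp
  also have "{p. p permutes ?R} = ?\<phi> ` {p. p permutes (UNIV :: 'm set)}"
  proof (intro equalityI subsetI)
    fix p assume p: "p \<in> {p. p permutes ?R}"
    define p' where "p' = (\<lambda>i. projl (p (Inl i)))"
    have p1: "p (Inl i) = Inl (p' i)" for i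
      using permutes_in_image[of p ?R "Inl i"] p by (auto simp: p'_def)
    have "inj p'" using p1 permutes_inj[of p ?R] p by (auto simp: inj_def) (metis Inl_inject)
    hence "bij_betw p' UNIV UNIV" by (simp add: finite_UNIV_inj_surj bij_betw_def)
    hence perm: "p' permutes UNIV" by (rule bij_imp_permutes) simp
    have "p x = ?\<phi> p' x" for x
      using p permutes_not_in[of p ?R x] by (cases x) (auto simp: p1 \<phi>Inl[OF perm] \<phi>Inr)
    thus "p \<in> ?\<phi> ` {p. p permutes (UNIV :: 'm set)}" using perm by blast
  next
    fix p assume "p \<in> ?\<phi> ` {p. p permutes (UNIV :: 'm set)}"
    thus "p \<in> {p. p permutes ?R}"
      by (auto intro!: map_permutation_permutes simp: bij_betw_def)
  qed
  also have "(\<Sum>p\<in>?\<phi> ` {p. p permutes (UNIV :: 'm set)}. of_int (sign p) * (\<Prod>i\<in>?U. ?A $ i $ p i))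
     = (\<Sum>p\<in>{p. p permutes (UNIV :: 'm set)}. of_int (sign p) * (\<Prod>i\<in>UNIV. m $ i $ p i))"
  proof (subst sum.reindex)
    show "inj_on ?\<phi> {p. p permutes (UNIV :: 'm set)}"
      by (rule inj_onI, rule ext) (metis \<phi>Inl Inl_inject mem_Collect_eq)
    show "sum ((\<lambda>p. of_int (sign p) * (\<Prod>i\<in>?U. ?A $ i $ p i)) \<circ> ?\<phi>) {p. p permutes (UNIV :: 'm set)}
     = (\<Sum>p\<in>{p. p permutes (UNIV :: 'm set)}. of_int (sign p) * (\<Prod>i\<in>UNIV. m $ i $ p i))"
    proof (rule sum.cong[OF refl], unfold o_def)
      fix p assume "p \<in> {p. p permutes (UNIV :: 'm set)}"
      hence p: "p permutes UNIV" by simp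
      have "?U = range Inl \<union> range Inr" by (simp add: UNIV_sum)
      hence "(\<Prod>i\<in>?U. ?A $ i $ ?\<phi> p i) = (\<Prod>i\<in>range Inl. ?A $ i $ ?\<phi> p i) * (\<Prod>i\<in>range Inr. ?A $ i $ ?\<phi> p i)"
        using prod.union_disjoint[of "range Inl" "range Inr" "\<lambda>i. ?A $ i $ ?\<phi> p i"] by auto
      also have "(\<Prod>i\<in>range Inr. ?A $ i $ ?\<phi> p i) = 1"
        using assms by (simp add: prod.reindex \<phi>Inr diag_mat_entries UNIV_bool)
      also have "(\<Prod>i\<in>range Inl. ?A $ i $ ?\<phi> p i) = (\<Prod>i\<in>UNIV. m $ i $ p i)"
        by (simp add: prod.reindex \<phi>Inl[OF p] diag_mat_entries)
      finally show "of_int (sign (?\<phi> p)) * (\<Prod>i\<in>?U. ?A $ i $ ?\<phi> p i) = of_int (sign p) * (\<Prod>i\<in>UNIV. m $ i $ p i)"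
        by (simp add: sign_map_permutation[OF inj p])
    qed
  qed
  also have "\<dots> = det m" by (simp add: det_def)
  finally show ?thesis .
qed

locale signature_space =
  fixes q :: "real^'m \<Rightarrow> real" and n :: nat and Vpos Vn :: "(real^'m) set" and v1 v2 :: "real^'m"
  assumes split: "signature_split q n Vpos Vn v1 v2"
begin

lemma v_facts:
  "quadratic_form q" "polar q v1 v1 = 1" "polar q v2 v2 = 1" "polar q v1 v2 = 0" "v1 \<in> Vpos" "v2 \<in> Vpos"
  "Vpos = span {v1, v2}" "subspace Vn" "dim Vn = n" "subspace Vpos"
  "\<And>y. y \<in> Vn \<Longrightarrow> y \<noteq> 0 \<Longrightarrow> q y < 0" "\<And>x. x \<in> Vpos \<Longrightarrow> x \<noteq> 0 \<Longrightarrow> q x > 0"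
  "\<And>x y. x \<in> Vpos \<Longrightarrow> y \<in> Vn \<Longrightarrow> polar q x y = 0"
  "\<And>z. \<exists>x\<in>Vpos. \<exists>y\<in>Vn. z = x + y"
  using split by (auto simp: signature_split_def)

end

sublocale signature_space \<subseteq> qform q
proof
  show "quadratic_form q" by (rule v_facts)
  fix x assume x: "\<And>y. polar q x y = 0"
  obtain a b where ab: "a \<in> Vpos" "b \<in> Vn" "x = a + b" using v_facts(14) by blast
  have bil: "bilinear (polar q)" using v_facts(1) by (simp add: quadratic_form_def)
  have two: "polar q z z = 2 * q z" for z
    using v_facts(1) by (simp add: polar_def quadratic_form_def flip: scaleR_2)
  have "polar q b a = 0" using v_facts(13)[OF ab(1,2)] by (simp add: polar_def add.commute)
  hence "q a = 0" using x[of a] two[of a] by (simp add: ab(3) bilinear_ladd[OF bil])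
  moreover have "q b = 0" using x[of b] two[of b] v_facts(13)[OF ab(1,2)] by (simp add: ab(3) bilinear_ladd[OF bil])
  ultimately show "x = 0" using v_facts(11)[of b] v_facts(12)[of a] ab by force
qed

lemma polar_hyp:
  assumes "quadratic_form q"
  shows "polar (hyp q) w z = e_coord w * f_coord z + e_coord z * f_coord w + polar q (mid w) (mid z)"
  by (simp add: polar_def hyp_def algebra_simps)

sublocale signature_space \<subseteq> V: qform "hyp q"
proof
  have ph: "polar (hyp q) = (\<lambda>w z. e_coord w * f_coord z + e_coord z * f_coord w + polar q (mid w) (mid z))"
    by (intro ext polar_hyp qf)
  show "quadratic_form (hyp q)"
    unfolding quadratic_form_def bilinear_def ph
    by (auto simp: hyp_def q_scale power2_eq_square algebra_simps polar_simps intro!: linearI)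
  fix x :: "real^('m+bool)" assume x: "\<And>y. polar (hyp q) x y = 0"
  have "mid x = 0"
  proof (rule nondeg)
    show "polar q (mid x) y = 0" for y using x[of "vec_of 0 y 0"] by (simp add: ph)
  qed
  moreover have "e_coord x = 0" using x[of "vec_of 0 0 1"] by (simp add: ph polar_simps)
  moreover have "f_coord x = 0" using x[of "vec_of 1 0 0"] by (simp add: ph polar_simps)
  ultimately show "x = 0" by (intro vec_eqI) simp_all
qed

context signature_space
begin

abbreviation "H \<equiv> polar (hyp q)"
abbreviation "wedgeV \<equiv> wedge (hyp q)"

definition "E1 = vec_of 0 v1 0"
definition "E2 = vec_of 0 v2 0"
definition "U = (vec_of (1 / sqrt 2) 0 (1 / sqrt 2) :: real^('m+bool))"
definition "W = (vec_of (1 / sqrt 2) 0 (- 1 / sqrt 2) :: real^('m+bool))"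
definition "ee = (vec_of 1 0 0 :: real^('m+bool))"
definition "ff = (vec_of 0 0 1 :: real^('m+bool))"

lemmas H_eq = polar_hyp[OF qf]
lemmas E_defs = E1_def E2_def U_def W_def ee_def ff_def

lemma v21: "polar q v2 v1 = 0" using v_facts(4) polar_commute by metis

lemma H_basis:
  "H E1 E1 = 1" "H E2 E2 = 1" "H U U = 1" "H W W = -1" "H E1 E2 = 0" "H E2 E1 = 0" "H E1 U = 0" "H E2 U = 0"
  "H U E1 = 0" "H U E2 = 0" "H E1 W = 0" "H E2 W = 0" "H U W = 0" "H W U = 0" "H W E1 = 0" "H W E2 = 0"
  by (simp_all add: H_eq E_defs v_facts v21 polar_simps)

lemma sqrt2_ee: "sqrt 2 *\<^sub>R ee = U + W"
  by (simp add: E_defs vec_of_linear field_simps)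

lemma Vn_iff: "y \<in> Vn \<longleftrightarrow> polar q v1 y = 0 \<and> polar q v2 y = 0"
proof
  assume "y \<in> Vn" thus "polar q v1 y = 0 \<and> polar q v2 y = 0" using v_facts by auto
next
  assume y: "polar q v1 y = 0 \<and> polar q v2 y = 0"
  obtain a b where ab: "a \<in> Vpos" "b \<in> Vn" "y = a + b" using v_facts(14) by blast
  obtain c d where "a = c *\<^sub>R v1 + d *\<^sub>R v2" using ab(1) v_facts(7) by (auto simp: span_insert span_breakdown_eq algebra_simps)
  hence "c = 0 \<and> d = 0" using y ab v_facts v21 by (auto simp: polar_simps)
  thus "y \<in> Vn" using ab \<open>a = _\<close> by simp
qed

definition "pos_part z = polar q v1 z *\<^sub>R v1 + polar q v2 z *\<^sub>R v2"

lemma pos_part_in: "pos_part z \<in> Vpos"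
  unfolding pos_part_def using v_facts by (intro subspace_add subspace_scale) auto

lemma neg_part_in: "z - pos_part z \<in> Vn"
  by (simp add: Vn_iff pos_part_def polar_simps v_facts v21)

lemma Vpos_iff: "z \<in> Vpos \<longleftrightarrow> pos_part z = z"
proof
  assume z: "z \<in> Vpos"
  hence "z - pos_part z \<in> Vpos" using pos_part_in v_facts(10) subspace_diff by blast
  moreover have "polar q (z - pos_part z) (z - pos_part z) = 0" using v_facts(13)[OF calculation neg_part_in] .
  ultimately show "pos_part z = z" using v_facts(12)[of "z - pos_part z"] by (cases "z - pos_part z = 0") (auto simp: polar_self)
qed (metis pos_part_in)

lemma polar_Vpos_Vn: "x \<in> Vpos \<Longrightarrow> y \<in> Vn \<Longrightarrow> polar q x y = 0 \<and> polar q y x = 0"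
  using v_facts(13) polar_commute by metis

lemma nmat_mult: "nmat q x *v w = vec_of (e_coord w + polar q x (mid w) - f_coord w * q x) (mid w - f_coord w *\<^sub>R x) (f_coord w)"
proof -
  have "linear (\<lambda>w. vec_of (e_coord w + polar q x (mid w) - f_coord w * q x) (mid w - f_coord w *\<^sub>R x) (f_coord w))"
    by (rule linearI) (simp_all add: vec_of_linear algebra_simps polar_simps)
  thus ?thesis by (simp add: nmat_def matrix_works)
qed

text \<open>\<open>n(x)\<close> is the exponential of \<open>e \<and> x\<close>, whose cube vanishes.\<close>
lemma nmat_rot: "nmat q (s *\<^sub>R x) = V.rot ee (vec_of 0 x 0) s (s\<^sup>2 / 2)"
proof (rule matrix_eqI)
  fix w
  have 0: "H ee (vec_of 0 x 0) = 0" by (simp add: H_eq E_defs polar_simps)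
  show "nmat q (s *\<^sub>R x) *v w = V.rot ee (vec_of 0 x 0) s (s\<^sup>2 / 2) *v w"
    unfolding nmat_mult V.rot_mult[OF 0] using q_scale[of 0 0]
    by (intro vec_eqI) (simp_all add: H_eq E_defs polar_simps polar_self q_scale power2_eq_square algebra_simps)
qed

lemma nmat_compose: "nmat q x ** nmat q y = nmat q (x + y)"
proof (rule matrix_eqI, rule vec_eqI)
  fix w
  have "q (x + y) = q x + q y + polar q x y" by (simp add: polar_def)
  thus "e_coord ((nmat q x ** nmat q y) *v w) = e_coord (nmat q (x + y) *v w)"
    by (simp add: matrix_vector_mul_assoc[symmetric] nmat_mult polar_simps algebra_simps)
qed (simp_all add: matrix_vector_mul_assoc[symmetric] nmat_mult algebra_simps)

lemma nmat_zero: "nmat q 0 = mat 1"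
  using nmat_rot[of 0 0] by (simp add: V.rot_zero)

lemma nmat_SO: "nmat q x \<in> SO (hyp q)"
proof -
  \<comment> \<open>As for boosts, determinant 1 comes from writing n(x) as the square of
    n(x/2).\<close>
  have "nmat q ((1/2) *\<^sub>R x) ** nmat q ((1/2) *\<^sub>R x) \<in> SO (hyp q)"
  proof (rule V.SO_square)
    fix w
    have 0: "H ee (vec_of 0 x 0) = 0" by (simp add: H_eq E_defs polar_simps)
    have "H ee ee = 0" by (simp add: H_eq E_defs polar_simps)
    hence "2 * ((1/2)\<^sup>2 / 2) - H ee ee * H (vec_of 0 x 0) (vec_of 0 x 0) * ((1/2)\<^sup>2 / 2)\<^sup>2 = (1/2 :: real)\<^sup>2" by simp
    from V.rot_polar[OF 0 this] show "hyp q (nmat q ((1/2) *\<^sub>R x) *v w) = hyp q w"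
      by (simp only: V.q_polar nmat_rot)
  qed
  moreover have "(1/2) *\<^sub>R x + (1/2) *\<^sub>R x = x" by (metis scaleR_half_double scaleR_right_distrib)
  ultimately show ?thesis by (simp only: nmat_compose)
qed

lemma nmat_deriv: "((\<lambda>s. nmat q (s *\<^sub>R x)) has_vector_derivative wedgeV ee (vec_of 0 x 0)) (at 0)"
  unfolding nmat_rot V.rot_def
  by (auto intro!: derivative_eq_intros simp: has_vector_derivative_def)

text \<open>M normalises N, so right translation by N at a point of M becomes left translation,
  where F transforms by the character. This is what makes derivatives along
  \<open>ee \<and> V'\<close> computable.\<close>

lemma diag_nmat:
  assumes "m \<in> SO q" "t \<noteq> 0"
  shows "diag_mat t m ** nmat q x = nmat q (t *\<^sub>R (m *v x)) ** diag_mat t m"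
proof (rule matrix_eqI, rule vec_eqI)
  fix w
  have "polar q (m *v x) (m *v y) = polar q x y" for y using assms by (simp add: SO_polar)
  moreover have "q (m *v x) = q x" using assms by (simp add: SO_def)
  ultimately show "e_coord ((diag_mat t m ** nmat q x) *v w) = e_coord ((nmat q (t *\<^sub>R (m *v x)) ** diag_mat t m) *v w)"
    using assms(2)
    by (simp add: matrix_vector_mul_assoc[symmetric] nmat_mult diag_mat_mult polar_simps q_scale power2_eq_square field_simps)
qed (use assms in \<open>simp_all add: matrix_vector_mul_assoc[symmetric] nmat_mult diag_mat_mult matrix_vector_algebra field_simps\<close>)

lemma diag_SO:
  assumes "m \<in> SO q" "t \<noteq> 0" shows "diag_mat t m \<in> SO (hyp q)"
  using assms by (auto simp: SO_def det_diag_mat hyp_def diag_mat_mult)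

lemma diag_boost:
  assumes "polar q a b = 0"
  shows "diag_mat t (m ** boost a b s) = diag_mat t m ** V.boost (vec_of 0 a 0) (vec_of 0 b 0) s"
proof -
  have 0: "H (vec_of 0 a 0) (vec_of 0 b 0) = 0" using assms by (simp add: H_eq)
  have "V.boost (vec_of 0 a 0) (vec_of 0 b 0) s = diag_mat 1 (boost a b s)"
    by (rule matrix_eqI, rule vec_eqI)
       (simp_all add: V.boost_def boost_def V.rot_mult[OF 0] rot_mult[OF assms] H_eq diag_mat_mult)
  thus ?thesis by (simp add: diag_mat_compose)
qed

text \<open>\<open>ee \<and> ff\<close> is 1 on e, -1 on f and 0 on V', so \<open>t d/dt\<close> is
  the right-regular derivative along it.\<close>

lemma diag_deriv:
  assumes "t \<noteq> 0"
  shows "((\<lambda>t. diag_mat t m) has_vector_derivative diag_mat t m ** ((1/t) *\<^sub>R wedgeV ee ff)) (at t)"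
proof -
  define A where "A = (matrix (\<lambda>w. vec_of (e_coord w) 0 0) :: real^('m+bool)^('m+bool))"
  define B where "B = (matrix (\<lambda>w. vec_of 0 0 (f_coord w)) :: real^('m+bool)^('m+bool))"
  define C where "C = (matrix (\<lambda>w. vec_of 0 (m *v mid w) 0) :: real^('m+bool)^('m+bool))"
  have A: "A *v w = vec_of (e_coord w) 0 0" and B: "B *v w = vec_of 0 0 (f_coord w)" and C: "C *v w = vec_of 0 (m *v mid w) 0" for w
  proof -
    have "linear (\<lambda>w :: real^('m+bool). vec_of (e_coord w) 0 0 :: real^('m+bool))"
      "linear (\<lambda>w :: real^('m+bool). vec_of 0 0 (f_coord w) :: real^('m+bool))"
      "linear (\<lambda>w. vec_of 0 (m *v mid w) 0)"
      by (rule linearI; simp add: vec_of_linear matrix_vector_algebra)+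
    thus "A *v w = vec_of (e_coord w) 0 0" "B *v w = vec_of 0 0 (f_coord w)" "C *v w = vec_of 0 (m *v mid w) 0"
      unfolding A_def B_def C_def by (simp_all add: matrix_works)
  qed
  have "(\<lambda>t. diag_mat t m) = (\<lambda>t. t *\<^sub>R A + inverse t *\<^sub>R B + C)"
    by (intro ext matrix_eqI vec_eqI) (simp_all add: matrix_vector_algebra A B C diag_mat_mult)
  moreover have "((\<lambda>t. t *\<^sub>R A + inverse t *\<^sub>R B + C) has_vector_derivative A - (inverse t * inverse t) *\<^sub>R B) (at t)"
    using assms by (auto intro!: derivative_eq_intros simp: has_vector_derivative_def algebra_simps)
  moreover have "A - (inverse t * inverse t) *\<^sub>R B = diag_mat t m ** ((1/t) *\<^sub>R wedgeV ee ff)"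
    using assms by (intro matrix_eqI vec_eqI)
      (simp_all add: matrix_vector_algebra A B diag_mat_mult matrix_vector_mul_assoc[symmetric] V.wedge_mult H_eq E_defs polar_simps divide_inverse)
  ultimately show ?thesis by simp
qed

section \<open>The Cartan involution and elements of K\<close>

lemma iota_adjoint: "H (iota q v1 v2 v) w = H v (iota q v1 v2 w)"
  by (simp add: H_eq iota_def polar_simps polar_commute[of v1] polar_commute[of v2] algebra_simps)

lemma iota_linear: "iota q v1 v2 (v + w) = iota q v1 v2 v + iota q v1 v2 w" "iota q v1 v2 (c *\<^sub>R v) = c *\<^sub>R iota q v1 v2 v"
  "iota q v1 v2 (v - w) = iota q v1 v2 v - iota q v1 v2 w"
  by (auto intro!: vec_eqI simp: iota_def polar_simps algebra_simps)

text \<open>\<open>iota\<close> is self-adjoint, so \<open>a \<and> b\<close> commutes with it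
  whenever a and b lie in the same eigenspace.\<close>

lemma turn_K:
  assumes "H a b = 0" "H a a * H b b = 1" "iota q v1 v2 a = c *\<^sub>R a" "iota q v1 v2 b = c *\<^sub>R b"
  shows "V.turn a b s \<in> Kgroup q v1 v2"
proof -
  have "H b (iota q v1 v2 w) = c * H b w" "H a (iota q v1 v2 w) = c * H a w" for w
    using assms by (simp_all add: iota_adjoint[symmetric] V.polar_simps)
  thus ?thesis unfolding Kgroup_def V.turn_def
    using V.turn_SO[OF assms(1,2), of s] assms
    by (auto simp: V.turn_def V.rot_mult iota_linear algebra_simps)
qed

lemma iota_basis: "iota q v1 v2 E1 = 1 *\<^sub>R E1" "iota q v1 v2 E2 = 1 *\<^sub>R E2" "iota q v1 v2 U = 1 *\<^sub>R U" "iota q v1 v2 W = -1 *\<^sub>R W"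
  "b \<in> Vn \<Longrightarrow> iota q v1 v2 (vec_of 0 b 0) = -1 *\<^sub>R vec_of 0 b 0"
  using polar_Vpos_Vn[OF v_facts(5)] polar_Vpos_Vn[OF v_facts(6)]
  by (auto intro!: vec_eqI simp: iota_def E_defs v_facts(2-4) v21 polar_simps scaleR_2)

lemma stab_Vpos_image:
  assumes "k \<in> SO q" "\<And>x. x \<in> Vpos \<Longrightarrow> k *v x \<in> Vpos"
  shows "(*v) k ` Vpos = Vpos"
proof (rule subspace_dim_equal)
  have inj: "inj_on ((*v) k) (span Vpos)"
    by (metis SO_inv(2) assms(1) inj_onI matrix_vector_mul_assoc matrix_vector_mul_lid)
  show "subspace ((*v) k ` Vpos)" by (rule linear_subspace_image[OF matrix_vector_mul_linear v_facts(10)])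
  show "dim Vpos \<le> dim ((*v) k ` Vpos)" using dim_image_eq[OF matrix_vector_mul_linear inj] by simp
qed (use assms(2) v_facts(10) in auto)

lemma stab_Vpos_inv:
  assumes "k \<in> SO q" "\<And>x. x \<in> Vpos \<Longrightarrow> k *v x \<in> Vpos" "x \<in> Vpos"
  shows "matrix_inv k *v x \<in> Vpos"
proof -
  obtain x' where "x' \<in> Vpos" "x = k *v x'" using stab_Vpos_image[OF assms(1,2)] assms(3) by blast
  thus ?thesis by (simp add: matrix_vector_mul_assoc SO_inv[OF assms(1)])
qed

text \<open>An isometry preserving V2 preserves its orthogonal complement Vn, hence commutes with
  the projection.\<close>

lemma stab_pos_part:
  assumes "k \<in> SO q" "\<And>x. x \<in> Vpos \<Longrightarrow> k *v x \<in> Vpos"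
  shows "pos_part (k *v z) = k *v pos_part z"
proof -
  have Vn: "k *v y \<in> Vn" if "y \<in> Vn" for y
  proof -
    have "polar q x (k *v y) = 0" if x: "x \<in> Vpos" for x
    proof -
      obtain x' where "x' \<in> Vpos" "x = k *v x'" using stab_Vpos_image[OF assms] x by blast
      thus ?thesis using polar_Vpos_Vn[OF _ \<open>y \<in> Vn\<close>] assms(1) by (simp add: SO_polar)
    qed
    thus ?thesis using v_facts(5,6) by (simp add: Vn_iff)
  qed
  have add: "pos_part (x + y) = pos_part x + pos_part y" for x y by (simp add: pos_part_def polar_simps algebra_simps)
  have "k *v z = k *v pos_part z + k *v (z - pos_part z)" by (simp add: matrix_vector_algebra)
  also have "pos_part \<dots> = pos_part (k *v pos_part z) + pos_part (k *v (z - pos_part z))" by (rule add)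
  also have "pos_part (k *v (z - pos_part z)) = 0" using Vn[OF neg_part_in, of z] by (simp add: Vn_iff pos_part_def)
  also have "pos_part (k *v pos_part z) = k *v pos_part z" using assms(2)[OF pos_part_in] by (simp add: Vpos_iff)
  finally show ?thesis by simp
qed

lemma diag_K:
  assumes "k \<in> SO q" "\<And>x. x \<in> Vpos \<Longrightarrow> k *v x \<in> Vpos" "c = 1 \<or> c = -1"
  shows "diag_mat c k \<in> Kgroup q v1 v2"
proof -
  have io: "iota q v1 v2 w = vec_of (f_coord w) (2 *\<^sub>R pos_part (mid w) - mid w) (e_coord w)" for w
    by (simp add: iota_def pos_part_def polar_commute[of "mid w"])
  show ?thesis
    unfolding Kgroup_def using assms(1,3) diag_SO[of k c]
    by (auto simp: io diag_mat_mult stab_pos_part[OF assms(1,2)] matrix_vector_algebra)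
qed

end

section \<open>Spin lifts\<close>

lemma cvec_linear:
  "cvec (v + w) = cvec v + cvec w" "cvec (c *\<^sub>R v) = complex_of_real c *s cvec v" "cvec (v - w) = cvec v - cvec w"
  "cvec (- v) = - cvec v"
  by (simp_all add: cvec_def vec_eq_iff)

lemma cmat_cvec: "cmat k *v cvec v = cvec (k *v v)"
  by (simp add: cmat_def cvec_def matrix_vector_mult_def vec_eq_iff)

lemma sym_act_2:
  shows "coeff (sym_act 2 A p) 2 = coeff p 2 * (A$1$1)\<^sup>2 + coeff p 1 * (A$1$1 * A$1$2) + coeff p 0 * (A$1$2)\<^sup>2"
    "coeff (sym_act 2 A p) 1 = 2 * coeff p 2 * A$1$1 * A$2$1 + coeff p 1 * (A$1$1 * A$2$2 + A$2$1 * A$1$2) + 2 * coeff p 0 * A$1$2 * A$2$2"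
    "coeff (sym_act 2 A p) 0 = coeff p 2 * (A$2$1)\<^sup>2 + coeff p 1 * (A$2$1 * A$2$2) + coeff p 0 * (A$2$2)\<^sup>2"
  by (simp_all add: sym_act_def atMost_Suc numeral_2_eq_2 power2_eq_square algebra_simps)

lemma coeff_linear_powers:
  "coeff ([:0, a:] ^ i * [:b:] ^ m) (j :: nat) = (if i = j then a ^ i * b ^ m else (0 :: complex))"
proof -
  have "[:0, a:] ^ i = monom (a ^ i) i" by (metis monom_0 monom_Suc monom_power mult_1 power_one_right One_nat_def)
  moreover have "[:b:] ^ m = [:b ^ m:]" by (induction m) (simp_all add: one_pCons)
  ultimately show ?thesis by simp
qed

lemma coeff_sym_act_diagonal:
  assumes "A$1$2 = 0" "A$2$1 = 0" "j \<le> k"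
  shows "coeff (sym_act k A p) j = coeff p j * (A$1$1) ^ j * (A$2$2) ^ (k - j)"
  using assms by (simp add: sym_act_def coeff_sum coeff_linear_powers if_distrib[of "\<lambda>x. _ * x"] cong: if_cong)

lemma coeff_sym_act_antidiagonal:
  assumes "A$1$1 = 0" "A$2$2 = 0" "j \<le> k"
  shows "coeff (sym_act k A p) j = coeff p (k - j) * (A$2$1) ^ (k - j) * (A$1$2) ^ j"
proof -
  have "coeff (sym_act k A p) j = (\<Sum>i\<le>k. coeff p i * coeff ([:0, A$1$2:] ^ (k - i) * [:A$2$1:] ^ i) j)"
    using assms by (simp add: sym_act_def coeff_sum mult.commute)
  also have "\<dots> = (\<Sum>i\<le>k. if i = k - j then coeff p i * (A$2$1) ^ i * (A$1$2) ^ (k - i) else 0)"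
    using assms(3) by (intro sum.cong refl) (auto simp: coeff_linear_powers)
  also have "\<dots> = coeff p (k - j) * (A$2$1) ^ (k - j) * (A$1$2) ^ j"
    using assms(3) by simp
  finally show ?thesis .
qed

lemma poly_sym_act:
  "poly (sym_act k A p) z = (\<Sum>j\<le>k. coeff p j * (A$2$1 + A$1$1 * z) ^ j * (A$2$2 + A$1$2 * z) ^ (k - j))"
  by (simp add: sym_act_def poly_sum mult.assoc mult.commute[of z])

lemma poly_forms: "p \<in> forms k \<Longrightarrow> poly p z = (\<Sum>j\<le>k. coeff p j * z ^ j)"
  unfolding poly_altdef forms_def
  by (rule sum.mono_neutral_left) (auto simp: coeff_eq_0)

lemma sym_act_one: "p \<in> forms k \<Longrightarrow> sym_act k (mat 1) p = p"
  by (subst poly_eq_poly_eq_iff[symmetric], rule ext) (simp add: poly_sym_act poly_forms mat_def)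

context signature_space
begin

lemma S2_eq: "S2_to_V3 v1 v2 p = (\<i> * (coeff p 2 + coeff p 0)) *s cvec E1 + (coeff p 0 - coeff p 2) *s cvec E2 + coeff p 1 *s cvec U"
proof -
  have "complex_of_real (1 / sqrt 2) *s cvec (vec_of 1 0 1 :: real^('m+bool)) = cvec U"
    by (simp only: cvec_linear(2)[symmetric] U_def vec_of_linear) simp
  thus ?thesis
    unfolding S2_to_V3_def E1_def E2_def by (simp only:) (simp add: vec_eq_iff algebra_simps)
qed

lemma S2_basis:
  "S2_to_V3 v1 v2 (monom 1 2) = \<i> *s cvec E1 - cvec E2"
  "S2_to_V3 v1 v2 (monom 1 1) = cvec U"
  "S2_to_V3 v1 v2 (monom 1 0) = \<i> *s cvec E1 + cvec E2"
  by (simp_all add: S2_eq)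

lemma S2_Re_Im:
  "Re_vec (S2_to_V3 v1 v2 (monom 1 2)) = - E2" "Im_vec (S2_to_V3 v1 v2 (monom 1 2)) = E1"
  "Re_vec (S2_to_V3 v1 v2 (monom 1 1)) = U" "Im_vec (S2_to_V3 v1 v2 (monom 1 1)) = 0"
  "Re_vec (S2_to_V3 v1 v2 (monom 1 0)) = E2" "Im_vec (S2_to_V3 v1 v2 (monom 1 0)) = E1"
  unfolding S2_basis by (simp_all add: Re_vec_def Im_vec_def cvec_def vec_eq_iff)

definition mat2 :: "complex \<Rightarrow> complex \<Rightarrow> complex \<Rightarrow> complex \<Rightarrow> complex^2^2" where
  "mat2 a b c d = (\<chi> i j. if i = 1 then (if j = 1 then a else b) else (if j = 1 then c else d))"

lemma mat2_simps [simp]: "mat2 a b c d $ 1 $ 1 = a" "mat2 a b c d $ 1 $ 2 = b" "mat2 a b c d $ 2 $ 1 = c" "mat2 a b c d $ 2 $ 2 = d"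
  by (simp_all add: mat2_def)

text \<open>Here \<open>x, y, z\<close> are the coefficients of an arbitrary quadratic form.
  Comparing components along \<open>E1\<close>, \<open>E2\<close>, \<open>U\<close> reduces the
  lifting property to three scalar identities, one for each.\<close>

lemma spin_liftI:
  assumes "\<epsilon> = 1 \<or> \<epsilon> = -1" "a * d - b * c = 1"
    and k: "k *v E1 = a1 *\<^sub>R E1 + a2 *\<^sub>R E2 + a3 *\<^sub>R U" "k *v E2 = b1 *\<^sub>R E1 + b2 *\<^sub>R E2 + b3 *\<^sub>R U"
      "k *v U = c1 *\<^sub>R E1 + c2 *\<^sub>R E2 + c3 *\<^sub>R U"
    and eq: "\<And>x y z. \<i> * (x + z) * of_real a1 + (z - x) * of_real b1 + y * of_real c1
        = \<epsilon> * (\<i> * ((x * a\<^sup>2 + y * (a * b) + z * b\<^sup>2) + (x * c\<^sup>2 + y * (c * d) + z * d\<^sup>2)))"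
      "\<And>x y z. \<i> * (x + z) * of_real a2 + (z - x) * of_real b2 + y * of_real c2
        = \<epsilon> * ((x * c\<^sup>2 + y * (c * d) + z * d\<^sup>2) - (x * a\<^sup>2 + y * (a * b) + z * b\<^sup>2))"
      "\<And>x y z. \<i> * (x + z) * of_real a3 + (z - x) * of_real b3 + y * of_real c3
        = \<epsilon> * (2 * x * a * c + y * (a * d + c * b) + 2 * z * b * d)"
  shows "spin_lift v1 v2 k (mat2 a b c d) \<epsilon>"
proof -
  let ?A = "mat2 a b c d"
  have "cmat k *v S2_to_V3 v1 v2 p = \<epsilon> *s S2_to_V3 v1 v2 (sym_act 2 ?A p)" for p
  proof -
    define x y z where "x = coeff p 2" and "y = coeff p 1" and "z = coeff p 0"
    have "cmat k *v S2_to_V3 v1 v2 p = (\<i> * (x + z)) *s cvec (k *v E1) + (z - x) *s cvec (k *v E2) + y *s cvec (k *v U)"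
      unfolding S2_eq x_def y_def z_def
      by (simp only: matrix_vector_right_distrib vector_scalar_commute cmat_cvec)
    also have "\<dots> = (\<i> * (x + z) * of_real a1 + (z - x) * of_real b1 + y * of_real c1) *s cvec E1
       + (\<i> * (x + z) * of_real a2 + (z - x) * of_real b2 + y * of_real c2) *s cvec E2
       + (\<i> * (x + z) * of_real a3 + (z - x) * of_real b3 + y * of_real c3) *s cvec U"
      unfolding k cvec_linear by (simp add: vec_eq_iff algebra_simps)
    also have "\<dots> = \<epsilon> *s S2_to_V3 v1 v2 (sym_act 2 ?A p)"
      unfolding eq S2_eq sym_act_2 mat2_simps x_def[symmetric] y_def[symmetric] z_def[symmetric]
      by (simp add: vec_eq_iff algebra_simps)
    finally show ?thesis .
  qed
  thus ?thesis using assms(1,2) by (simp add: spin_lift_def det_2)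
qed

text \<open>SL2 covers SO(3) twice, so the lift of a rotation by s has entries in s/2.\<close>

lemma half_angle:
  "complex_of_real (cos s) = (complex_of_real (cos (s/2)))\<^sup>2 - (complex_of_real (sin (s/2)))\<^sup>2"
  "complex_of_real (sin s) = 2 * complex_of_real (sin (s/2)) * complex_of_real (cos (s/2))"
  "(complex_of_real (cos (s/2)))\<^sup>2 + (complex_of_real (sin (s/2)))\<^sup>2 = 1"
proof -
  have "cos s = (cos (s/2))\<^sup>2 - (sin (s/2))\<^sup>2" "sin s = 2 * sin (s/2) * cos (s/2)"
    using cos_double[of "s/2"] sin_double[of "s/2"] by simp_all
  thus "complex_of_real (cos s) = (complex_of_real (cos (s/2)))\<^sup>2 - (complex_of_real (sin (s/2)))\<^sup>2"
    "complex_of_real (sin s) = 2 * complex_of_real (sin (s/2)) * complex_of_real (cos (s/2))"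
    by (simp_all only: of_real_diff of_real_mult of_real_power of_real_numeral)
  show "(complex_of_real (cos (s/2)))\<^sup>2 + (complex_of_real (sin (s/2)))\<^sup>2 = 1"
    using sin_cos_squared_add2[of "s/2"] by (metis of_real_1 of_real_add of_real_power)
qed

lemma spin_lift_turn1:
  fixes s defines "c \<equiv> complex_of_real (cos (s/2))" and "d \<equiv> complex_of_real (sin (s/2))"
  shows "spin_lift v1 v2 (V.turn E1 U s) (mat2 c (- \<i> * d) (- \<i> * d) c) 1"
proof -
  note ha = half_angle[of s, folded c_def d_def]
  \<comment> \<open>Rewrites d^2 as 1 - c^2, both for a bare square and for a square inside a longer
    product.\<close>
  have dd: "d * d = 1 - c * c" "d * (d * z) = z - c * (c * z)" for z using ha(3) by algebra+
  have k: "V.turn E1 U s *v E1 = cos s *\<^sub>R E1 + 0 *\<^sub>R E2 + (- sin s) *\<^sub>R U"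
    "V.turn E1 U s *v E2 = 0 *\<^sub>R E1 + 1 *\<^sub>R E2 + 0 *\<^sub>R U"
    "V.turn E1 U s *v U = sin s *\<^sub>R E1 + 0 *\<^sub>R E2 + cos s *\<^sub>R U"
    by (simp_all add: V.turn_def V.rot_mult H_basis algebra_simps)
  show ?thesis
    by (rule spin_liftI[OF disjI1[OF refl] _ k])
       (unfold of_real_minus ha(1,2), simp_all add: power2_eq_square algebra_simps dd)
qed

lemma spin_lift_turn2:
  fixes s defines "c \<equiv> complex_of_real (cos (s/2))" and "d \<equiv> complex_of_real (sin (s/2))"
  shows "spin_lift v1 v2 (V.turn E2 U s) (mat2 c (- d) d c) 1"
proof -
  note ha = half_angle[of s, folded c_def d_def]
  have dd: "d * d = 1 - c * c" "d * (d * z) = z - c * (c * z)" for z using ha(3) by algebra+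
  have k: "V.turn E2 U s *v E1 = 1 *\<^sub>R E1 + 0 *\<^sub>R E2 + 0 *\<^sub>R U"
    "V.turn E2 U s *v E2 = 0 *\<^sub>R E1 + cos s *\<^sub>R E2 + (- sin s) *\<^sub>R U"
    "V.turn E2 U s *v U = 0 *\<^sub>R E1 + sin s *\<^sub>R E2 + cos s *\<^sub>R U"
    by (simp_all add: V.turn_def V.rot_mult H_basis algebra_simps)
  show ?thesis
    by (rule spin_liftI[OF disjI1[OF refl] _ k])
       (unfold of_real_minus ha(1,2), simp_all add: power2_eq_square algebra_simps dd)
qed

lemma spin_lift_trivial:
  assumes "k *v E1 = E1" "k *v E2 = E2" "k *v U = U"
  shows "spin_lift v1 v2 k (mat 1) 1"
proof -
  have "mat 1 = mat2 1 0 0 1" by (simp add: mat2_def mat_def vec_eq_iff forall_2)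
  thus ?thesis by (simp only:) (rule spin_liftI[of 1 1 1 0 0 k 1 0 0 0 1 0 0 0 1], simp_all add: assms)
qed

text \<open>On V3 this element negates only \<open>U\<close>: it is -1 times the rotation by \<pi>
  in V2, which lifts to diag(i, -i).\<close>

lemma spin_lift_minus: "spin_lift v1 v2 (diag_mat (-1) (mat 1)) (mat2 \<i> 0 0 (- \<i>)) (-1)"
proof (rule spin_liftI)
  show "diag_mat (-1) (mat 1) *v E1 = 1 *\<^sub>R E1 + 0 *\<^sub>R E2 + 0 *\<^sub>R U"
    "diag_mat (-1) (mat 1) *v E2 = 0 *\<^sub>R E1 + 1 *\<^sub>R E2 + 0 *\<^sub>R U"
    "diag_mat (-1) (mat 1) *v U = 0 *\<^sub>R E1 + 0 *\<^sub>R E2 + (-1) *\<^sub>R U"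
    by (simp_all add: diag_mat_mult E_defs vec_of_linear)
qed (auto simp: algebra_simps)

text \<open>The middle coefficient is fixed by the whole of \<open>K \<inter> M\<close>, including the components where
  \<open>k\<close> reverses the orientation of \<open>V2\<close>.\<close>
lemma spin_lift_diag:
  assumes "k \<in> SO q" "\<And>x. x \<in> Vpos \<Longrightarrow> k *v x \<in> Vpos"
  obtains A \<epsilon> where "spin_lift v1 v2 (diag_mat 1 k) A \<epsilon>"
    "\<And>l p. coeff (smult (\<epsilon> ^ l) (sym_act (2 * l) A p)) l = coeff p l"
proof -
  obtain c d where k1: "k *v v1 = c *\<^sub>R v1 + d *\<^sub>R v2"
    using assms(2)[OF v_facts(5)] unfolding Vpos_iff pos_part_def by metis
  obtain c' d' where k2: "k *v v2 = c' *\<^sub>R v1 + d' *\<^sub>R v2"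
    using assms(2)[OF v_facts(6)] unfolding Vpos_iff pos_part_def by metis
  have 1: "c * c + d * d = 1" using SO_polar[OF assms(1), of v1 v1] by (simp add: k1 polar_simps v_facts v21)
  have 2: "c' * c' + d' * d' = 1" using SO_polar[OF assms(1), of v2 v2] by (simp add: k2 polar_simps v_facts v21)
  have 3: "c * c' + d * d' = 0" using SO_polar[OF assms(1), of v1 v2] by (simp add: k1 k2 polar_simps v_facts v21 mult.commute)
  \<comment> \<open>An orthogonal 2 by 2 matrix is a rotation or a reflection.\<close>
  have "(c' = - d \<and> d' = c) \<or> (c' = d \<and> d' = - c)"
  proof -
    have "(c' + d) * (c' - d) = 0" "(d' + c) * (d' - c) = 0" "(c' + d) * (d' + c) = 0" "(c' - d) * (d' - c) = 0"
      using 1 2 3 by algebra+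
    thus ?thesis using 1 3 by (auto simp: mult_eq_0_iff add_eq_0_iff2)
  qed
  have kE: "diag_mat 1 k *v E1 = c *\<^sub>R E1 + d *\<^sub>R E2 + 0 *\<^sub>R U" "diag_mat 1 k *v E2 = c' *\<^sub>R E1 + d' *\<^sub>R E2 + 0 *\<^sub>R U"
    "diag_mat 1 k *v U = 0 *\<^sub>R E1 + 0 *\<^sub>R E2 + 1 *\<^sub>R U"
    by (simp_all add: diag_mat_mult E_defs k1 k2 vec_of_linear)
  have i: "\<i>\<^sup>2 = -1" by simp
  have cd: "complex_of_real c * complex_of_real c + complex_of_real d * complex_of_real d = 1"
    using 1 by (metis of_real_1 of_real_add of_real_mult)
  from \<open>(c' = - d \<and> d' = c) \<or> (c' = d \<and> d' = - c)\<close> show ?thesis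
  proof
    assume cd': "c' = - d \<and> d' = c"
    \<comment> \<open>A rotation of V2 scales x^2 and y^2 by inverse phases; the diagonal lift needs
      a square root of the first.\<close>
    define \<alpha> where "\<alpha> = csqrt (of_real c - \<i> * of_real d)"
    have a2: "\<alpha>\<^sup>2 = of_real c - \<i> * of_real d" by (simp add: \<alpha>_def)
    have n0: "\<alpha> \<noteq> 0"
    proof
      assume "\<alpha> = 0"
      hence "(of_real c - \<i> * of_real d) * (of_real c + \<i> * of_real d) = (0::complex)" using a2 by simp
      thus False using cd i by (simp add: algebra_simps power2_eq_square)
    qed
    have b2: "(inverse \<alpha>)\<^sup>2 = of_real c + \<i> * of_real d"
    proof -
      have "\<alpha>\<^sup>2 * (of_real c + \<i> * of_real d) = 1" unfolding a2 using cd i by (simp add: algebra_simps power2_eq_square)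
      thus ?thesis using n0 by (simp add: field_simps)
    qed
    show ?thesis
    proof (rule that)
      show "spin_lift v1 v2 (diag_mat 1 k) (mat2 \<alpha> 0 0 (inverse \<alpha>)) 1"
        by (rule spin_liftI[OF _ _ kE]) (use n0 cd' in \<open>simp_all add: a2 b2 algebra_simps\<close>)
      show "coeff (smult (1 ^ l) (sym_act (2 * l) (mat2 \<alpha> 0 0 (inverse \<alpha>)) p)) l = coeff p l" for l p
        using n0 by (simp add: coeff_sym_act_diagonal flip: power_mult_distrib)
    qed
  next
    \<comment> \<open>A reflection of V2 fixing \<open>U\<close> has determinant -1 on V3, so
      \<epsilon> = -1 and its lift swaps x and y up to scalars. On the middle coefficient these
      scalars multiply to (-1)^l, which \<epsilon>^l cancels.\<close>
    assume cd': "c' = d \<and> d' = - c"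
    define \<beta> where "\<beta> = csqrt (- of_real c - \<i> * of_real d)"
    have a2: "\<beta>\<^sup>2 = - of_real c - \<i> * of_real d" by (simp add: \<beta>_def)
    have n0: "\<beta> \<noteq> 0"
    proof
      assume "\<beta> = 0"
      hence "(- of_real c - \<i> * of_real d) * (- of_real c + \<i> * of_real d) = (0::complex)" using a2 by simp
      thus False using cd i by (simp add: algebra_simps power2_eq_square)
    qed
    have b2: "(inverse \<beta>)\<^sup>2 = - of_real c + \<i> * of_real d"
    proof -
      have "\<beta>\<^sup>2 * (- of_real c + \<i> * of_real d) = 1" unfolding a2 using cd i by (simp add: algebra_simps power2_eq_square)
      thus ?thesis using n0 by (simp add: field_simps)
    qed
    let ?A = "mat2 0 (- inverse \<beta>) \<beta> 0"
    show ?thesis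
    proof (rule that)
      show "spin_lift v1 v2 (diag_mat 1 k) ?A (-1)"
        by (rule spin_liftI[OF _ _ kE]) (use n0 cd' in \<open>simp_all add: a2 b2 algebra_simps\<close>)
      show "coeff (smult ((-1) ^ l) (sym_act (2 * l) ?A p)) l = coeff p l" for l p
        using n0 by (simp add: coeff_sym_act_antidiagonal flip: power_mult_distrib)
    qed
  qed
qed

end

section \<open>The operator \<open>D\<^sub>l\<close>\<close>

lemma coeff_form_dy: "coeff (form_dy k p) j = (of_nat k - of_nat j) * coeff p j"
  by (cases j) (simp_all add: form_dy_def coeff_pderiv algebra_simps)

text \<open>Eliminating one unknown from the two transvectant identities decouples \<open>Y\<close> from \<open>X\<close>.\<close>
lemma pr_eq_0:
  assumes k: "k \<ge> 1" and pr: "pr k (smult (- 1 / 2) Y, Q, smult (- 1 / 2) X) = (0, 0)"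
  shows "(of_nat k - of_nat j) * coeff Y j = - of_nat (Suc j) * coeff Q (Suc j)"
    "of_nat (Suc j) * coeff X (Suc j) = - (of_nat k - of_nat j) * coeff Q j"
proof -
  define K where "K = (of_nat k :: complex)"
  have K: "K \<noteq> 0" "of_nat (k - 1) = K - 1" using k by (simp_all add: K_def of_nat_diff)
  have dy: "form_dy 2 (monom 1 2) = 0" "form_dy 2 (monom 1 1) = [:0, 1:]" "form_dy 2 (monom 1 0) = [:2:]"
    "form_dy 1 [:0, 1:] = 0" "form_dy 1 [:2:] = [:2:]" "form_dy i 0 = 0" for i
    by (rule poly_eqI; auto simp: coeff_form_dy coeff_pCons split: nat.split)+
  have dx: "form_dx (monom 1 2) = [:0, 2:]" "form_dx (monom 1 1) = 1" "form_dx (monom 1 0) = 0"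
    "form_dx [:0, 2:] = [:2:]" "form_dx [:0, 1:] = 1" "form_dx 1 = 0" "form_dx [:2:] = 0" "form_dx 0 = 0"
    by (rule poly_eqI; auto simp: form_dx_def coeff_pderiv coeff_pCons split: nat.split)+
  have t1: "transvectant1 k P (monom 1 2) = - (form_dy k P * [:0, 2:])"
    "transvectant1 k P (monom 1 1) = form_dx P * [:0, 1:] - form_dy k P"
    "transvectant1 k P (monom 1 0) = form_dx P * [:2:]" for P
    unfolding transvectant1_def dy dx by simp_all
  have t2: "transvectant2 k P (monom 1 2) = form_dy (k - 1) (form_dy k P) * [:2:]"
    "transvectant2 k P (monom 1 1) = - (form_dx (form_dy k P) * [:2:])"
    "transvectant2 k P (monom 1 0) = form_dx (form_dx P) * [:2:]" for P
    unfolding transvectant2_def dy dx by (simp_all add: numeral_poly)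
  have c1: "coeff (p * [:0, c:]) 0 = 0" "coeff (p * [:0, c:]) (Suc j) = c * coeff p j" "coeff (p * [:c:]) j = c * coeff p j"
    "coeff (form_dx p) j = of_nat (Suc j) * coeff p (Suc j)"
    for p :: "complex poly" and c j by (simp_all add: mult.commute[of p] form_dx_def coeff_pderiv)
  have T1: "- (form_dy k (smult (- 1 / 2) Y) * [:0, 2:]) + (form_dx Q * [:0, 1:] - form_dy k Q) + form_dx (smult (- 1 / 2) X) * [:2:] = 0"
    and T2: "form_dy (k - 1) (form_dy k (smult (- 1 / 2) Y)) * [:2:] + - (form_dx (form_dy k Q) * [:2:])
       + form_dx (form_dx (smult (- 1 / 2) X)) * [:2:] = 0"
    using pr unfolding pr_def prod.case t1 t2 by (metis Pair_inject)+
  have T10: "- K * coeff Q 0 - coeff X 1 = 0"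
    using arg_cong[OF T1, of "\<lambda>p. coeff p 0"] by (simp add: c1 coeff_form_dy K_def)
  have T1S: "(K - of_nat j) * coeff Y j + (2 * of_nat (Suc j) - K) * coeff Q (Suc j) - of_nat (Suc (Suc j)) * coeff X (Suc (Suc j)) = 0" for j
    using arg_cong[OF T1, of "\<lambda>p. coeff p (Suc j)"] by (simp add: c1 coeff_form_dy K_def algebra_simps add_divide_distrib diff_divide_distrib)
  have T2j: "- (K - of_nat j) * (K - 1 - of_nat j) * coeff Y j - 2 * of_nat (Suc j) * (K - of_nat (Suc j)) * coeff Q (Suc j)
     - of_nat (Suc (Suc j)) * of_nat (Suc j) * coeff X (Suc (Suc j)) = 0" for j
    using arg_cong[OF T2, of "\<lambda>p. coeff p j"] by (simp add: c1 coeff_form_dy K(2)[unfolded One_nat_def] K_def[symmetric] algebra_simps add_divide_distrib diff_divide_distrib)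
  \<comment> \<open>(j+1) times \<open>T1S\<close> minus \<open>T2j\<close> eliminates X; the factor
    \<open>K\<close>, nonzero because k >= 1, comes out of both remaining terms.\<close>
  have "K * ((K - of_nat j) * coeff Y j + of_nat (Suc j) * coeff Q (Suc j)) = 0"
  proof -
    have "of_nat (Suc j) = 1 + (of_nat j :: complex)" by simp
    thus ?thesis using T1S[of j] T2j[of j] by algebra
  qed
  hence "(K - of_nat j) * coeff Y j + of_nat (Suc j) * coeff Q (Suc j) = 0" using K by simp
  thus "(of_nat k - of_nat j) * coeff Y j = - of_nat (Suc j) * coeff Q (Suc j)"
    unfolding K_def by algebra
  show "of_nat (Suc j) * coeff X (Suc j) = - (of_nat k - of_nat j) * coeff Q j"
  proof (cases j)
    \<comment> \<open>The coefficient X_1 does not occur in the second transvectant; the constant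
      term of the first determines it alone.\<close>
    case 0 thus ?thesis using T10 by (simp add: K_def)
  next
    case (Suc i)
    have "of_nat (Suc i) = 1 + (of_nat i :: complex)" by simp
    hence "K * (of_nat (Suc (Suc i)) * coeff X (Suc (Suc i)) + (K - of_nat (Suc i)) * coeff Q (Suc i)) = 0"
      using T1S[of i] T2j[of i] by algebra
    hence "of_nat (Suc (Suc i)) * coeff X (Suc (Suc i)) + (K - of_nat (Suc i)) * coeff Q (Suc i) = 0" using K by simp
    thus ?thesis unfolding K_def Suc by algebra
  qed
qed

text \<open>Near g the function is the restriction of a function differentiable at g, so by the
  chain rule one linear map serves all curves with tangent gX. Curves need to lie in G only near s0,
  since \<open>diag_mat t m\<close> leaves G at t = 0.\<close>

lemma smooth_lie:
  fixes f :: "real^'k^'k \<Rightarrow> complex"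
  assumes "smooth_fun_on G f" "g \<in> G"
  shows "\<exists>L. linear L \<and> (\<forall>X \<gamma> s0. (\<gamma> has_vector_derivative g ** X) (at s0) \<longrightarrow> \<gamma> s0 = g \<longrightarrow> (\<forall>\<^sub>F s in at s0. \<gamma> s \<in> G) \<longrightarrow>
     ((\<lambda>s. f (\<gamma> s)) has_vector_derivative L X) (at s0))"
proof -
  have "\<exists>T h. open T \<and> g \<in> T \<and> (\<forall>k. Ck_on k T h) \<and> (\<forall>x\<in>T \<inter> G. h x = f x)"
    using assms by (simp add: smooth_fun_on_def)
  then obtain T h where T: "open T" "g \<in> T" "\<And>k. Ck_on k T h" "\<And>x. x \<in> T \<inter> G \<Longrightarrow> h x = f x"
    by metis
  have "h differentiable (at g)" using T(3)[of "Suc 0"] T(2) unfolding Ck_on.simps(2) by blast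
  then obtain D where D: "(h has_derivative D) (at g)" unfolding differentiable_def by blast
  have lin: "linear D" using has_derivative_linear[OF D] .
  show ?thesis
  proof (intro exI conjI allI impI)
    show "linear (\<lambda>X. D (g ** X))"
      using linear_compose[OF linear_matrix_mult_left lin] by (simp add: o_def)
    fix X \<gamma> and s0 :: real
    assume \<gamma>: "(\<gamma> has_vector_derivative g ** X) (at s0)" "\<gamma> s0 = g" "\<forall>\<^sub>F s in at s0. \<gamma> s \<in> G"
    have "isCont \<gamma> s0" using \<gamma>(1) has_vector_derivative_continuous by blast
    hence ev: "\<forall>\<^sub>F s in at s0. \<gamma> s \<in> T"
      using T(1,2) \<gamma>(2) by (auto simp: isCont_def intro: topological_tendstoD)
    have "((h \<circ> \<gamma>) has_derivative D \<circ> (\<lambda>s. s *\<^sub>R (g ** X))) (at s0)"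
      using \<gamma>(1) D unfolding has_vector_derivative_def \<gamma>(2)[symmetric] by (intro diff_chain_at) auto
    hence "((h \<circ> \<gamma>) has_vector_derivative D (g ** X)) (at s0)"
      unfolding has_vector_derivative_def by (simp add: o_def linear_scale[OF lin])
    thus "((\<lambda>s. f (\<gamma> s)) has_vector_derivative D (g ** X)) (at s0)"
      unfolding has_vector_derivative_def
      by (rule has_derivative_transform_eventually) (use eventually_conj[OF ev \<gamma>(3)] T(2,4) \<gamma>(2) assms(2) in \<open>auto elim!: eventually_mono\<close>)
  qed
qed

section \<open>Derivatives of F along the Lie algebra\<close>

locale whittaker = signature_space q n Vpos Vn v1 v2
  for q :: "real^'m \<Rightarrow> real" and n Vpos Vn v1 v2 +
  fixes l :: nat and \<eta> :: "real^'m" and F :: "real^('m + bool)^('m + bool) \<Rightarrow> complex poly"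
  assumes n1: "n \<ge> 1" and l1: "l \<ge> 1" and gen: "gen_whittaker q Vn v1 v2 l \<eta> F"
begin

abbreviation "G \<equiv> SO (hyp q)"
abbreviation "k2 \<equiv> 2 * l"

lemma F_forms: "g \<in> G \<Longrightarrow> F g \<in> forms k2"
  and F_smooth: "smooth_fun_on G (\<lambda>g. coeff (F g) j)"
  and F_growth: "moderate_growth_on G F"
  and F_N: "g \<in> G \<Longrightarrow> F (nmat q x ** g) = smult (exp (\<i> * complex_of_real (polar q \<eta> x))) (F g)"
  and F_K: "K_equivariant q v1 v2 l F"
  and F_D: "g \<in> G \<Longrightarrow> b \<in> Vminus Vn \<Longrightarrow> D_op q v1 v2 l F g b = (0, 0)"
  using gen by (auto simp: gen_whittaker_def)

lemma F_K_apply: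
  assumes "g \<in> G" "k \<in> Kgroup q v1 v2" "k ** k' = mat 1" "spin_lift v1 v2 k' A \<epsilon>"
  shows "F (g ** k) = smult (\<epsilon> ^ l) (sym_act k2 A (F g))"
proof -
  have "k \<in> G" using assms(2) by (simp add: Kgroup_def)
  hence "matrix_inv k = k'"
    by (metis assms(3) V.SO_inv(2) matrix_mul_assoc matrix_mul_lid matrix_mul_rid)
  thus ?thesis using F_K assms unfolding K_equivariant_def by blast
qed

text \<open>F determines the value only on tangent directions of G; a choice fixes a linear
  extension to all matrices, so linearity needs no tangency conditions.\<close>

definition lie :: "nat \<Rightarrow> real^('m+bool)^('m+bool) \<Rightarrow> real^('m+bool)^('m+bool) \<Rightarrow> complex" where
  "lie j g = (SOME L. linear L \<and> (\<forall>X \<gamma> s0. (\<gamma> has_vector_derivative g ** X) (at s0) \<longrightarrow> \<gamma> s0 = g \<longrightarrow> (\<forall>\<^sub>F s in at s0. \<gamma> s \<in> G) \<longrightarrow>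
     ((\<lambda>s. coeff (F (\<gamma> s)) j) has_vector_derivative L X) (at s0)))"

text \<open>Unlike \<open>right_deriv\<close>, this is linear in \<open>X\<close> by construction and may be computed along any curve.\<close>
definition dF :: "real^('m+bool)^('m+bool) \<Rightarrow> real^('m+bool)^('m+bool) \<Rightarrow> complex poly" where
  "dF g X = (\<Sum>j\<le>k2. monom (lie j g X) j)"

lemma lie:
  assumes "g \<in> G"
  shows "linear (lie j g)"
    "(\<gamma> has_vector_derivative g ** X) (at s0) \<Longrightarrow> \<gamma> s0 = g \<Longrightarrow> (\<forall>\<^sub>F s in at s0. \<gamma> s \<in> G) \<Longrightarrow>
       ((\<lambda>s. coeff (F (\<gamma> s)) j) has_vector_derivative lie j g X) (at s0)"
  using someI_ex[OF smooth_lie[OF F_smooth[of j] assms]] unfolding lie_def[symmetric] by blast+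

lemma coeff_dF: "coeff (dF g X) j = (if j \<le> k2 then lie j g X else 0)"
  by (simp add: dF_def coeff_sum)

lemma dF_forms: "dF g X \<in> forms k2"
  by (auto simp: forms_def coeff_dF intro: degree_le)

lemma dF_linear:
  assumes "g \<in> G"
  shows "dF g (X + Y) = dF g X + dF g Y" "dF g (X - Y) = dF g X - dF g Y" "dF g (c *\<^sub>R X) = smult (of_real c) (dF g X)"
    "dF g (- X) = - dF g X"
  by (rule poly_eqI; simp add: coeff_dF linear_add[OF lie(1)[OF assms]] linear_diff[OF lie(1)[OF assms]]
      linear_scale[OF lie(1)[OF assms]] linear_neg[OF lie(1)[OF assms]] scaleR_conv_of_real[of c "lie _ g X"])+

lemma dF_curve:
  assumes "g \<in> G" "(\<gamma> has_vector_derivative g ** X) (at s0)" "\<gamma> s0 = g" "\<forall>\<^sub>F s in at s0. \<gamma> s \<in> G"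
  shows "((\<lambda>s. coeff (F (\<gamma> s)) j) has_vector_derivative coeff (dF g X) j) (at s0)"
proof (cases "j \<le> k2")
  case True
  thus ?thesis using lie(2)[OF assms, of j] by (simp add: coeff_dF)
next
  case False
  have 0: "coeff (F h) j = 0" if "h \<in> G" for h
    using F_forms[OF that] False by (auto simp: forms_def intro!: coeff_eq_0)
  have "((\<lambda>s. coeff (F (\<gamma> s)) j) has_derivative (\<lambda>h. 0)) (at s0)"
    by (rule has_derivative_transform_eventually[OF has_derivative_const[of 0]])
       (use assms 0 in \<open>auto elim!: eventually_mono\<close>)
  thus ?thesis using False by (simp add: coeff_dF has_vector_derivative_def)
qed

lemma dF_curve_poly:
  assumes "g \<in> G" "(\<gamma> has_vector_derivative g ** X) (at s0)" "\<gamma> s0 = g" "\<And>s. \<gamma> s \<in> G"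
  shows "((\<lambda>s. poly (F (\<gamma> s)) z) has_vector_derivative poly (dF g X) z) (at s0)"
  unfolding poly_forms[OF F_forms[OF assms(4)]] poly_forms[OF dF_forms]
  by (intro has_vector_derivative_sum has_vector_derivative_mult_left dF_curve assms always_eventually allI)

text \<open>A polynomial is determined by its values, so a formula for F along one curve with the
  right tangent identifies \<open>dF\<close>.\<close>

lemma dF_unique:
  assumes "g \<in> G" "(\<gamma> has_vector_derivative X) (at 0)" "\<gamma> 0 = mat 1" "\<And>s. \<gamma> s \<in> G"
    and "\<And>z. ((\<lambda>s. poly (F (g ** \<gamma> s)) z) has_vector_derivative poly P z) (at 0)"
  shows "dF g X = P"
proof -
  have "((\<lambda>s. g ** \<gamma> s) has_vector_derivative g ** X) (at 0)"
    using bounded_linear.has_vector_derivative[OF linear_conv_bounded_linear[THEN iffD1, OF linear_matrix_mult_left] assms(2)] .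
  hence "((\<lambda>s. poly (F (g ** \<gamma> s)) z) has_vector_derivative poly (dF g X) z) (at 0)" for z
    by (rule dF_curve_poly[OF assms(1)]) (use assms V.SO_mult in auto)
  hence "poly (dF g X) z = poly P z" for z
    using assms(5) vector_derivative_unique_at by blast
  thus ?thesis by (simp add: poly_eq_poly_eq_iff[symmetric] ext)
qed

text \<open>The exponential curve in the definition of the operator is one of the curves allowed in
  \<open>dF_curve\<close>.\<close>

lemma right_deriv_eq:
  assumes "g \<in> G" "H w b = 0" "H w w = 1" "b = 0 \<or> H b b < 0"
  shows "right_deriv l (wedgeV w b) F g = dF g (wedgeV w b)"
proof -
  let ?\<gamma> = "\<lambda>s. g ** mexp (s *\<^sub>R wedgeV w b)"
  note m = V.mexp_wedge[OF assms(2-4)]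
  have "(?\<gamma> has_vector_derivative g ** wedgeV w b) (at 0)"
    using bounded_linear.has_vector_derivative[OF linear_conv_bounded_linear[THEN iffD1, OF linear_matrix_mult_left] m(3)] .
  hence "((\<lambda>s. coeff (F (?\<gamma> s)) j) has_vector_derivative coeff (dF g (wedgeV w b)) j) (at 0)" for j
    by (rule dF_curve[OF assms(1)]) (use assms(1) V.SO_mult m(1,2) in \<open>auto intro!: always_eventually\<close>)
  hence "vector_derivative (\<lambda>s. coeff (F (?\<gamma> s)) j) (at 0) = coeff (dF g (wedgeV w b)) j" for j
    by (rule vector_derivative_at)
  thus ?thesis by (auto intro!: poly_eqI simp: right_deriv_def coeff_sum coeff_dF)
qed

lemma right_deriv_zero: "right_deriv l (wedgeV 0 b) F g = 0"
proof -
  have "wedgeV 0 b = 0" by (rule matrix_eqI) (simp add: V.wedge_mult V.polar_simps)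
  thus ?thesis by (simp add: right_deriv_def)
qed

text \<open>The vectors \<open>b\<close> for which \<open>w \<and> b\<close> is a multiple of the generator of a boost for all unit \<open>w \<in> V\<^sub>3\<close>.\<close>
definition admissible where
  "admissible b \<longleftrightarrow> b \<in> Vminus Vn \<and> (b = 0 \<or> H b b < 0) \<and> H E1 b = 0 \<and> H E2 b = 0 \<and> H U b = 0"

lemma admissible_Vn:
  assumes "y \<in> Vn" shows "admissible (vec_of 0 y 0)"
proof -
  have "vec_of 0 y 0 \<in> Vminus Vn"
    unfolding Vminus_def using assms by (auto intro!: exI[of _ 0] exI[of _ y])
  moreover have "vec_of 0 y 0 = (0 :: real^('m+bool)) \<or> H (vec_of 0 y 0) (vec_of 0 y 0) < 0"
    using v_facts(11)[OF assms] by (cases "y = 0") (auto simp: H_eq polar_self vec_of_linear)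
  moreover have "polar q v1 y = 0" "polar q v2 y = 0" using assms by (auto simp: Vn_iff)
  ultimately show ?thesis by (simp add: admissible_def H_eq E_defs polar_simps)
qed

lemma admissible_W: "admissible W"
  using v_facts(8) H_basis
  by (auto simp: admissible_def Vminus_def W_def intro!: exI[of _ "1 / sqrt 2"] exI[of _ 0] subspace_0)

lemma p_deriv_eq:
  assumes "g \<in> G" "admissible b"
  shows "p_deriv (hyp q) l (S2_to_V3 v1 v2 (monom 1 2)) b F g = smult \<i> (dF g (wedgeV E1 b)) - dF g (wedgeV E2 b)"
    "p_deriv (hyp q) l (S2_to_V3 v1 v2 (monom 1 0)) b F g = smult \<i> (dF g (wedgeV E1 b)) + dF g (wedgeV E2 b)"
    "p_deriv (hyp q) l (S2_to_V3 v1 v2 (monom 1 1)) b F g = dF g (wedgeV U b)"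
proof -
  have b: "b = 0 \<or> H b b < 0" "H E1 b = 0" "H E2 b = 0" "H U b = 0" "H (- E2) b = 0" "H (- E2) (- E2) = 1"
    using assms(2) by (auto simp: admissible_def V.polar_simps H_basis)
  have "wedgeV (- E2) b = - wedgeV E2 b" using V.wedge_scale_left[of "-1" E2 b] by simp
  hence "right_deriv l (wedgeV (- E2) b) F g = - dF g (wedgeV E2 b)"
    using right_deriv_eq[OF assms(1) b(5,6,1)] dF_linear(4)[OF assms(1)] by metis
  thus "p_deriv (hyp q) l (S2_to_V3 v1 v2 (monom 1 2)) b F g = smult \<i> (dF g (wedgeV E1 b)) - dF g (wedgeV E2 b)"
    unfolding p_deriv_def S2_Re_Im
    by (simp add: right_deriv_eq[OF assms(1) b(2) H_basis(1) b(1)])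
  show "p_deriv (hyp q) l (S2_to_V3 v1 v2 (monom 1 0)) b F g = smult \<i> (dF g (wedgeV E1 b)) + dF g (wedgeV E2 b)"
    unfolding p_deriv_def S2_Re_Im
    by (simp add: right_deriv_eq[OF assms(1) b(2) H_basis(1) b(1)] right_deriv_eq[OF assms(1) b(3) H_basis(2) b(1)])
  show "p_deriv (hyp q) l (S2_to_V3 v1 v2 (monom 1 1)) b F g = dF g (wedgeV U b)"
    unfolding p_deriv_def S2_Re_Im
    by (simp add: right_deriv_eq[OF assms(1) b(4) H_basis(3) b(1)] right_deriv_zero)
qed

text \<open>The combinations \<open>\<i> E1 + E2\<close> and \<open>\<i> E1 - E2\<close> represent
  y^2 and x^2, and \<open>U\<close> represents xy, so each identity expresses a derivative along a
  square through the one along xy.\<close>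

lemma D_equations:
  assumes "g \<in> G" "admissible b"
  shows "(of_nat k2 - of_nat j) * coeff (smult \<i> (dF g (wedgeV E1 b)) + dF g (wedgeV E2 b)) j
      = - of_nat (Suc j) * coeff (dF g (wedgeV U b)) (Suc j)"
    "of_nat (Suc j) * coeff (smult \<i> (dF g (wedgeV E1 b)) - dF g (wedgeV E2 b)) (Suc j)
      = - (of_nat k2 - of_nat j) * coeff (dF g (wedgeV U b)) j"
proof -
  have "b \<in> Vminus Vn" using assms(2) by (simp add: admissible_def)
  from F_D[OF assms(1) this] have pr: "pr k2 (smult (- 1 / 2) (smult \<i> (dF g (wedgeV E1 b)) + dF g (wedgeV E2 b)),
     dF g (wedgeV U b), smult (- 1 / 2) (smult \<i> (dF g (wedgeV E1 b)) - dF g (wedgeV E2 b))) = (0, 0)"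
    unfolding D_op_def D_tilde_def p_deriv_eq[OF assms] .
  have k: "k2 \<ge> 1" using l1 by simp
  show "(of_nat k2 - of_nat j) * coeff (smult \<i> (dF g (wedgeV E1 b)) + dF g (wedgeV E2 b)) j
      = - of_nat (Suc j) * coeff (dF g (wedgeV U b)) (Suc j)"
    by (rule pr_eq_0(1)[OF k pr])
  show "of_nat (Suc j) * coeff (smult \<i> (dF g (wedgeV E1 b)) - dF g (wedgeV E2 b)) (Suc j)
      = - (of_nat k2 - of_nat j) * coeff (dF g (wedgeV U b)) j"
    by (rule pr_eq_0(2)[OF k pr])
qed

lemma dF_N:
  assumes "m \<in> SO q" "t \<noteq> 0"
  shows "dF (diag_mat t m) (wedgeV ee (vec_of 0 x 0)) = smult (\<i> * of_real (t * polar q \<eta> (m *v x))) (F (diag_mat t m))"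
proof (rule dF_unique[OF diag_SO[OF assms] nmat_deriv])
  fix z
  have "(\<lambda>s. poly (F (diag_mat t m ** nmat q (s *\<^sub>R x))) z) =
     (\<lambda>s. exp (of_real s * (\<i> * of_real (t * polar q \<eta> (m *v x)))) * poly (F (diag_mat t m)) z)"
    unfolding diag_nmat[OF assms] F_N[OF diag_SO[OF assms]]
    by (simp add: matrix_vector_algebra polar_simps algebra_simps)
  moreover have "(\<dots> has_vector_derivative (\<i> * of_real (t * polar q \<eta> (m *v x))) * poly (F (diag_mat t m)) z) (at 0)"
  proof -
    define c where "c = \<i> * of_real (t * polar q \<eta> (m *v x))"
    have "((\<lambda>z. exp (z * c)) has_field_derivative c) (at (of_real 0))"
      by (auto intro!: derivative_eq_intros)
    thus ?thesis unfolding c_def[symmetric]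
      by (intro has_vector_derivative_mult_left has_vector_derivative_real_field)
  qed
  ultimately show "((\<lambda>s. poly (F (diag_mat t m ** nmat q (s *\<^sub>R x))) z) has_vector_derivative
     poly (smult (\<i> * of_real (t * polar q \<eta> (m *v x))) (F (diag_mat t m))) z) (at 0)" by simp
qed (auto simp: nmat_zero nmat_SO)

lemma poly_pderiv_forms:
  assumes "p \<in> forms k"
  shows "poly (pderiv p) z = (\<Sum>j\<le>k. coeff p j * (of_nat j * z ^ (j - 1)))"
proof -
  have "p = (\<Sum>j\<le>k. monom (coeff p j) j)"
    using assms by (auto intro!: poly_eqI simp: coeff_sum forms_def coeff_eq_0)
  hence "poly (pderiv p) z = poly (pderiv (\<Sum>j\<le>k. monom (coeff p j) j)) z" by simp
  also have "\<dots> = (\<Sum>j\<le>k. coeff p j * (of_nat j * z ^ (j - 1)))"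
  proof -
    have "pderiv (\<Sum>j\<le>i. monom (coeff p j) j) = (\<Sum>j\<le>i. pderiv (monom (coeff p j) j))" for i
      by (induction i) (simp_all add: pderiv_add)
    thus ?thesis by (simp add: pderiv_monom poly_sum poly_monom algebra_simps)
  qed
  finally show ?thesis .
qed

lemma poly_form_dy:
  assumes "p \<in> forms k"
  shows "z * poly (form_dy k p) z = (\<Sum>j\<le>k. coeff p j * (of_nat (k - j) * z ^ (j + 1)))"
proof -
  have "form_dy k p \<in> forms k"
    using assms by (auto simp: forms_def coeff_form_dy coeff_eq_0 intro!: degree_le)
  thus ?thesis by (auto simp: poly_forms coeff_form_dy sum_distrib_left of_nat_diff algebra_simps intro!: sum.cong)
qed

lemma sym_act_deriv:
  assumes "p \<in> forms k" "A 0 = mat 1"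
    and A: "\<And>i j. ((\<lambda>s. A s $ i $ j) has_vector_derivative A' $ i $ j) (at (0::real))"
    and A'0: "A' $ 1 $ 1 = 0" "A' $ 2 $ 2 = 0"
  shows "((\<lambda>s. poly (sym_act k (A s) p) z) has_vector_derivative
     poly (smult (A' $ 2 $ 1) (pderiv p) + smult (A' $ 1 $ 2) ([:0, 1:] * form_dy k p)) z) (at 0)"
proof -
  have eq: "poly (smult (A' $ 2 $ 1) (pderiv p) + smult (A' $ 1 $ 2) ([:0, 1:] * form_dy k p)) z
     = (\<Sum>j\<le>k. coeff p j * ((of_nat j * z ^ (j - 1) * (A' $ 2 $ 1)) + z ^ j * (of_nat (k - j) * (A' $ 1 $ 2 * z))))"
  proof -
    have "poly (smult (A' $ 2 $ 1) (pderiv p) + smult (A' $ 1 $ 2) ([:0, 1:] * form_dy k p)) z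
       = A' $ 2 $ 1 * poly (pderiv p) z + A' $ 1 $ 2 * (z * poly (form_dy k p) z)" by simp
    also have "\<dots> = (\<Sum>j\<le>k. A' $ 2 $ 1 * (coeff p j * (of_nat j * z ^ (j - 1))) + A' $ 1 $ 2 * (coeff p j * (of_nat (k - j) * z ^ (j + 1))))"
      unfolding poly_form_dy[OF assms(1)] poly_pderiv_forms[OF assms(1)] sum_distrib_left sum.distrib ..
    finally show ?thesis by (simp add: algebra_simps)
  qed
  have e11: "((\<lambda>s. A s $ 2 $ 1 + A s $ 1 $ 1 * z) has_derivative (\<lambda>h. h *\<^sub>R (A' $ 2 $ 1))) (at 0)"
    and e12: "((\<lambda>s. A s $ 2 $ 2 + A s $ 1 $ 2 * z) has_derivative (\<lambda>h. h *\<^sub>R (A' $ 1 $ 2 * z))) (at 0)"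
    using A[of 2 1] A[of 1 1] A[of 2 2] A[of 1 2] A'0 unfolding has_vector_derivative_def
    by (auto intro!: derivative_eq_intros)
  have *: "((\<lambda>s. coeff p j * (A s $ 2 $ 1 + A s $ 1 $ 1 * z) ^ j * (A s $ 2 $ 2 + A s $ 1 $ 2 * z) ^ (k - j)) has_derivative
     (\<lambda>h. h *\<^sub>R (coeff p j * ((of_nat j * z ^ (j - 1) * (A' $ 2 $ 1)) + z ^ j * (of_nat (k - j) * (A' $ 1 $ 2 * z)))))) (at 0)" for j
    by (rule derivative_eq_intros e11 e12 refl)+
       (simp add: assms(2) mat_def scaleR_conv_of_real algebra_simps fun_eq_iff)
  show ?thesis
    unfolding eq poly_sym_act
    by (intro has_vector_derivative_sum) (unfold has_vector_derivative_def, rule *)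
qed

lemma dF_turn:
  assumes "g \<in> G" "v = E1 \<or> v = E2"
    and sl: "\<And>s. spin_lift v1 v2 (V.turn v U s) (mat2 (of_real (cos (s/2))) (c * of_real (sin (s/2))) (d * of_real (sin (s/2))) (of_real (cos (s/2)))) 1"
  shows "dF g (wedgeV v U) = smult (- d / 2) (pderiv (F g)) + smult (- c / 2) ([:0, 1:] * form_dy k2 (F g))"
proof (rule dF_unique[OF assms(1) V.turn_deriv0])
  have vU: "H v U = 0" "H v v * H U U = 1" "iota q v1 v2 v = 1 *\<^sub>R v" using assms(2) by (auto simp: H_basis iota_basis)
  \<comment> \<open>Taken at -s because F(gk) is the inverse of k applied to F(g); this and the half
    angle produce the factor -1/2.\<close>
  define A where "A = (\<lambda>s. mat2 (of_real (cos (- s/2))) (c * of_real (sin (- s/2))) (d * of_real (sin (- s/2))) (of_real (cos (- s/2))))"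
  have inv: "V.turn v U s ** V.turn v U (- s) = mat 1" for s
    by (simp add: V.turn_add[OF vU(1,2)] V.turn_zero)
  have F: "F (g ** V.turn v U s) = sym_act k2 (A s) (F g)" for s
    using F_K_apply[OF assms(1) turn_K[OF vU iota_basis(3)] inv sl] by (simp add: A_def)
  fix z
  have "((\<lambda>s. poly (sym_act k2 (A s) (F g)) z) has_vector_derivative
     poly (smult (mat2 0 (- c / 2) (- d / 2) 0 $ 2 $ 1) (pderiv (F g)) + smult (mat2 0 (- c / 2) (- d / 2) 0 $ 1 $ 2) ([:0, 1:] * form_dy k2 (F g))) z) (at 0)"
  proof (rule sym_act_deriv[OF F_forms[OF assms(1)]])
    show "A 0 = mat 1" by (simp add: A_def mat2_def mat_def vec_eq_iff forall_2)
    show "((\<lambda>s. A s $ i $ j) has_vector_derivative mat2 0 (- c / 2) (- d / 2) 0 $ i $ j) (at 0)" for i j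
      using exhaust_2[of i] exhaust_2[of j] unfolding A_def has_vector_derivative_def
      by (auto intro!: derivative_eq_intros simp: fun_eq_iff scaleR_conv_of_real)
  qed simp_all
  thus "((\<lambda>s. poly (F (g ** V.turn v U s)) z) has_vector_derivative
     poly (smult (- d / 2) (pderiv (F g)) + smult (- c / 2) ([:0, 1:] * form_dy k2 (F g))) z) (at 0)"
    unfolding F mat2_simps .
  show "V.turn v U s \<in> G" for s by (rule V.turn_SO[OF vU(1,2)])
qed (simp add: V.turn_zero)

lemma dF_E1_U: "g \<in> G \<Longrightarrow> dF g (wedgeV E1 U) = smult (\<i> / 2) (pderiv (F g) + [:0, 1:] * form_dy k2 (F g))"
  using dF_turn[of g E1 "- \<i>" "- \<i>"] spin_lift_turn1 by (simp add: smult_add_right)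

lemma dF_E2_U: "g \<in> G \<Longrightarrow> dF g (wedgeV E2 U) = smult (1 / 2) ([:0, 1:] * form_dy k2 (F g) - pderiv (F g))"
  using dF_turn[of g E2 "- 1" 1] spin_lift_turn2 by (simp add: smult_diff_right)

text \<open>\<open>W \<and> y\<close> generates rotations inside the negative definite space
  \<open>V_{n+1}\<close>; they fix V3 pointwise and hence act trivially on the values of F.\<close>

lemma dF_W_Vn:
  assumes "g \<in> G" "y \<in> Vn" shows "dF g (wedgeV W (vec_of 0 y 0)) = 0"
proof -
  have unit: "dF g (wedgeV W (vec_of 0 b 0)) = 0" if b: "b \<in> Vn" "polar q b b = -1" for b
  proof (rule dF_unique[OF assms(1) V.turn_deriv0])
    let ?b = "vec_of 0 b 0"
    have H: "H W ?b = 0" "H W W * H ?b ?b = 1" "H ?b W = 0"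
      using b by (simp_all add: H_basis) (simp_all add: H_eq E_defs polar_simps)
    have H0: "H ?b E1 = 0" "H ?b E2 = 0" "H ?b U = 0"
      using b polar_Vpos_Vn[OF v_facts(5)] polar_Vpos_Vn[OF v_facts(6)] by (simp_all add: H_eq E_defs polar_simps)
    show G: "V.turn W ?b s \<in> G" for s by (rule V.turn_SO[OF H(1,2)])
    have inv: "V.turn W ?b s ** V.turn W ?b (- s) = mat 1" for s
      by (simp add: V.turn_add[OF H(1,2)] V.turn_zero)
    have sl: "spin_lift v1 v2 (V.turn W ?b (- s)) (mat 1) 1" for s
      by (rule spin_lift_trivial) (simp_all add: V.turn_def V.rot_mult[OF H(1)] H_basis H0)
    have "F (g ** V.turn W ?b s) = F g" for s
      using F_K_apply[OF assms(1) turn_K[OF H(1,2) iota_basis(4) iota_basis(5)[OF b(1)]] inv sl]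
      by (simp add: sym_act_one[OF F_forms[OF assms(1)]])
    thus "((\<lambda>s. poly (F (g ** V.turn W ?b s)) z) has_vector_derivative poly 0 z) (at 0)" for z by simp
  qed (simp add: V.turn_zero)
  show ?thesis
  proof (cases "y = 0")
    case True
    have "wedgeV W (vec_of 0 y 0) = 0 *\<^sub>R wedgeV W (vec_of 0 y 0)"
      unfolding True by (rule matrix_eqI) (simp add: V.wedge_mult V.polar_simps vec_of_linear)
    thus ?thesis by (metis dF_linear(3)[OF assms(1)] of_real_0 smult_0_left)
  next
    case False
    define c where "c = sqrt (- polar q y y)"
    have c: "c > 0" "polar q y y = - c\<^sup>2" using v_facts(11)[OF assms(2) False] by (auto simp: c_def polar_self)
    have y: "y = c *\<^sub>R ((1/c) *\<^sub>R y)" using c by simp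
    have "dF g (wedgeV W (vec_of 0 ((1/c) *\<^sub>R y) 0)) = 0"
      using c v_facts(8) assms(2) by (intro unit subspace_scale) (auto simp: polar_simps power2_eq_square)
    moreover have "wedgeV W (vec_of 0 y 0) = c *\<^sub>R wedgeV W (vec_of 0 ((1/c) *\<^sub>R y) 0)"
      by (subst y) (simp add: vec_of_linear V.wedge_scale_right[symmetric])
    ultimately show ?thesis by (simp add: dF_linear[OF assms(1)])
  qed
qed

end

section \<open>The Bessel equation\<close>

text \<open>The Wronskian with \<open>(K\<^sub>0, K\<^sub>1)\<close> is constant and, by the growth condition, tends to \<open>0\<close>.\<close>
lemma bessel_system_moderate:
  fixes f0 f1 :: "real \<Rightarrow> complex" and c :: real
  assumes c: "c > 0"
    and f0: "\<And>t. t > 0 \<Longrightarrow> (f0 has_vector_derivative - (c *\<^sub>R f1 t)) (at t)"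
    and f1: "\<And>t. t > 0 \<Longrightarrow> (f1 has_vector_derivative - (c *\<^sub>R f0 t) - (1 / t) *\<^sub>R f1 t) (at t)"
    and growth: "\<And>t. t \<ge> 1 \<Longrightarrow> norm (f0 t) \<le> M * t ^ N" "\<And>t. t \<ge> 1 \<Longrightarrow> norm (f1 t) \<le> M * t ^ N"
  shows "\<exists>C. \<forall>t>0. f0 t = C * of_real (bessel_K 0 (c * t)) \<and> f1 t = C * of_real (bessel_K 1 (c * t))"
proof -
  define K0 where "K0 = (\<lambda>t. bessel_K 0 (c * t))"
  define K1 where "K1 = (\<lambda>t. bessel_K 1 (c * t))"
  have pos: "K0 t > 0" "K1 t > 0" if "t > 0" for t using that c by (auto simp: K0_def K1_def bessel_K_pos)
  have lin: "((\<lambda>t. c * t) has_real_derivative c) (at t)" for t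
    by (auto intro!: derivative_eq_intros)
  have dK0: "(K0 has_vector_derivative - (c * K1 t)) (at t)" if "t > 0" for t
  proof -
    have "c * t > 0" using c that by simp
    from DERIV_chain2[of "bessel_K 0" _ "\<lambda>t. c * t", OF bessel_K0_deriv[OF this] lin]
    show ?thesis
      by (simp add: K0_def K1_def has_real_derivative_iff_has_vector_derivative[symmetric] mult.commute)
  qed
  have dK1: "(K1 has_vector_derivative - (c * K0 t) - K1 t / t) (at t)" if "t > 0" for t
  proof -
    have "c * t > 0" using c that by simp
    note DERIV_chain2[of "bessel_K 1" _ "\<lambda>t. c * t", OF bessel_K1_deriv[OF this] lin]
    moreover have "(- bessel_K 0 (c * t) - bessel_K 1 (c * t) / (c * t)) * c = - (c * K0 t) - K1 t / t"
      using c by (simp add: K0_def K1_def field_simps)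
    ultimately show ?thesis by (simp add: K1_def has_real_derivative_iff_has_vector_derivative)
  qed
  \<comment> \<open>The system has trace -1/t, so by Liouville the Wronskian is proportional to 1/t;
    the factor t makes it constant.\<close>
  define w where "w = (\<lambda>t. t *\<^sub>R (K1 t *\<^sub>R f0 t - K0 t *\<^sub>R f1 t))"
  have "(w has_derivative (\<lambda>h. 0)) (at t within {0<..})" if "t \<in> {0<..}" for t
  proof -
    have t: "t > 0" using that by simp
    have "(w has_vector_derivative t *\<^sub>R ((K1 t *\<^sub>R (- (c *\<^sub>R f1 t)) + (- (c * K0 t) - K1 t / t) *\<^sub>R f0 t)
        - (K0 t *\<^sub>R (- (c *\<^sub>R f0 t) - (1 / t) *\<^sub>R f1 t) + (- (c * K1 t)) *\<^sub>R f1 t)) + 1 *\<^sub>R (K1 t *\<^sub>R f0 t - K0 t *\<^sub>R f1 t)) (at t)"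
      unfolding w_def
      using dK0[OF t] dK1[OF t] f0[OF t] f1[OF t]
      by (intro has_vector_derivative_scaleR has_vector_derivative_diff)
         (auto simp: has_real_derivative_iff_has_vector_derivative has_vector_derivative_id[unfolded id_def] intro!: derivative_eq_intros)
    moreover have "t *\<^sub>R ((K1 t *\<^sub>R (- (c *\<^sub>R f1 t)) + (- (c * K0 t) - K1 t / t) *\<^sub>R f0 t)
        - (K0 t *\<^sub>R (- (c *\<^sub>R f0 t) - (1 / t) *\<^sub>R f1 t) + (- (c * K1 t)) *\<^sub>R f1 t)) + 1 *\<^sub>R (K1 t *\<^sub>R f0 t - K0 t *\<^sub>R f1 t) = 0"
      using t by (simp add: scaleR_conv_of_real field_simps)
    ultimately show ?thesis
      by (auto simp: has_vector_derivative_def intro: has_derivative_at_withinI)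
  qed
  then obtain w0 where w0: "\<And>t. t > 0 \<Longrightarrow> w t = w0"
    using has_derivative_zero_constant[of "{0<..}" w] by (auto simp: convex_real_interval)
  have "w0 = 0"
  proof -
    define B where "B = M * (exp 1 * bessel_K 1 1 + exp 1 * bessel_K 0 1)"
    \<comment> \<open>The exponential decay of K_0 and K_1 against the polynomial growth of f0 and
      f1.\<close>
    have bound: "norm (w t) \<le> B * (t ^ (N + 1) * exp (- c * t))" if t: "t \<ge> max 1 (1 / c)" for t
    proof -
      have t1: "t \<ge> 1" "c * t \<ge> 1" using t c by (auto simp: field_simps)
      have d: "K0 t \<le> exp (1 - c * t) * bessel_K 0 1" "K1 t \<le> exp (1 - c * t) * bessel_K 1 1"
        unfolding K0_def K1_def by (intro bessel_K_decay t1(2))+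
      have M: "M * t ^ N \<ge> 0" using growth(1)[OF t1(1)] norm_ge_zero order_trans by blast
      have "norm (K1 t *\<^sub>R f0 t - K0 t *\<^sub>R f1 t) \<le> K1 t * norm (f0 t) + K0 t * norm (f1 t)"
        using norm_triangle_ineq4[of "K1 t *\<^sub>R f0 t" "K0 t *\<^sub>R f1 t"] pos[of t] t1 by simp
      also have "\<dots> \<le> exp (1 - c * t) * bessel_K 1 1 * (M * t ^ N) + exp (1 - c * t) * bessel_K 0 1 * (M * t ^ N)"
        using d growth[OF t1(1)] M by (intro add_mono mult_mono) (auto intro!: mult_nonneg_nonneg less_imp_le[OF bessel_K_pos])
      finally have "norm (w t) \<le> t * (exp (1 - c * t) * bessel_K 1 1 * (M * t ^ N) + exp (1 - c * t) * bessel_K 0 1 * (M * t ^ N))"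
        using t1 by (simp add: w_def mult_left_mono)
      also have "\<dots> = B * (t ^ (N + 1) * exp (- c * t))"
        by (simp add: B_def exp_diff exp_minus field_simps)
      finally show ?thesis .
    qed
    have "((\<lambda>t. (c * t) ^ (N + 1) / exp (c * t)) \<longlongrightarrow> 0) at_top"
      using c by (intro filterlim_compose[OF tendsto_power_div_exp_0] filterlim_tendsto_pos_mult_at_top[OF tendsto_const] filterlim_ident)
    hence "((\<lambda>t. B / c ^ (N + 1) * ((c * t) ^ (N + 1) / exp (c * t))) \<longlongrightarrow> 0) at_top"
      by (rule tendsto_mult_right_zero)
    moreover have "(\<lambda>t. B / c ^ (N + 1) * ((c * t) ^ (N + 1) / exp (c * t))) = (\<lambda>t. B * (t ^ (N + 1) * exp (- c * t)))"
      using c by (auto simp: power_mult_distrib exp_minus field_simps)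
    ultimately have "((\<lambda>t. B * (t ^ (N + 1) * exp (- c * t))) \<longlongrightarrow> 0) at_top" by simp
    hence "(w \<longlongrightarrow> 0) at_top"
      by (rule Lim_null_comparison[rotated]) (unfold eventually_at_top_linorder, use bound in blast)
    moreover have "(w \<longlongrightarrow> w0) at_top"
      by (rule tendsto_eventually) (use w0 in \<open>auto simp: eventually_at_top_dense\<close>)
    ultimately show ?thesis using tendsto_unique[OF trivial_limit_at_top_linorder] by blast
  qed
  hence W: "K1 t *\<^sub>R f0 t = K0 t *\<^sub>R f1 t" if "t > 0" for t
    using w0[OF that] that by (simp add: w_def)
  \<comment> \<open>A vanishing Wronskian makes (f0, f1) proportional to (K_0, K_1) at each t; it
    remains to see that the ratio is constant.\<close>
  define r where "r = (\<lambda>t. (1 / K0 t) *\<^sub>R f0 t)"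
  have "(r has_derivative (\<lambda>h. 0)) (at t within {0<..})" if "t \<in> {0<..}" for t
  proof -
    have t: "t > 0" using that by simp
    have "((\<lambda>t. 1 / K0 t) has_real_derivative c * K1 t / (K0 t * K0 t)) (at t)"
      using dK0[OF t, folded has_real_derivative_iff_has_vector_derivative] pos[OF t]
      by (auto intro!: derivative_eq_intros)
    hence "(r has_vector_derivative (1 / K0 t) *\<^sub>R (- (c *\<^sub>R f1 t)) + (c * K1 t / (K0 t * K0 t)) *\<^sub>R f0 t) (at t)"
      unfolding r_def using f0[OF t] by (intro has_vector_derivative_scaleR)
    also have "(c * K1 t / (K0 t * K0 t)) *\<^sub>R f0 t = (c / (K0 t * K0 t)) *\<^sub>R (K1 t *\<^sub>R f0 t)" by simp
    also have "(1 / K0 t) *\<^sub>R (- (c *\<^sub>R f1 t)) + \<dots> = 0" unfolding W[OF t] using pos[OF t] by simp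
    finally show ?thesis
      by (auto simp: has_vector_derivative_def intro: has_derivative_at_withinI)
  qed
  then obtain C where C: "\<And>t. t > 0 \<Longrightarrow> r t = C"
    using has_derivative_zero_constant[of "{0<..}" r] by (auto simp: convex_real_interval)
  show ?thesis
  proof (intro exI[of _ C] allI impI)
    fix t :: real assume t: "t > 0"
    have f0: "f0 t = K0 t *\<^sub>R C" using C[OF t] pos[OF t] by (auto simp: r_def)
    moreover have "K0 t *\<^sub>R f1 t = K0 t *\<^sub>R (K1 t *\<^sub>R C)" using W[OF t] by (simp add: f0 mult.commute)
    hence "f1 t = K1 t *\<^sub>R C" using pos[OF t] by (metis less_irrefl scaleR_cancel_left)
    ultimately show "f0 t = C * of_real (bessel_K 0 (c * t)) \<and> f1 t = C * of_real (bessel_K 1 (c * t))"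
      by (simp add: K0_def K1_def scaleR_conv_of_real)
  qed
qed

text \<open>Both outer coefficients are the nonzero y, so the values at l and l+1 propagate upwards
  and downwards alike.\<close>

lemma three_term_recurrence_unique:
  fixes h g :: "nat \<Rightarrow> complex"
  assumes y: "y \<noteq> 0" and "l < k"
    and h: "\<And>j. j + 1 < k \<Longrightarrow> y * h (j + 2) = c j * h (j + 1) + y * h j"
    and g: "\<And>j. j + 1 < k \<Longrightarrow> y * g (j + 2) = c j * g (j + 1) + y * g j"
    and "h l = g l" "h (l + 1) = g (l + 1)" "j \<le> k"
  shows "h j = g j"
proof -
  have up: "l + i < k \<Longrightarrow> h (l + i) = g (l + i) \<and> h (l + i + 1) = g (l + i + 1)" for i
  proof (induction i)
    case (Suc i)
    hence "y * h (l + i + 2) = y * g (l + i + 2)" using h[of "l + i"] g[of "l + i"] by simp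
    thus ?case using Suc y by simp
  qed (use assms in auto)
  have down: "i \<le> l \<Longrightarrow> h (l - i) = g (l - i) \<and> h (l - i + 1) = g (l - i + 1)" for i
  proof (induction i)
    case (Suc i)
    hence e: "l - i = Suc (l - Suc i)" "l - Suc i + 1 < k" using assms by auto
    have "h (l - Suc i) = g (l - Suc i)"
      using h[OF e(2)] g[OF e(2)] Suc e y by auto
    thus ?case using Suc e by simp
  qed (use assms in auto)
  consider "j \<le> l" | "l < j" by linarith
  thus ?thesis
  proof cases
    case 1 thus ?thesis using down[of "l - j"] by simp
  next
    case 2 thus ?thesis using up[of "j - l - 1"] assms by simp
  qed
qed

section \<open>The differential system along the torus\<close>

context whittaker
begin

text \<open>The coefficients of \<open>F\<close> with respect to \<open>[x\<^sup>j][y\<^bsup>2l-j\<^esup>]\<close>; the index \<open>v\<close> of the informal statement is \<open>j - l\<close>.\<close>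
definition \<phi> :: "nat \<Rightarrow> real \<Rightarrow> real^'m^'m \<Rightarrow> complex" where
  "\<phi> j t m = fact j * fact (k2 - j) * coeff (F (diag_mat t m)) j"

text \<open>\<open>u_eta\<close> with the complex pairing multiplied out, so that |u|^2 is visibly a
  sum of two real squares.\<close>

definition u :: "real \<Rightarrow> real^'m^'m \<Rightarrow> complex" where
  "u t m = - of_real (sqrt 2 * t) * Complex (polar q \<eta> (m *v v1)) (polar q \<eta> (m *v v2))"

lemma u_eta_eq: "u_eta q v1 v2 \<eta> t m = u t m"
proof -
  have "cmat m *v (\<i> *s cvec v1 - cvec v2) = \<i> *s cvec (m *v v1) - cvec (m *v v2)"
    by (simp add: matrix_vector_mult_diff_distrib vector_scalar_commute cmat_cvec)
  moreover have "Re_vec (\<i> *s cvec (m *v v1) - cvec (m *v v2)) = - (m *v v2)" "Im_vec (\<i> *s cvec (m *v v1) - cvec (m *v v2)) = m *v v1"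
    "Re_vec (cvec \<eta>) = \<eta>" "Im_vec (cvec \<eta>) = 0"
    by (simp_all add: Re_vec_def Im_vec_def cvec_def vec_eq_iff)
  ultimately show ?thesis
    by (simp add: u_eta_def u_def cpolar_def polar_simps complex_eq_iff)
qed

lemma u_scale: "u t m = of_real t * u 1 m"
  by (simp add: u_def)

text \<open>The Iwasawa splitting of the generators. Terms \<open>ee \<and> v\<close> are evaluated
  by the character and terms \<open>E1 \<and> U\<close>, \<open>E2 \<and> U\<close>,
  \<open>W \<and> b\<close> by equivariance; \<open>ee \<and> ff\<close> is the one true derivative
  left.\<close>

lemma wedge_relations:
  "wedgeV E1 W = - (sqrt 2 *\<^sub>R wedgeV ee E1) - wedgeV E1 U"
  "wedgeV E2 W = - (sqrt 2 *\<^sub>R wedgeV ee E2) - wedgeV E2 U"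
  "wedgeV U W = - wedgeV ee ff"
  "wedgeV U b = sqrt 2 *\<^sub>R wedgeV ee b - wedgeV W b"
proof -
  have W: "W = sqrt 2 *\<^sub>R ee - U" using sqrt2_ee by simp
  have sw: "wedgeV a b = - wedgeV b a" for a b
    by (rule matrix_eqI) (simp add: V.wedge_mult matrix_vector_algebra)
  have neg: "wedgeV a (b - b') = wedgeV a b - wedgeV a b'" for a b b'
    by (rule matrix_eqI) (simp add: V.wedge_mult matrix_vector_algebra V.polar_simps algebra_simps)
  show "wedgeV E1 W = - (sqrt 2 *\<^sub>R wedgeV ee E1) - wedgeV E1 U"
    "wedgeV E2 W = - (sqrt 2 *\<^sub>R wedgeV ee E2) - wedgeV E2 U"
    unfolding W neg V.wedge_scale_right by (subst sw, simp)+
  show "wedgeV U b = sqrt 2 *\<^sub>R wedgeV ee b - wedgeV W b"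
  proof -
    have U: "U = sqrt 2 *\<^sub>R ee - W" using sqrt2_ee by simp
    have "wedgeV (a - a') b = wedgeV a b - wedgeV a' b" for a a'
      by (rule matrix_eqI) (simp add: V.wedge_mult matrix_vector_algebra V.polar_simps algebra_simps)
    thus ?thesis by (simp only: U V.wedge_scale_left)
  qed
  show "wedgeV U W = - wedgeV ee ff"
  proof (rule matrix_eqI, rule vec_eqI)
    fix w
    show "e_coord (wedgeV U W *v w) = e_coord (- wedgeV ee ff *v w)"
      "f_coord (wedgeV U W *v w) = f_coord (- wedgeV ee ff *v w)"
      "mid (wedgeV U W *v w) = mid (- wedgeV ee ff *v w)"
      by (simp_all add: V.wedge_mult matrix_vector_algebra H_eq E_defs polar_simps field_simps)
  qed
qed

abbreviation "bess j t m \<equiv> (of_real (cmod (u t m)) / u t m) powi (int j - int l) * of_real (bessel_K (int j - int l) (cmod (u t m)))"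

text \<open>This is \<open>t d/dt\<close> of \<open>\<phi> j\<close>, written as a derivative along
  the Lie algebra.\<close>

definition Dt where "Dt j t m = fact j * fact (k2 - j) * coeff (dF (diag_mat t m) (wedgeV ee ff)) j"

lemma \<phi>_t_deriv:
  assumes "m \<in> SO q" "t \<noteq> 0"
  shows "((\<lambda>t. \<phi> j t m) has_vector_derivative (1 / t) *\<^sub>R Dt j t m) (at t)"
proof -
  have G: "diag_mat t m \<in> G" by (rule diag_SO[OF assms])
  have ev: "\<forall>\<^sub>F s in at t. diag_mat s m \<in> G"
  proof -
    have "\<forall>\<^sub>F s in at t. s \<noteq> 0" using assms(2) by (intro tendsto_imp_eventually_ne[OF tendsto_ident_at])
    thus ?thesis by eventually_elim (rule diag_SO[OF assms(1)])
  qed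
  have "((\<lambda>t. coeff (F (diag_mat t m)) j) has_vector_derivative coeff (dF (diag_mat t m) ((1/t) *\<^sub>R wedgeV ee ff)) j) (at t)"
    by (rule dF_curve[OF G diag_deriv[OF assms(2)] refl ev])
  hence "((\<lambda>t. fact j * fact (k2 - j) * coeff (F (diag_mat t m)) j) has_vector_derivative
     fact j * fact (k2 - j) * coeff (dF (diag_mat t m) ((1/t) *\<^sub>R wedgeV ee ff)) j) (at t)"
    by (rule has_vector_derivative_mult_right)
  thus ?thesis unfolding \<phi>_def Dt_def dF_linear(3)[OF G] by (simp add: scaleR_conv_of_real mult.left_commute)
qed

lemma fact_k2: "j < k2 \<Longrightarrow> fact (k2 - j) = (of_nat k2 - of_nat j) * (fact (k2 - Suc j) :: complex)"
  by (subst fact_reduce) (auto simp: of_nat_diff Suc_diff_Suc)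

text \<open>The contraction with b = \<open>W\<close>. The derivatives along
  \<open>E1 \<and> W\<close> and \<open>E2 \<and> W\<close> turn into multiplications and sl2
  operators, and \<open>U \<and> W\<close> into -\<open>Dt\<close>.\<close>

lemma t_equations:
  assumes m: "m \<in> SO q" and t: "t \<noteq> 0" and j: "j < k2"
  shows "Dt (Suc j) t m = (of_nat k2 - of_nat j) * \<phi> (Suc j) t m - cnj (u t m) * \<phi> j t m"
    "Dt j t m = of_nat (Suc j) * \<phi> j t m - u t m * \<phi> (Suc j) t m"
proof -
  let ?g = "diag_mat t m" and ?P = "F (diag_mat t m)"
  have G: "?g \<in> G" by (rule diag_SO[OF m t])
  define p1 p2 where "p1 = polar q \<eta> (m *v v1)" and "p2 = polar q \<eta> (m *v v2)"
  have d1: "dF ?g (wedgeV E1 W) = - smult (of_real (sqrt 2) * (\<i> * of_real (t * p1))) ?P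
       - smult (\<i> / 2) (pderiv ?P + [:0, 1:] * form_dy k2 ?P)"
    unfolding wedge_relations dF_linear[OF G] dF_E1_U[OF G] unfolding E1_def dF_N[OF m t] p1_def by simp
  have d2: "dF ?g (wedgeV E2 W) = - smult (of_real (sqrt 2) * (\<i> * of_real (t * p2))) ?P
       - smult (1 / 2) ([:0, 1:] * form_dy k2 ?P - pderiv ?P)"
    unfolding wedge_relations dF_linear[OF G] dF_E2_U[OF G] unfolding E2_def dF_N[OF m t] p2_def by simp
  have d3: "dF ?g (wedgeV U W) = - dF ?g (wedgeV ee ff)"
    unfolding wedge_relations(3) dF_linear[OF G] ..
  have uu: "u t m = - of_real (sqrt 2 * t) * (of_real p1 + \<i> * of_real p2)"
    "cnj (u t m) = - of_real (sqrt 2 * t) * (of_real p1 - \<i> * of_real p2)"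
    by (simp_all add: u_def p1_def p2_def complex_eq_iff)
  have ii: "\<i> * (\<i> * z) = - z" "\<i> * (z * \<i>) = - z" for z by (simp_all add: complex_eq_iff)
  have dyS: "coeff ([:0, 1:] * form_dy k2 ?P) (Suc i) = (of_nat k2 - of_nat i) * coeff ?P i" for i
    by (simp add: coeff_form_dy)
  have Y: "coeff (smult \<i> (dF ?g (wedgeV E1 W)) + dF ?g (wedgeV E2 W)) j
     = - cnj (u t m) * coeff ?P j + of_nat (Suc j) * coeff ?P (Suc j)"
  proof -
    \<comment> \<open>The two sl2 operators are combined so that the one raising the power of x,
      abbreviated here, cancels; for \<open>X\<close> below it is the lowering one.\<close>
    define a where "a = coeff ([:0, 1:] * form_dy k2 ?P) j"
    have "coeff (smult \<i> (dF ?g (wedgeV E1 W)) + dF ?g (wedgeV E2 W)) j =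
       \<i> * (- (of_real (sqrt 2) * (\<i> * of_real (t * p1)) * coeff ?P j) - \<i> / 2 * (of_nat (Suc j) * coeff ?P (Suc j) + a))
        + (- (of_real (sqrt 2) * (\<i> * of_real (t * p2)) * coeff ?P j) - 1 / 2 * (a - of_nat (Suc j) * coeff ?P (Suc j)))"
      unfolding d1 d2 by (simp only: coeff_add coeff_smult coeff_diff coeff_minus coeff_pderiv a_def[symmetric])
    also have "\<dots> = - cnj (u t m) * coeff ?P j + of_nat (Suc j) * coeff ?P (Suc j)"
      unfolding uu by (simp add: algebra_simps ii add_divide_distrib diff_divide_distrib)
    finally show ?thesis .
  qed
  have X: "coeff (smult \<i> (dF ?g (wedgeV E1 W)) - dF ?g (wedgeV E2 W)) (Suc j)
     = - u t m * coeff ?P (Suc j) + (of_nat k2 - of_nat j) * coeff ?P j"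
  proof -
    define a where "a = of_nat (Suc (Suc j)) * coeff ?P (Suc (Suc j))"
    define b where "b = (of_nat k2 - of_nat j) * coeff ?P j"
    have "coeff (smult \<i> (dF ?g (wedgeV E1 W)) - dF ?g (wedgeV E2 W)) (Suc j) =
       \<i> * (- (of_real (sqrt 2) * (\<i> * of_real (t * p1)) * coeff ?P (Suc j)) - \<i> / 2 * (a + b))
        - (- (of_real (sqrt 2) * (\<i> * of_real (t * p2)) * coeff ?P (Suc j)) - 1 / 2 * (b - a))"
      unfolding d1 d2 by (simp only: coeff_add coeff_smult coeff_diff coeff_minus coeff_pderiv dyS a_def[symmetric] b_def[symmetric])
    also have "\<dots> = - u t m * coeff ?P (Suc j) + b"
      unfolding uu by (simp add: algebra_simps ii add_divide_distrib diff_divide_distrib)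
    finally show ?thesis by (simp add: b_def)
  qed
  note eq = D_equations[OF G admissible_W, of j, unfolded X Y d3]
  \<comment> \<open>The factorials in \<open>\<phi>\<close> absorb the factors j+1 and 2l-j of
    \<open>D_equations\<close>.\<close>
  define f where "f = (fact j * fact (k2 - Suc j) :: complex)"
  have fS: "fact (Suc j) * fact (k2 - Suc j) = of_nat (Suc j) * f" "fact j * fact (k2 - j) = (of_nat k2 - of_nat j) * f"
    using j by (simp_all add: f_def fact_k2 mult.assoc)
  show "Dt (Suc j) t m = (of_nat k2 - of_nat j) * \<phi> (Suc j) t m - cnj (u t m) * \<phi> j t m"
    using eq(1) unfolding Dt_def \<phi>_def fS coeff_minus by algebra
  show "Dt j t m = of_nat (Suc j) * \<phi> j t m - u t m * \<phi> (Suc j) t m"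
    using eq(2) unfolding Dt_def \<phi>_def fS coeff_minus by algebra
qed

text \<open>The two equations give two expressions for \<open>Dt (j + 1)\<close>; equating them
  removes the derivative.\<close>

lemma \<phi>_recurrence:
  assumes m: "m \<in> SO q" and t: "t \<noteq> 0" and j: "j + 1 < k2"
  shows "u t m * \<phi> (j + 2) t m = (2 * of_nat (j + 1) - of_nat k2) * \<phi> (j + 1) t m + cnj (u t m) * \<phi> j t m"
proof -
  have "of_nat (Suc (Suc j)) = (of_nat j :: complex) + 2" "of_nat (j + 1) = (of_nat j :: complex) + 1" by simp_all
  thus ?thesis
    using t_equations(1)[OF m t, of j] t_equations(2)[OF m t, of "Suc j"] j
    by (simp add: algebra_simps)
qed

section \<open>The equations along \<open>V2 \<and> Vn\<close>\<close>

lemma boost_curve: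
  assumes m: "m \<in> SO q" and t: "t \<noteq> 0" and wb: "polar q w b = 0" "polar q w w * polar q b b = -1"
  shows "((\<lambda>s. \<phi> j t (m ** boost w b s)) has_vector_derivative
     fact j * fact (k2 - j) * coeff (dF (diag_mat t (m ** boost w b s)) (wedgeV (vec_of 0 w 0) (vec_of 0 b 0))) j) (at s)"
proof -
  let ?w = "vec_of 0 w 0" and ?b = "vec_of 0 b 0" and ?g = "diag_mat t (m ** boost w b s)"
  have H: "H ?w ?b = 0" "H ?w ?w * H ?b ?b = -1" using wb by (simp_all add: H_eq)
  have G: "diag_mat t (m ** boost w b s) \<in> G" for s
    by (rule diag_SO[OF SO_mult[OF m boost_SO[OF wb]] t])
  have "((\<lambda>s. diag_mat t m ** V.boost ?w ?b s) has_vector_derivative diag_mat t m ** (V.boost ?w ?b s ** wedgeV ?w ?b)) (at s)"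
    by (rule bounded_linear.has_vector_derivative[OF linear_conv_bounded_linear[THEN iffD1, OF linear_matrix_mult_left] V.boost_deriv[OF H]])
  hence "((\<lambda>s. diag_mat t (m ** boost w b s)) has_vector_derivative ?g ** wedgeV ?w ?b) (at s)"
    by (simp add: diag_boost[OF wb(1)] matrix_mul_assoc)
  from dF_curve[OF G this refl always_eventually[OF allI[OF G]], of j] show ?thesis
    unfolding \<phi>_def by (rule has_vector_derivative_mult_right)
qed

text \<open>For b in Vn the derivative along \<open>U \<and> b\<close> is multiplication by a
  scalar, since \<open>W \<and> b\<close> contributes nothing. Hence \<open>D_equations\<close> give
  the derivatives along \<open>E1 \<and> b\<close> and \<open>E2 \<and> b\<close> algebraically in
  the neighbouring coefficients.\<close>

lemma boost_equation:
  assumes m: "m \<in> SO q" and t: "t \<noteq> 0" and b: "b \<in> Vn" "polar q b b = -1" and w: "w = c1 *\<^sub>R v1 + c2 *\<^sub>R v2" "polar q w w = 1"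
  shows "((\<lambda>s. \<phi> l t (m ** boost w b s)) has_vector_derivative
     - of_real (t * polar q \<eta> ((m ** boost w b s) *v b) / sqrt 2)
       * ((of_real c1 + \<i> * of_real c2) * \<phi> (l + 1) t (m ** boost w b s) + (of_real c1 - \<i> * of_real c2) * \<phi> (l - 1) t (m ** boost w b s))) (at s)"
proof -
  have wV: "w \<in> Vpos" unfolding w(1) using v_facts by (intro subspace_add subspace_scale) auto
  have wb: "polar q w b = 0" "polar q w w * polar q b b = -1" using polar_Vpos_Vn[OF wV b(1)] b w by auto
  let ?w = "vec_of 0 w 0" and ?b = "vec_of 0 b 0"
  have H: "H ?w ?b = 0" "H ?w ?w * H ?b ?b = -1" using wb by (simp_all add: H_eq)
  define n where "n = m ** boost w b s"
  have n: "n \<in> SO q" unfolding n_def by (rule SO_mult[OF m boost_SO[OF wb]])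
  let ?g = "diag_mat t n" and ?P = "F (diag_mat t n)"
  have G: "?g \<in> G" by (rule diag_SO[OF n t])
  define X where "X = smult \<i> (dF ?g (wedgeV E1 ?b)) - dF ?g (wedgeV E2 ?b)"
  define Y where "Y = smult \<i> (dF ?g (wedgeV E1 ?b)) + dF ?g (wedgeV E2 ?b)"
  define pb where "pb = polar q \<eta> (n *v b)"
  note D = boost_curve[OF m t wb, of l s, folded n_def]
  have "?w = c1 *\<^sub>R E1 + c2 *\<^sub>R E2" by (simp add: w E_defs vec_of_linear)
  hence wedge: "dF ?g (wedgeV ?w ?b) = smult (of_real c1) (dF ?g (wedgeV E1 ?b)) + smult (of_real c2) (dF ?g (wedgeV E2 ?b))"
    by (simp only: V.wedge_add_left V.wedge_scale_left dF_linear[OF G])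
  have Q: "dF ?g (wedgeV U ?b) = smult (of_real (sqrt 2) * (\<i> * of_real (t * pb))) ?P"
    unfolding wedge_relations(4) dF_linear[OF G] dF_W_Vn[OF G b(1)] dF_N[OF n t] pb_def by simp
  obtain l' where l': "l = Suc l'" using l1 by (cases l) auto
  have Yl: "of_nat l * coeff Y l = - of_nat (Suc l) * (of_real (sqrt 2) * (\<i> * of_real (t * pb)) * coeff ?P (Suc l))"
    using D_equations(1)[OF G admissible_Vn[OF b(1)], of l] unfolding Y_def[symmetric] Q by simp
  have Xl: "of_nat l * coeff X l = - of_nat (Suc l) * (of_real (sqrt 2) * (\<i> * of_real (t * pb)) * coeff ?P l')"
    using D_equations(2)[OF G admissible_Vn[OF b(1)], of l'] unfolding X_def[symmetric] Q by (simp add: l' algebra_simps)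
  define r where "r = of_real (sqrt 2) * (\<i> * of_real (t * pb))"
  have fl: "fact (k2 - l) = of_nat l * (fact l' :: complex)" "fact l = of_nat l * (fact l' :: complex)" "k2 - Suc l = l'"
    "k2 - l' = Suc l" "fact (Suc l) = of_nat (Suc l) * (fact l :: complex)" "l + 1 = Suc l" "l - 1 = l'" by (simp_all add: l')
  have Y\<phi>: "fact l * fact (k2 - l) * coeff Y l = - r * \<phi> (l + 1) t n"
    using Yl unfolding \<phi>_def fl(1,3,5,6) r_def[symmetric] by algebra
  have X\<phi>: "fact l * fact (k2 - l) * coeff X l = - r * \<phi> (l - 1) t n"
  proof -
    have "fact l * fact (k2 - l) * coeff X l = fact l * fact l' * (of_nat l * coeff X l)" unfolding fl(1) by simp
    also have "\<dots> = - r * \<phi> (l - 1) t n" unfolding Xl \<phi>_def fl(4,5,7) r_def[symmetric] by algebra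
    finally show ?thesis .
  qed
  have ii: "\<i> * \<i> = -1" by simp
  \<comment> \<open>Inverts the definitions: \<open>E1\<close> contributes (X + Y)/(2i) and
    \<open>E2\<close> contributes (Y - X)/2.\<close>
  have "2 * coeff (dF ?g (wedgeV ?w ?b)) l = (of_real c2 - \<i> * of_real c1) * coeff Y l - (of_real c2 + \<i> * of_real c1) * coeff X l"
    unfolding wedge X_def Y_def coeff_add coeff_diff coeff_smult using ii by algebra
  hence "2 * (fact l * fact (k2 - l) * coeff (dF ?g (wedgeV ?w ?b)) l)
     = (of_real c2 - \<i> * of_real c1) * (fact l * fact (k2 - l) * coeff Y l) - (of_real c2 + \<i> * of_real c1) * (fact l * fact (k2 - l) * coeff X l)"
    by algebra
  also have "\<dots> = 2 * (- of_real (t * pb / sqrt 2) * ((of_real c1 + \<i> * of_real c2) * \<phi> (l + 1) t n + (of_real c1 - \<i> * of_real c2) * \<phi> (l - 1) t n))"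
  proof -
    define h where "h = complex_of_real (t * pb / sqrt 2)"
    have "sqrt 2 * (t * pb) = 2 * (t * pb / sqrt 2)" by (simp add: field_simps)
    hence "r = 2 * (\<i> * h)" unfolding r_def h_def
      by (metis (no_types, lifting) mult.left_commute of_real_mult of_real_numeral)
    thus ?thesis unfolding X\<phi> Y\<phi> h_def[symmetric] using ii by algebra
  qed
  finally have "fact l * fact (k2 - l) * coeff (dF ?g (wedgeV ?w ?b)) l
     = - of_real (t * pb / sqrt 2) * ((of_real c1 + \<i> * of_real c2) * \<phi> (l + 1) t n + (of_real c1 - \<i> * of_real c2) * \<phi> (l - 1) t n)"
    unfolding mult_cancel_left by (metis zero_neq_numeral)
  with D show ?thesis unfolding pb_def n_def by simp
qed

end

section \<open>Growth and solution along a ray\<close>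

lemma norm_diag_mat_bound: "\<exists>R. \<forall>t\<ge>1. norm (diag_mat t m) \<le> R * t"
proof -
  define R where "R = (\<Sum>i\<in>UNIV. \<Sum>j\<in>UNIV. 1 + norm (diag_mat 1 m $ i $ j))"
  have "norm (diag_mat t m) \<le> R * t" if t: "t \<ge> 1" for t
  proof -
    have e: "norm (diag_mat t m $ i $ j) \<le> (1 + norm (diag_mat 1 m $ i $ j)) * t" for i j
    proof (cases i; cases j)
      fix i' j' assume "i = Inl i'" "j = Inl j'"
      have "norm (m $ i' $ j') * 1 \<le> norm (m $ i' $ j') * t" using t by (intro mult_left_mono) auto
      thus ?thesis using t \<open>i = _\<close> \<open>j = _\<close> by (simp add: diag_mat_entries algebra_simps)
    next
      fix c c' assume "i = Inr c" "j = Inr c'"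
      moreover have "inverse t \<le> t" using t by (simp add: field_simps) (metis mult_mono' one_le_numeral mult_1 order_trans zero_le_one)
      ultimately show ?thesis using t by (auto simp: diag_mat_entries)
    qed (use t in \<open>auto simp: diag_mat_entries\<close>)
    have "norm (diag_mat t m) \<le> (\<Sum>i\<in>UNIV. norm (diag_mat t m $ i))"
      unfolding norm_vec_def[of "diag_mat t m"] by (rule L2_set_le_sum) simp
    also have "\<dots> \<le> (\<Sum>i\<in>UNIV. \<Sum>j\<in>UNIV. norm (diag_mat t m $ i $ j))"
      unfolding norm_vec_def[of "diag_mat t m $ _"] by (intro sum_mono L2_set_le_sum) simp
    also have "\<dots> \<le> (\<Sum>i\<in>UNIV. \<Sum>j\<in>UNIV. (1 + norm (diag_mat 1 m $ i $ j)) * t)"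
      by (intro sum_mono e)
    finally show ?thesis by (simp add: R_def sum_distrib_right)
  qed
  thus ?thesis by blast
qed

context whittaker
begin

lemma \<phi>_growth: 
  assumes "m \<in> SO q"
  shows "\<exists>M N. \<forall>t\<ge>1. \<forall>j\<le>k2. norm (\<phi> j t m) \<le> M * t ^ N"
proof -
  obtain C N where CN: "\<And>g j. g \<in> G \<Longrightarrow> cmod (coeff (F g) j) \<le> C * norm g ^ N"
    using F_growth unfolding moderate_growth_on_def by blast
  obtain R where R: "\<And>t. t \<ge> 1 \<Longrightarrow> norm (diag_mat t m) \<le> R * t" using norm_diag_mat_bound by blast
  have "norm (\<phi> j t m) \<le> (fact k2 * fact k2 * (\<bar>C\<bar> * R ^ N)) * t ^ N" if "t \<ge> 1" "j \<le> k2" for t j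
  proof -
    have "diag_mat t m \<in> G" using assms that by (intro diag_SO) auto
    hence "cmod (coeff (F (diag_mat t m)) j) \<le> C * norm (diag_mat t m) ^ N" by (rule CN)
    also have "\<dots> \<le> \<bar>C\<bar> * (R * t) ^ N" using R[OF that(1)] by (intro mult_mono power_mono) auto
    finally have "cmod (coeff (F (diag_mat t m)) j) \<le> \<bar>C\<bar> * (R * t) ^ N" .
    moreover have "fact j \<le> (fact k2 :: real)" "fact (k2 - j) \<le> (fact k2 :: real)" using that by (auto intro: fact_mono)
    ultimately have "fact j * fact (k2 - j) * cmod (coeff (F (diag_mat t m)) j) \<le> fact k2 * fact k2 * (\<bar>C\<bar> * (R * t) ^ N)"
      by (intro mult_mono) auto
    thus ?thesis by (simp add: \<phi>_def norm_mult power_mult_distrib mult_ac)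
  qed
  thus ?thesis by blast
qed

text \<open>Dividing by t^(l+1) removes the term (l+1) \<phi> from the equation for index l, and
  inserting the phase \<omega> of u makes the coefficients real. The result is the Bessel system
  with c = |u(1, m)|.\<close>

lemma ray_solution:
  assumes m: "m \<in> SO q" and u1: "u 1 m \<noteq> 0"
  shows "\<exists>C. \<forall>t>0. \<forall>j\<le>k2. \<phi> j t m = C * of_real (t ^ (l + 1)) *
     bess j t m"
proof -
  define c where "c = cmod (u 1 m)"
  define \<omega> where "\<omega> = u 1 m / of_real c"
  have c: "c > 0" using u1 by (simp add: c_def)
  have u1': "u 1 m = of_real c * \<omega>" using c by (simp add: \<omega>_def)
  have "cmod \<omega> = 1" using c by (simp add: \<omega>_def norm_divide) (simp add: c_def)
  hence \<omega>: "\<omega> * cnj \<omega> = 1" "\<omega> \<noteq> 0" by (auto simp: complex_norm_square[symmetric])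
  have ut: "u t m = of_real (t * c) * \<omega>" for t by (subst u_scale) (simp add: u1')
  have cmod_u: "cmod (u t m) = c * t" if "t > 0" for t
    using that c \<open>cmod \<omega> = 1\<close> by (simp add: ut norm_mult)
  define f0 where "f0 = (\<lambda>t. (1 / t ^ (l + 1)) *\<^sub>R \<phi> l t m)"
  define f1 where "f1 = (\<lambda>t. (1 / t ^ (l + 1)) *\<^sub>R (\<omega> * \<phi> (l + 1) t m))"
  have dp: "((\<lambda>t. 1 / t ^ (l + 1)) has_real_derivative - real (l + 1) / t ^ (l + 2)) (at t)" if "t > 0" for t :: real
  proof -
    have p: "((\<lambda>t. t ^ (l + 1)) has_real_derivative real (l + 1) * t ^ l) (at t)" using DERIV_pow[of "l + 1" t] by simp
    have "((\<lambda>t. 1 / t ^ (l + 1)) has_real_derivative (0 * t ^ (l + 1) - 1 * (real (l + 1) * t ^ l)) / (t ^ (l + 1) * t ^ (l + 1))) (at t)"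
      using that by (intro DERIV_divide DERIV_const p) auto
    moreover have "(0 * t ^ (l + 1) - 1 * (real (l + 1) * t ^ l)) / (t ^ (l + 1) * t ^ (l + 1)) = - real (l + 1) / t ^ (l + 2)"
      using that by (simp add: field_simps)
    ultimately show ?thesis by (simp only:)
  qed
  have lk: "l < k2" "k2 - l = l" using l1 by simp_all
  have d0: "(f0 has_vector_derivative - (c *\<^sub>R f1 t)) (at t)" if t: "t > 0" for t
  proof -
    have "(f0 has_vector_derivative (1 / t ^ (l + 1)) *\<^sub>R ((1 / t) *\<^sub>R Dt l t m) + (- real (l + 1) / t ^ (l + 2)) *\<^sub>R \<phi> l t m) (at t)"
      unfolding f0_def using t by (intro has_vector_derivative_scaleR dp \<phi>_t_deriv[OF m]) auto
    also have "(1 / t ^ (l + 1)) *\<^sub>R ((1 / t) *\<^sub>R Dt l t m) + (- real (l + 1) / t ^ (l + 2)) *\<^sub>R \<phi> l t m = - (c *\<^sub>R f1 t)"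
    proof -
      have D: "Dt l t m = of_nat (Suc l) * \<phi> l t m - of_real (t * c) * \<omega> * \<phi> (l + 1) t m"
        using t t_equations(2)[OF m _ lk(1), of t] by (simp add: ut)
      show ?thesis unfolding D using t by (simp add: f1_def scaleR_conv_of_real field_simps)
    qed
    finally show ?thesis .
  qed
  have d1: "(f1 has_vector_derivative - (c *\<^sub>R f0 t) - (1 / t) *\<^sub>R f1 t) (at t)" if t: "t > 0" for t
  proof -
    have "(f1 has_vector_derivative (1 / t ^ (l + 1)) *\<^sub>R (\<omega> * ((1 / t) *\<^sub>R Dt (l + 1) t m)) + (- real (l + 1) / t ^ (l + 2)) *\<^sub>R (\<omega> * \<phi> (l + 1) t m)) (at t)"
      unfolding f1_def using t by (intro has_vector_derivative_scaleR has_vector_derivative_mult_right dp \<phi>_t_deriv[OF m]) auto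
    moreover have "(1 / t ^ (l + 1)) *\<^sub>R (\<omega> * ((1 / t) *\<^sub>R Dt (l + 1) t m)) + (- real (l + 1) / t ^ (l + 2)) *\<^sub>R (\<omega> * \<phi> (l + 1) t m)
      = - (c *\<^sub>R f0 t) - (1 / t) *\<^sub>R f1 t"
    proof -
      define a where "a = \<phi> l t m"
      define b where "b = \<phi> (l + 1) t m"
      define T where "T = complex_of_real t"
      have T: "T \<noteq> 0" using t by (simp add: T_def)
      have "Dt (l + 1) t m = of_nat l * b - T * of_real c * cnj \<omega> * a"
        using t t_equations(1)[OF m _ lk(1), of t] by (simp add: ut a_def b_def T_def)
      hence "\<omega> * Dt (l + 1) t m = of_nat l * (\<omega> * b) - T * of_real c * a"
        using \<omega>(1) by algebra
      hence e: "\<omega> * ((1 / T) * Dt (l + 1) t m) = of_nat l * (\<omega> * b) / T - of_real c * a"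
        using T by (simp add: field_simps)
      have "(1 / t ^ (l + 1)) *\<^sub>R (\<omega> * ((1 / t) *\<^sub>R Dt (l + 1) t m)) + (- real (l + 1) / t ^ (l + 2)) *\<^sub>R (\<omega> * \<phi> (l + 1) t m)
        = (1 / T ^ (l + 1)) * (\<omega> * ((1 / T) * Dt (l + 1) t m)) + (- 1 - of_nat l) / T ^ (l + 2) * (\<omega> * b)"
        by (simp add: scaleR_conv_of_real T_def b_def)
      also have "\<dots> = - of_real c * ((1 / T ^ (l + 1)) * a) - (1 / T) * ((1 / T ^ (l + 1)) * (\<omega> * b))"
        unfolding e using T by (simp add: field_simps)
      also have "\<dots> = - (c *\<^sub>R f0 t) - (1 / t) *\<^sub>R f1 t"
        by (simp add: scaleR_conv_of_real T_def a_def b_def f0_def f1_def)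
      finally show ?thesis .
    qed
    ultimately show ?thesis by simp
  qed
  obtain M N where MN: "\<And>t j. t \<ge> 1 \<Longrightarrow> j \<le> k2 \<Longrightarrow> norm (\<phi> j t m) \<le> M * t ^ N" using \<phi>_growth[OF m] by blast
  have gr: "norm (f0 t) \<le> M * t ^ N" "norm (f1 t) \<le> M * t ^ N" if t: "t \<ge> 1" for t
  proof -
    have le: "(1 / t ^ (l + 1)) * x \<le> x" if "x \<ge> 0" for x
    proof -
      have "1 / t ^ (l + 1) \<le> 1" using t one_le_power[OF t, of "l + 1"] by (simp add: field_simps)
      from mult_right_mono[OF this that] show ?thesis by simp
    qed
    have "norm (f0 t) = (1 / t ^ (l + 1)) * norm (\<phi> l t m)" "norm (f1 t) = (1 / t ^ (l + 1)) * norm (\<phi> (l + 1) t m)"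
      using t \<open>cmod \<omega> = 1\<close> by (simp_all add: f0_def f1_def norm_mult)
    thus "norm (f0 t) \<le> M * t ^ N" "norm (f1 t) \<le> M * t ^ N"
      using le[of "norm (\<phi> l t m)"] le[of "norm (\<phi> (l + 1) t m)"] MN[OF t, of l] MN[OF t, of "l + 1"] lk by simp_all
  qed
  from bessel_system_moderate[OF c d0 d1 gr] obtain C where
    C: "\<And>t. t > 0 \<Longrightarrow> f0 t = C * of_real (bessel_K 0 (c * t))" "\<And>t. t > 0 \<Longrightarrow> f1 t = C * of_real (bessel_K 1 (c * t))"
    by blast
  show ?thesis
  proof (intro exI[of _ C] allI impI)
    fix t :: real and j :: nat assume t: "t > 0" and j: "j \<le> k2"
    \<comment> \<open>The powers of \<omega> make both outer coefficients of
      \<open>\<phi>_recurrence\<close> equal to ct, which gives the recurrence of the Bessel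
      functions at ct.\<close>
    define h where "h = (\<lambda>j. \<omega> powi (int j - int l) * (\<phi> j t m / of_real (t ^ (l + 1))))"
    define g where "g = (\<lambda>j. C * of_real (bessel_K (int j - int l) (c * t)))"
    have ct: "c * t > 0" using c t by simp
    have "h j = g j"
    proof (rule three_term_recurrence_unique[of "of_real (c * t)" l k2 h "\<lambda>j. of_int (2 * (int j + 1 - int l))" g])
      show "of_real (c * t) \<noteq> (0 :: complex)" using c t by simp
      show "h l = g l" using C(1)[OF t] t by (simp add: h_def g_def f0_def scaleR_conv_of_real)
      show "h (l + 1) = g (l + 1)" using C(2)[OF t] t by (simp add: h_def g_def f1_def scaleR_conv_of_real)
      fix j assume jk: "j + 1 < k2"
      have i: "int (j + 2) - int l = (int j + 1 - int l) + 1" "int (j + 1) - int l = int j + 1 - int l" "int j - int l = (int j + 1 - int l) - 1" by simp_all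
      show "of_real (c * t) * g (j + 2) = of_int (2 * (int j + 1 - int l)) * g (j + 1) + of_real (c * t) * g j"
      proof -
        have "c * t * bessel_K ((int j + 1 - int l) + 1) (c * t) = of_int (2 * (int j + 1 - int l)) * bessel_K (int j + 1 - int l) (c * t) + c * t * bessel_K ((int j + 1 - int l) - 1) (c * t)"
          using bessel_K_recurrence[OF ct, of "int j + 1 - int l"] by (simp add: algebra_simps)
        hence "complex_of_real (c * t * bessel_K ((int j + 1 - int l) + 1) (c * t)) = complex_of_real (of_int (2 * (int j + 1 - int l)) * bessel_K (int j + 1 - int l) (c * t) + c * t * bessel_K ((int j + 1 - int l) - 1) (c * t))"
          by (simp only:)
        thus ?thesis unfolding g_def i of_real_add of_real_mult[of "of_int _"] of_real_mult[of "c * t"] of_real_of_int_eq by algebra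
      qed
      define p where "p = \<omega> powi (int j + 1 - int l)"
      have gen: "\<omega> powi (v + 1) = \<omega> powi v * \<omega>" "\<omega> * \<omega> powi (v - 1) = \<omega> powi v" for v
        using \<omega>(2) power_int_add_1[of \<omega> v] power_int_add_1[of \<omega> "v - 1"] by (simp_all add: mult.commute)
      have pw: "\<omega> powi ((int j + 1 - int l) + 1) = p * \<omega>" "\<omega> * \<omega> powi ((int j + 1 - int l) - 1) = p"
        unfolding p_def by (rule gen)+
      define T where "T = complex_of_real (t ^ (l + 1))"
      have T: "T \<noteq> 0" using t by (simp add: T_def)
      have a: "of_int (2 * (int j + 1 - int l)) = (2 * of_nat (j + 1) - of_nat k2 :: complex)" by simp
      have um: "cnj (u t m) * p = of_real (c * t) * \<omega> powi ((int j + 1 - int l) - 1)"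
        unfolding pw(2)[symmetric] ut using \<omega>(1) by (simp add: algebra_simps)
      have up: "of_real (c * t) * (p * \<omega>) = p * u t m" by (simp add: ut mult_ac)
      have r: "u t m * \<phi> (j + 2) t m = (2 * of_nat (j + 1) - of_nat k2) * \<phi> (j + 1) t m + cnj (u t m) * \<phi> j t m"
        using \<phi>_recurrence[OF m, of t j] jk t by simp
      have "of_real (c * t) * (p * \<omega>) * \<phi> (j + 2) t m = p * (u t m * \<phi> (j + 2) t m)" unfolding up by simp
      also have "\<dots> = of_int (2 * (int j + 1 - int l)) * (p * \<phi> (j + 1) t m) + of_real (c * t) * \<omega> powi ((int j + 1 - int l) - 1) * \<phi> j t m"
        unfolding r a um[symmetric] by (simp add: algebra_simps)
      finally have "of_real (c * t) * (p * \<omega> * (\<phi> (j + 2) t m / T)) = of_int (2 * (int j + 1 - int l)) * (p * (\<phi> (j + 1) t m / T))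
           + of_real (c * t) * (\<omega> powi ((int j + 1 - int l) - 1) * (\<phi> j t m / T))"
        using T by (simp add: field_simps)
      thus "of_real (c * t) * h (j + 2) = of_int (2 * (int j + 1 - int l)) * h (j + 1) + of_real (c * t) * h j"
        unfolding h_def i pw(1) p_def[symmetric] T_def[symmetric] .
    qed (use l1 j in auto)
    hence "\<phi> j t m = C * of_real (bessel_K (int j - int l) (c * t)) * of_real (t ^ (l + 1)) / \<omega> powi (int j - int l)"
      using \<omega>(2) t by (simp add: h_def g_def field_simps)
    moreover have "of_real (cmod (u t m)) / u t m = inverse \<omega>"
      unfolding cmod_u[OF t] unfolding ut using c t by (simp add: field_simps)
    ultimately show "\<phi> j t m = C * of_real (t ^ (l + 1)) *
       bess j t m"
      using cmod_u[OF t] by (simp add: power_int_inverse field_simps)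
  qed
qed

section \<open>Variation of the constant along boosts\<close>

lemma polar_boost_deriv:
  assumes wb: "polar q w b = 0" "polar q w w * polar q b b = -1"
  shows "((\<lambda>s. polar q \<eta> ((m ** boost w b s) *v v)) has_real_derivative polar q \<eta> ((m ** boost w b s) *v (wedge q w b *v v))) (at s)"
proof -
  have "linear (\<lambda>A :: real^'m^'m. polar q \<eta> ((m ** A) *v v))"
    by (rule linearI) (simp_all add: matrix_mult_algebra matrix_vector_algebra polar_simps)
  from bounded_linear.has_vector_derivative[OF linear_conv_bounded_linear[THEN iffD1, OF this] boost_deriv[OF wb, of s]]
  show ?thesis by (simp add: has_real_derivative_iff_has_vector_derivative matrix_vector_mul_assoc matrix_mul_assoc)
qed

text \<open>Index l carries no power of the phase of u and t = 1 no power of t, so C(m) is a plain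
  quotient. It has this meaning only where u does not vanish.\<close>

definition cst :: "real^'m^'m \<Rightarrow> complex" where
  "cst m = \<phi> l 1 m / of_real (bessel_K 0 (cmod (u 1 m)))"

lemma ray_solution_cst:
  assumes m: "m \<in> SO q" and u1: "u 1 m \<noteq> 0" and "t > 0" "j \<le> k2"
  shows "\<phi> j t m = cst m * of_real (t ^ (l + 1)) *
     bess j t m"
proof -
  obtain C where C: "\<And>t j. t > 0 \<Longrightarrow> j \<le> k2 \<Longrightarrow> \<phi> j t m = C * of_real (t ^ (l + 1)) *
     bess j t m"
    using ray_solution[OF m u1] by blast
  have "bessel_K 0 (cmod (u 1 m)) > 0" using u1 by (intro bessel_K_pos) simp
  hence "cst m = C" using C[of 1 l] by (simp add: cst_def)
  thus ?thesis using C[OF assms(3,4)] by simp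
qed

text \<open>The middle coefficient and \<open>K_0(|u|)\<close> have the same logarithmic derivative:
  \<open>boost_equation\<close> involves only its two neighbours, which on the ray are C times a
  phase times \<open>K_1(|u|)\<close>, and \<open>K_0' = - K_1\<close>.\<close>

lemma cst_boost_deriv:
  assumes m: "m \<in> SO q" and b: "b \<in> Vn" "polar q b b = -1" and w: "w \<in> Vpos" "polar q w w = 1"
    and u0: "u 1 (m ** boost w b s) \<noteq> 0"
  shows "((\<lambda>s. cst (m ** boost w b s)) has_vector_derivative 0) (at s)"
proof -
  obtain c1 c2 where w_eq: "w = c1 *\<^sub>R v1 + c2 *\<^sub>R v2"
    using w(1) unfolding Vpos_iff pos_part_def by metis
  have wb: "polar q w b = 0" "polar q w w * polar q b b = -1" using polar_Vpos_Vn[OF w(1) b(1)] b w by auto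
  define n where "n = (\<lambda>s. m ** boost w b s)"
  define p1 where "p1 = (\<lambda>s. polar q \<eta> (n s *v v1))"
  define p2 where "p2 = (\<lambda>s. polar q \<eta> (n s *v v2))"
  define pb where "pb = polar q \<eta> (n s *v b)"
  define N where "N = (\<lambda>s. cmod (u 1 (n s)))"
  have ns: "m ** boost w b s = n s" for s by (simp add: n_def)
  have nS: "n s \<in> SO q" for s unfolding n_def by (rule SO_mult[OF m boost_SO[OF wb]])
  have Xv: "wedge q w b *v v1 = - c1 *\<^sub>R b" "wedge q w b *v v2 = - c2 *\<^sub>R b"
    using polar_Vpos_Vn[OF v_facts(5) b(1)] polar_Vpos_Vn[OF v_facts(6) b(1)]
    by (simp_all add: wedge_mult w_eq polar_simps v_facts(2-4) v21)
  have dp1: "(p1 has_real_derivative - c1 * pb) (at s)"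
    using polar_boost_deriv[OF wb, of m v1 s] unfolding Xv by (simp add: p1_def n_def pb_def matrix_vector_algebra polar_simps)
  have dp2: "(p2 has_real_derivative - c2 * pb) (at s)"
    using polar_boost_deriv[OF wb, of m v2 s] unfolding Xv by (simp add: p2_def n_def pb_def matrix_vector_algebra polar_simps)
  have N_eq: "N = (\<lambda>s. sqrt 2 * sqrt ((p1 s)\<^sup>2 + (p2 s)\<^sup>2))"
    by (simp add: N_def u_def norm_mult p1_def p2_def complex_norm)
  have Npos: "N s > 0" using u0 by (simp add: N_def n_def)
  hence "sqrt ((p1 s)\<^sup>2 + (p2 s)\<^sup>2) > 0" by (simp add: N_eq zero_less_mult_iff)
  hence ppos: "(p1 s)\<^sup>2 + (p2 s)\<^sup>2 > 0" by (simp only: real_sqrt_gt_0_iff)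
  \<comment> \<open>The pairing of \<open>\<eta>\<close> with the moved vector
    \<open>n s *v w\<close>; it governs the change of |u|.\<close>
  define pw where "pw = c1 * p1 s + c2 * p2 s"
  have dN: "(N has_real_derivative - 2 * pb * pw / N s) (at s)"
  proof -
    have "(N has_real_derivative sqrt 2 * ((2 * p1 s * (- c1 * pb) + 2 * p2 s * (- c2 * pb)) * (inverse (sqrt ((p1 s)\<^sup>2 + (p2 s)\<^sup>2)) / 2))) (at s)"
      unfolding N_eq using ppos dp1 dp2 by (auto intro!: derivative_eq_intros simp: algebra_simps)
    moreover have "sqrt 2 * ((2 * p1 s * (- c1 * pb) + 2 * p2 s * (- c2 * pb)) * (inverse (sqrt ((p1 s)\<^sup>2 + (p2 s)\<^sup>2)) / 2)) = - 2 * pb * pw / N s"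
    proof -
      define R where "R = sqrt ((p1 s)\<^sup>2 + (p2 s)\<^sup>2)"
      have R: "R > 0" using ppos by (simp add: R_def)
      have "sqrt 2 * sqrt 2 = (2::real)" by simp
      thus ?thesis using R unfolding N_eq R_def[symmetric] pw_def by (simp add: field_simps)
    qed
    ultimately show ?thesis by (simp only:)
  qed
  define K0 where "K0 = (\<lambda>s. bessel_K 0 (N s))"
  define k1 where "k1 = bessel_K 1 (N s)"
  have K0pos: "K0 s > 0" using Npos by (simp add: K0_def bessel_K_pos)
  have dK0: "(K0 has_real_derivative 2 * pb * pw * k1 / N s) (at s)"
    using DERIV_chain2[of "bessel_K 0" _ N, OF bessel_K0_deriv[OF Npos] dN] by (simp add: K0_def k1_def field_simps)
  define C where "C = cst (n s)"
  have \<phi>l: "\<phi> l 1 (n s) = C * of_real (K0 s)"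
    using K0pos by (simp add: C_def cst_def K0_def N_def)
  have u0': "u 1 (n s) \<noteq> 0" using u0 by (simp add: n_def)
  have \<phi>p: "\<phi> (l + 1) 1 (n s) = C * (cnj (u 1 (n s)) / of_real (N s)) * of_real k1"
    and \<phi>m: "\<phi> (l - 1) 1 (n s) = C * (u 1 (n s) / of_real (N s)) * of_real k1"
  proof -
    have inv: "of_real (cmod (u 1 (n s))) / u 1 (n s) = cnj (u 1 (n s)) / of_real (N s)"
      using u0' Npos by (simp add: N_def field_simps complex_norm_square[symmetric] power2_eq_square)
    have inv2: "u 1 (n s) / of_real (N s) = inverse (of_real (cmod (u 1 (n s))) / u 1 (n s))"
      by (simp add: N_def)
    show "\<phi> (l + 1) 1 (n s) = C * (cnj (u 1 (n s)) / of_real (N s)) * of_real k1"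
      using ray_solution_cst[OF nS u0', of 1 "l + 1"] l1 unfolding inv by (simp add: C_def k1_def N_def)
    show "\<phi> (l - 1) 1 (n s) = C * (u 1 (n s) / of_real (N s)) * of_real k1"
      using ray_solution_cst[OF nS u0', of 1 "l - 1"] l1 bessel_K1_neg[OF Npos] unfolding inv2
      by (simp add: C_def k1_def N_def of_nat_diff power_int_minus)
  qed
  have d\<phi>: "((\<lambda>s. \<phi> l 1 (n s)) has_vector_derivative C * of_real (2 * pb * pw * k1 / N s)) (at s)"
  proof -
    have uu: "u 1 (n s) = - of_real (sqrt 2) * (of_real (p1 s) + \<i> * of_real (p2 s))"
      "cnj (u 1 (n s)) = - of_real (sqrt 2) * (of_real (p1 s) - \<i> * of_real (p2 s))"
      by (simp_all add: u_def p1_def p2_def complex_eq_iff)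
    have ii: "\<i> * \<i> = -1" by simp
    \<comment> \<open>The two neighbours carry conjugate phases, so only a real part survives, and
      it is a multiple of \<open>pw\<close>.\<close>
    have re: "(of_real c1 + \<i> * of_real c2) * cnj (u 1 (n s)) + (of_real c1 - \<i> * of_real c2) * u 1 (n s) = - 2 * of_real (sqrt 2) * of_real pw"
      unfolding uu(2) unfolding uu(1) pw_def of_real_add of_real_mult using ii by algebra
    have "- complex_of_real (1 * pb / sqrt 2) * ((of_real c1 + \<i> * of_real c2) * \<phi> (l + 1) 1 (n s) + (of_real c1 - \<i> * of_real c2) * \<phi> (l - 1) 1 (n s))
      = - complex_of_real (pb / sqrt 2) * C * of_real k1 / of_real (N s) *
          ((of_real c1 + \<i> * of_real c2) * cnj (u 1 (n s)) + (of_real c1 - \<i> * of_real c2) * u 1 (n s))"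
      unfolding \<phi>p \<phi>m using Npos by (simp add: field_simps)
    also have "\<dots> = C * of_real (2 * pb * pw * k1 / N s)"
    proof -
      have "pb / sqrt 2 * sqrt 2 = pb" by simp
      hence "complex_of_real (pb / sqrt 2) * of_real (sqrt 2) = of_real pb" by (metis of_real_mult)
      thus ?thesis unfolding re using Npos by (simp add: field_simps)
    qed
    finally show ?thesis
      using boost_equation[OF m _ b w_eq w(2), of 1 s] unfolding ns pb_def[symmetric] by simp
  qed
  have "((\<lambda>s. (1 / K0 s) *\<^sub>R \<phi> l 1 (n s)) has_vector_derivative
     (1 / K0 s) *\<^sub>R (C * of_real (2 * pb * pw * k1 / N s)) + (- (2 * pb * pw * k1 / N s) / (K0 s * K0 s)) *\<^sub>R \<phi> l 1 (n s)) (at s)"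
  proof (rule has_vector_derivative_scaleR[OF _ d\<phi>])
    show "((\<lambda>s. 1 / K0 s) has_real_derivative (- (2 * pb * pw * k1 / N s) / (K0 s * K0 s))) (at s)"
      using K0pos dK0 by (auto intro!: derivative_eq_intros)
  qed
  also have "(1 / K0 s) *\<^sub>R (C * of_real (2 * pb * pw * k1 / N s)) + (- (2 * pb * pw * k1 / N s) / (K0 s * K0 s)) *\<^sub>R \<phi> l 1 (n s) = 0"
    unfolding \<phi>l using K0pos by (simp add: scaleR_conv_of_real field_simps)
  also have "(\<lambda>s. (1 / K0 s) *\<^sub>R \<phi> l 1 (n s)) = (\<lambda>s. cst (m ** boost w b s))"
    by (simp add: cst_def K0_def N_def n_def scaleR_conv_of_real fun_eq_iff divide_inverse mult.commute)
  finally show ?thesis .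
qed

end

section \<open>Decompositions of the orthogonal groups\<close>

text \<open>The solution is s = artanh(B/A), written as half the logarithm of (A+B)/(A-B).\<close>

lemma ex_tanh_eq:
  fixes A B :: real assumes "\<bar>B\<bar> < \<bar>A\<bar>"
  obtains s where "A * sinh s = B * cosh s"
proof -
  define r where "r = (A + B) / (A - B)"
  have n: "A - B \<noteq> 0" using assms by auto
  have "(A + B) * (A - B) > 0"
    using power_strict_mono[OF assms, of 2] by (simp add: power2_eq_square algebra_simps)
  hence r: "r > 0" using n by (simp add: r_def zero_less_divide_iff zero_less_mult_iff)
  define s where "s = ln r / 2"
  have e: "exp s * exp s = r" using r by (simp add: s_def flip: exp_add)
  have "(A - B) * (exp s * exp s) = A + B" unfolding e using n by (simp add: r_def)
  moreover have "exp s * exp (- s) = 1" by (simp flip: exp_add)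
  ultimately have "(A - B) * exp s = (A + B) * exp (- s)" by algebra
  hence "A * sinh s = B * cosh s" by (simp add: sinh_def cosh_def field_simps)
  thus ?thesis by (rule that)
qed

text \<open>A and B are the pairings of a vector with an orthogonal basis of a plane whose members
  have norm \<alpha>. The rotation kills the first pairing and gives the second the sign \<sigma>,
  as computed in \<open>turn_coords\<close>.\<close>

lemma ex_turn_angle:
  fixes A B \<alpha> \<sigma> :: real assumes \<alpha>: "\<alpha> = 1 \<or> \<alpha> = -1" and \<sigma>: "\<sigma> = 1 \<or> \<sigma> = -1"
  obtains s where "cos s * A + \<alpha> * sin s * B = 0" "\<sigma> * (cos s * B - \<alpha> * sin s * A) \<ge> 0"
proof (cases "A = 0 \<and> B = 0")
  case True thus ?thesis by (intro that[of 0]) auto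
next
  case False
  define r where "r = sqrt (A\<^sup>2 + B\<^sup>2)"
  have p: "A\<^sup>2 + B\<^sup>2 > 0" using False by (simp add: sum_power2_gt_zero_iff)
  hence r: "r > 0" "r\<^sup>2 = A\<^sup>2 + B\<^sup>2" by (simp_all add: r_def)
  have a2: "\<alpha>\<^sup>2 = 1" "\<sigma>\<^sup>2 = 1" using \<alpha> \<sigma> by auto
  have "(\<sigma> * B / r)\<^sup>2 + (- \<sigma> * \<alpha> * A / r)\<^sup>2 = (A\<^sup>2 + B\<^sup>2) / r\<^sup>2"
    by (simp add: power_divide power_mult_distrib a2 add_divide_distrib)
  also have "\<dots> = 1" unfolding r(2) by (rule divide_self) (use p in linarith)
  finally obtain s where s: "\<sigma> * B / r = cos s" "- \<sigma> * \<alpha> * A / r = sin s" using sincos_total_2pi by metis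
  show ?thesis
  proof (rule that[of s])
    show "cos s * A + \<alpha> * sin s * B = 0"
      unfolding s[symmetric] using a2(1) by (simp add: power2_eq_square)
    have "\<sigma> * (cos s * B - \<alpha> * sin s * A) = \<sigma>\<^sup>2 * (B\<^sup>2 + \<alpha>\<^sup>2 * A\<^sup>2) / r"
      unfolding s[symmetric] using r(1) by (simp add: power2_eq_square field_simps)
    also have "\<dots> \<ge> 0" using r(1) unfolding a2 by simp
    finally show "\<sigma> * (cos s * B - \<alpha> * sin s * A) \<ge> 0" .
  qed
qed

context signature_space
begin

lemma boost_coords:
  assumes "polar q w w = 1" "polar q b b = -1" "polar q w b = 0"
  shows "boost w b s *v (A *\<^sub>R w + B *\<^sub>R b) = (A * cosh s - B * sinh s) *\<^sub>R w + (B * cosh s - A * sinh s) *\<^sub>R b"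
  using assms by (simp add: boost_def rot_mult polar_simps polar_commute[of b w] algebra_simps)

lemma Vpos_unit:
  assumes "a \<in> Vpos" "a \<noteq> 0"
  obtains w A where "A > 0" "w \<in> Vpos" "polar q w w = 1" "a = A *\<^sub>R w"
proof (rule that)
  have p: "polar q a a > 0" using assms v_facts(12) by (simp add: polar_self)
  show "sqrt (polar q a a) > 0" using p by simp
  show "(1 / sqrt (polar q a a)) *\<^sub>R a \<in> Vpos" using assms v_facts(10) subspace_scale by blast
  show "polar q ((1 / sqrt (polar q a a)) *\<^sub>R a) ((1 / sqrt (polar q a a)) *\<^sub>R a) = 1"
    using p by (simp add: polar_simps)
  show "a = sqrt (polar q a a) *\<^sub>R ((1 / sqrt (polar q a a)) *\<^sub>R a)" using p by simp
qed

lemma Vn_unit: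
  assumes "a \<in> Vn" "a \<noteq> 0"
  obtains b B where "B > 0" "b \<in> Vn" "polar q b b = -1" "a = B *\<^sub>R b"
proof (rule that)
  have p: "polar q a a < 0" using assms v_facts(11) by (simp add: polar_self)
  show "sqrt (- polar q a a) > 0" using p by simp
  show "(1 / sqrt (- polar q a a)) *\<^sub>R a \<in> Vn" using assms v_facts(8) subspace_scale by blast
  show "polar q ((1 / sqrt (- polar q a a)) *\<^sub>R a) ((1 / sqrt (- polar q a a)) *\<^sub>R a) = -1"
    using p by (simp add: polar_simps field_simps)
  show "a = sqrt (- polar q a a) *\<^sub>R ((1 / sqrt (- polar q a a)) *\<^sub>R a)" using p by simp
qed

text \<open>The boost acts in the plane of the two components of x; positive norm makes the
  V2-component the longer one, so the other can be boosted away. The relation between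
  \<open>pos_part x\<close> and w is recorded to control what the boost fixes.\<close>

lemma boost_into_Vpos:
  assumes "polar q x x > 0" "x \<notin> Vpos"
  obtains w b s A where "w \<in> Vpos" "polar q w w = 1" "b \<in> Vn" "polar q b b = -1" "A > 0" "pos_part x = A *\<^sub>R w"
    "boost w b s *v x \<in> Vpos"
proof -
  have "pos_part x \<noteq> 0"
  proof
    assume "pos_part x = 0"
    hence "x \<in> Vn" using neg_part_in[of x] by simp
    thus False using v_facts(11)[of x] assms(1) q_scale[of 0 0] by (cases "x = 0") (auto simp: polar_self)
  qed
  then obtain w A where w: "A > 0" "w \<in> Vpos" "polar q w w = 1" "pos_part x = A *\<^sub>R w"
    using Vpos_unit[OF pos_part_in] by metis
  have "x - pos_part x \<noteq> 0" using assms(2) by (simp add: Vpos_iff)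
  then obtain b B where b: "B > 0" "b \<in> Vn" "polar q b b = -1" "x - pos_part x = B *\<^sub>R b"
    using Vn_unit[OF neg_part_in] by metis
  have wb: "polar q w b = 0" "polar q b w = 0" using polar_Vpos_Vn[OF w(2) b(2)] by auto
  have x: "x = A *\<^sub>R w + B *\<^sub>R b" using w(4) b(4) by (metis add.commute diff_add_cancel)
  have "A * A - B * B > 0" using assms(1) unfolding x by (simp add: polar_simps w b wb)
  hence "\<bar>B\<bar> < \<bar>A\<bar>" using w(1) b(1) mult_mono[of A B A B] by force
  then obtain s where "A * sinh s = B * cosh s" by (rule ex_tanh_eq)
  hence "boost w b s *v x = (A * cosh s - B * sinh s) *\<^sub>R w"
    unfolding x boost_coords[OF w(3) b(3) wb(1)] by simp
  hence "boost w b s *v x \<in> Vpos" using w(2) v_facts(10) subspace_scale by simp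
  thus ?thesis using that w b by blast
qed

lemma boost_move:
  assumes "w \<in> Vpos" "polar q w w = 1" "b \<in> Vn" "polar q b b = -1" "m *v x = y"
  shows "(m ** boost w b (- s)) *v (boost w b s *v x) = y"
proof -
  have wb: "polar q w b = 0" "polar q w w * polar q b b = -1" using polar_Vpos_Vn[OF assms(1,3)] assms by auto
  have "boost w b (- s) *v (boost w b s *v x) = x"
    by (simp add: matrix_vector_mul_assoc boost_add[OF wb] boost_zero)
  thus ?thesis using assms(5) by (simp flip: matrix_vector_mul_assoc)
qed

text \<open>A Cartan decomposition of \<open>SO(V')\<close>: two boosts bring \<open>m\<close> into the stabiliser of \<open>V2\<close>.\<close>
lemma SO_invariant_const:
  fixes c :: "real^'m^'m \<Rightarrow> 'b"
  assumes hb: "\<And>m w b s. m \<in> SO q \<Longrightarrow> w \<in> Vpos \<Longrightarrow> polar q w w = 1 \<Longrightarrow> b \<in> Vn \<Longrightarrow> polar q b b = -1 \<Longrightarrow> c (m ** boost w b s) = c m"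
    and hk: "\<And>m k. m \<in> SO q \<Longrightarrow> k \<in> SO q \<Longrightarrow> (\<And>x. x \<in> Vpos \<Longrightarrow> k *v x \<in> Vpos) \<Longrightarrow> c (m ** k) = c m"
    and m: "m \<in> SO q"
  shows "c m = c (mat 1)"
proof -
  have bS: "m ** boost w b s \<in> SO q" if "m \<in> SO q" "w \<in> Vpos" "polar q w w = 1" "b \<in> Vn" "polar q b b = -1" for m w b s
    using that polar_Vpos_Vn[of w b] by (intro SO_mult boost_SO) auto
  have "\<exists>m1 x1 x2. m1 \<in> SO q \<and> c m1 = c m \<and> m1 *v x1 = v1 \<and> m1 *v x2 = v2 \<and> x1 \<in> Vpos"
  proof -
    define x1 x2 where "x1 = matrix_inv m *v v1" and "x2 = matrix_inv m *v v2"
    have x: "m *v x1 = v1" "m *v x2 = v2" by (simp_all add: x1_def x2_def matrix_vector_mul_assoc SO_inv[OF m])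
    have x11: "polar q x1 x1 > 0" using SO_polar[OF m, of x1 x1] by (simp add: x v_facts)
    show ?thesis
    proof (cases "x1 \<in> Vpos")
      case True thus ?thesis using m x by blast
    next
      case False
      from boost_into_Vpos[OF x11 False] obtain w b s where w: "w \<in> Vpos" "polar q w w = 1" "b \<in> Vn" "polar q b b = -1"
        "boost w b s *v x1 \<in> Vpos" by metis
      show ?thesis using bS[OF m w(1-4), of "- s"] hb[OF m w(1-4), of "- s"] boost_move[OF w(1-4) x(1), of s] boost_move[OF w(1-4) x(2), of s] w(5)
        by blast
    qed
  qed
  then obtain m1 x1 x2 where m1: "m1 \<in> SO q" "c m1 = c m" "m1 *v x1 = v1" "m1 *v x2 = v2" "x1 \<in> Vpos" by blast
  have "\<exists>m2 x2. m2 \<in> SO q \<and> c m2 = c m \<and> m2 *v x1 = v1 \<and> m2 *v x2 = v2 \<and> x2 \<in> Vpos"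
  proof (cases "x2 \<in> Vpos")
    case True thus ?thesis using m1 by blast
  next
    case False
    have x22: "polar q x2 x2 > 0" using SO_polar[OF m1(1), of x2 x2] by (simp add: m1 v_facts)
    have x12: "polar q x2 x1 = 0" using SO_polar[OF m1(1), of x2 x1] by (simp add: m1 v21)
    from boost_into_Vpos[OF x22 False] obtain w b s A where w: "w \<in> Vpos" "polar q w w = 1" "b \<in> Vn" "polar q b b = -1"
       "A > 0" "pos_part x2 = A *\<^sub>R w" "boost w b s *v x2 \<in> Vpos" by metis
    have wb: "polar q w b = 0" "polar q b x1 = 0" using polar_Vpos_Vn[OF w(1,3)] polar_Vpos_Vn[OF m1(5) w(3)] by auto
    have "polar q x2 x1 = polar q (pos_part x2) x1 + polar q (x2 - pos_part x2) x1" by (simp add: polar_simps)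
    also have "polar q (x2 - pos_part x2) x1 = 0" using polar_Vpos_Vn[OF m1(5) neg_part_in] by simp
    \<comment> \<open>x2 is orthogonal to x1, so the plane of the second boost is too: the boost
      fixes x1 and does not undo the first step.\<close>
    finally have "polar q w x1 = 0" using x12 w(5,6) by (simp add: polar_simps)
    hence fix1: "boost w b s *v x1 = x1" using wb by (simp add: boost_def rot_mult)
    show ?thesis
      by (intro exI[of _ "m1 ** boost w b (- s)"] exI[of _ "boost w b s *v x2"])
         (use bS[OF m1(1) w(1-4), of "- s"] hb[OF m1(1) w(1-4), of "- s"] m1(2) boost_move[OF w(1-4) m1(3), of s, unfolded fix1]
           boost_move[OF w(1-4) m1(4), of s] w(7) in auto)
  qed
  then obtain m2 y2 where m2: "m2 \<in> SO q" "c m2 = c m" "m2 *v x1 = v1" "m2 *v y2 = v2" "y2 \<in> Vpos" by blast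
  \<comment> \<open>The inverse of m2 stabilises V2, and right multiplication by it takes m2 to the
    identity.\<close>
  have k: "matrix_inv m2 *v v1 = x1" "matrix_inv m2 *v v2 = y2"
    by (simp_all flip: m2(3,4)) (simp_all add: matrix_vector_mul_assoc SO_inv[OF m2(1)])
  have "matrix_inv m2 *v x \<in> Vpos" if "x \<in> Vpos" for x
  proof -
    have "x = polar q v1 x *\<^sub>R v1 + polar q v2 x *\<^sub>R v2" using that by (simp add: Vpos_iff pos_part_def)
    hence "matrix_inv m2 *v x = polar q v1 x *\<^sub>R x1 + polar q v2 x *\<^sub>R y2"
      by (metis k matrix_vector_algebra(5,7))
    thus ?thesis using m1(5) m2(5) v_facts(10) by (simp add: subspace_add subspace_scale)
  qed
  from hk[OF m2(1) SO_inv(1)[OF m2(1)] this] show ?thesis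
    by (simp add: SO_inv(3)[OF m2(1)] m2(2))
qed

lemma turn_coords:
  assumes "H a b = 0" "H a a = \<alpha>" "H b b = \<alpha>" "\<alpha> * \<alpha> = 1"
  shows "H a (V.turn a b s *v y) = cos s * H a y + \<alpha> * sin s * H b y"
    "H b (V.turn a b s *v y) = cos s * H b y - \<alpha> * sin s * H a y"
    "H a c = 0 \<Longrightarrow> H b c = 0 \<Longrightarrow> H c (V.turn a b s *v y) = H c y"
proof -
  have 1: "\<alpha> * (\<alpha> * z) = z" for z using assms(4) by (metis mult.assoc mult_1)
  show "H a (V.turn a b s *v y) = cos s * H a y + \<alpha> * sin s * H b y"
    "H b (V.turn a b s *v y) = cos s * H b y - \<alpha> * sin s * H a y"
    using assms(1-3) by (simp_all add: V.turn_def V.rot_mult V.polar_simps V.polar_commute[of b a] algebra_simps 1)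
  show "H c (V.turn a b s *v y) = H c y" if "H a c = 0" "H b c = 0"
    using that assms(1) V.polar_commute[of c a] V.polar_commute[of c b] by (simp add: V.turn_def V.rot_mult V.polar_simps)
qed

lemma turn_move:
  assumes "H a b = 0" "H a a * H b b = 1" "g *v y = z"
  shows "(g ** V.turn a b (- s)) *v (V.turn a b s *v y) = z"
proof -
  have "V.turn a b (- s) *v (V.turn a b s *v y) = y"
    by (simp add: matrix_vector_mul_assoc V.turn_add[OF assms(1,2)] V.turn_zero)
  thus ?thesis using assms(3) by (simp flip: matrix_vector_mul_assoc)
qed

text \<open>The image of f determines x. After removing n(x) both isotropic lines are preserved,
  hence also their orthogonal complement V', on which m is read off.\<close>

lemma stabilizer_decomposition:
  assumes h: "h \<in> SO (hyp q)" and e: "h *v ee = t *\<^sub>R ee" and t: "t \<noteq> 0"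
  obtains x m where "m \<in> SO q" "h = nmat q x ** diag_mat t m"
proof -
  define y where "y = h *v ff"
  have He: "H ee z = f_coord z" "H ff z = e_coord z" "H z ee = f_coord z" "H z ff = e_coord z" for z by (simp_all add: H_eq E_defs polar_simps)
  have "t * f_coord y = 1" using V.SO_polar[OF h, of ee ff] by (simp add: e y_def[symmetric] V.polar_simps He) (simp add: E_defs)
  hence fy: "f_coord y = inverse t" using t by (simp add: field_simps)
  have hy: "e_coord y * f_coord y + q (mid y) = 0"
  proof -
    have "hyp q y = hyp q ff" using h by (simp add: SO_def y_def)
    thus ?thesis using q_scale[of 0 0] by (simp add: hyp_def E_defs)
  qed
  \<comment> \<open>The element n(x) diag(t, m, 1/t) sends f to a vector with V'-part -x/t.\<close>
  define x where "x = - (t *\<^sub>R mid y)"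
  define h' where "h' = nmat q (- x) ** h"
  have h': "h' \<in> SO (hyp q)" unfolding h'_def by (rule V.SO_mult[OF nmat_SO h])
  have hh': "h = nmat q x ** h'" by (simp add: h'_def matrix_mul_assoc nmat_compose nmat_zero)
  have e': "h' *v ee = t *\<^sub>R ee"
  proof -
    have "h' *v ee = nmat q (- x) *v (h *v ee)" by (simp add: h'_def matrix_vector_mul_assoc)
    thus ?thesis unfolding e by (simp add: nmat_mult E_defs vec_of_linear polar_simps)
  qed
  have f': "h' *v ff = inverse t *\<^sub>R ff"
  proof -
    have "polar q x (mid y) = - t * (2 * q (mid y))" "q (- x) = t\<^sup>2 * q (mid y)"
      using q_scale[of t "mid y"] q_scale[of "-1" "t *\<^sub>R mid y"] by (simp_all add: x_def polar_simps polar_self)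
    moreover have "e_coord y = - (t * q (mid y))" using hy t by (simp add: fy field_simps)
    ultimately have "nmat q (- x) *v y = vec_of 0 0 (inverse t)"
      using t by (intro vec_eqI) (simp_all add: nmat_mult fy polar_simps x_def power2_eq_square field_simps)
    thus ?thesis by (simp add: h'_def y_def matrix_vector_mul_assoc[symmetric] E_defs vec_of_linear)
  qed
  have ef0: "f_coord (h' *v vec_of 0 v 0) = 0" "e_coord (h' *v vec_of 0 v 0) = 0" for v
    using V.SO_polar[OF h', of ee "vec_of 0 v 0"] V.SO_polar[OF h', of ff "vec_of 0 v 0"] t
    by (simp_all add: e' f' V.polar_simps He)
  define m where "m = matrix (\<lambda>v. mid (h' *v vec_of 0 v 0))"
  have m: "m *v v = mid (h' *v vec_of 0 v 0)" for v
  proof -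
    have "linear (\<lambda>v. mid (h' *v vec_of 0 v 0))"
    proof (rule linearI)
      fix v w :: "real^'m" and c :: real
      have "vec_of 0 (v + w) 0 = vec_of 0 v 0 + vec_of 0 w 0" "vec_of 0 (c *\<^sub>R v) 0 = c *\<^sub>R vec_of 0 v 0" by (simp_all add: vec_of_linear)
      thus "mid (h' *v vec_of 0 (v + w) 0) = mid (h' *v vec_of 0 v 0) + mid (h' *v vec_of 0 w 0)"
        "mid (h' *v vec_of 0 (c *\<^sub>R v) 0) = c *\<^sub>R mid (h' *v vec_of 0 v 0)"
        by (simp_all add: matrix_vector_algebra)
    qed
    thus ?thesis by (simp add: m_def matrix_works)
  qed
  have hd: "h' = diag_mat t m"
  proof (rule matrix_eqI)
    fix w
    have "w = e_coord w *\<^sub>R ee + vec_of 0 (mid w) 0 + f_coord w *\<^sub>R ff" by (intro vec_eqI) (simp_all add: E_defs)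
    hence "h' *v w = h' *v (e_coord w *\<^sub>R ee + vec_of 0 (mid w) 0 + f_coord w *\<^sub>R ff)" by simp
    also have "\<dots> = e_coord w *\<^sub>R (t *\<^sub>R ee) + h' *v vec_of 0 (mid w) 0 + f_coord w *\<^sub>R (inverse t *\<^sub>R ff)"
      by (simp add: matrix_vector_algebra e' f')
    also have "\<dots> = diag_mat t m *v w"
      by (intro vec_eqI) (simp_all add: diag_mat_mult m ef0, simp_all add: E_defs)
    finally show "h' *v w = diag_mat t m *v w" .
  qed
  have "m \<in> SO q"
  proof -
    have "q (m *v v) = q v" for v
    proof -
      have "hyp q (h' *v vec_of 0 v 0) = hyp q (vec_of 0 v 0)" using h' by (simp add: SO_def)
      thus ?thesis by (simp add: hyp_def ef0 m)
    qed
    moreover have "det m = 1" using h' det_diag_mat[OF t, of m] by (simp add: SO_def hd)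
    ultimately show ?thesis by (simp add: SO_def)
  qed
  thus ?thesis using that hh' hd by blast
qed

text \<open>The Iwasawa decomposition \<open>G = N M K\<close>, with \<open>K\<close> entering through three plane rotations
  that move the isotropic vector \<open>g\<^sup>-\<^sup>1 e\<close> to the ray of \<open>e\<close>.\<close>
lemma Iwasawa_induct:
  assumes n: "n \<ge> 1" and g: "g \<in> SO (hyp q)"
    and turn: "\<And>g v s. g \<in> SO (hyp q) \<Longrightarrow> v = E1 \<or> v = E2 \<Longrightarrow> Z (g ** V.turn v U s) \<Longrightarrow> Z g"
    and turnW: "\<And>g b s. g \<in> SO (hyp q) \<Longrightarrow> b \<in> Vn \<Longrightarrow> polar q b b = -1 \<Longrightarrow> Z (g ** V.turn (vec_of 0 b 0) W s) \<Longrightarrow> Z g"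
    and N: "\<And>g x. g \<in> SO (hyp q) \<Longrightarrow> Z g \<Longrightarrow> Z (nmat q x ** g)"
    and M: "\<And>t m. t > 0 \<Longrightarrow> m \<in> SO q \<Longrightarrow> Z (diag_mat t m)"
  shows "Z g"
proof -
  let ?G = "SO (hyp q)"
  define y where "y = matrix_inv g *v ee"
  have y: "g *v y = ee" by (simp add: y_def matrix_vector_mul_assoc V.SO_inv[OF g])
  \<comment> \<open>The first rotation needs no sign condition; the second fixes the sign of the
    pairing with \<open>U\<close>, the third that with \<open>W\<close>.\<close>
  obtain s1 where s1: "cos s1 * H E1 y + 1 * sin s1 * H U y = 0" by (rule ex_turn_angle[of 1 1]) auto
  define g1 y1 where "g1 = g ** V.turn E1 U (- s1)" and "y1 = V.turn E1 U s1 *v y"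
  have g1: "g1 \<in> ?G" unfolding g1_def by (intro V.SO_mult[OF g] V.turn_SO) (simp_all add: H_basis)
  have y1: "g1 *v y1 = ee" unfolding g1_def y1_def by (intro turn_move y) (simp_all add: H_basis)
  have y11: "H E1 y1 = 0" unfolding y1_def using s1 by (subst turn_coords(1)[where \<alpha> = 1]) (simp_all add: H_basis)
  obtain s2 where s2: "cos s2 * H E2 y1 + 1 * sin s2 * H U y1 = 0" "1 * (cos s2 * H U y1 - 1 * sin s2 * H E2 y1) \<ge> 0"
    by (rule ex_turn_angle[of 1 1]) auto
  define g2 y2 where "g2 = g1 ** V.turn E2 U (- s2)" and "y2 = V.turn E2 U s2 *v y1"
  have g2: "g2 \<in> ?G" unfolding g2_def by (intro V.SO_mult[OF g1] V.turn_SO) (simp_all add: H_basis)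
  have y2: "g2 *v y2 = ee" unfolding g2_def y2_def by (intro turn_move y1) (simp_all add: H_basis)
  have y21: "H E1 y2 = 0" unfolding y2_def by (subst turn_coords(3)[where \<alpha> = 1]) (simp_all add: H_basis y11)
  have y22: "H E2 y2 = 0" unfolding y2_def using s2(1) by (subst turn_coords(1)[where \<alpha> = 1]) (simp_all add: H_basis)
  have y23: "H U y2 \<ge> 0" unfolding y2_def using s2(2) by (subst turn_coords(2)[where \<alpha> = 1]) (simp_all add: H_basis)
  have mid2: "mid y2 \<in> Vn" using y21 y22 by (simp add: Vn_iff H_eq E_defs)
  obtain b \<beta> where b: "b \<in> Vn" "polar q b b = -1" "mid y2 = \<beta> *\<^sub>R b"
  proof (cases "mid y2 = 0")
    case True
    have "Vn \<noteq> {0}" using n v_facts(9) by (metis dim_eq_0 order_refl not_one_le_zero)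
    then obtain a where a: "a \<in> Vn" "a \<noteq> 0" using v_facts(8) subspace_0 by blast
    obtain b B where "B > 0" "b \<in> Vn" "polar q b b = -1" "a = B *\<^sub>R b" by (rule Vn_unit[OF a])
    thus ?thesis using that[of b 0] True by simp
  next
    case False
    obtain b B where "B > 0" "b \<in> Vn" "polar q b b = -1" "mid y2 = B *\<^sub>R b" by (rule Vn_unit[OF mid2 False])
    thus ?thesis using that by blast
  qed
  let ?b = "vec_of 0 b 0"
  have Hb: "H ?b ?b = -1" "H ?b W = 0" "H W ?b = 0" "H ?b E1 = 0" "H ?b E2 = 0" "H ?b U = 0"
    using b polar_Vpos_Vn[OF v_facts(5) b(1)] polar_Vpos_Vn[OF v_facts(6) b(1)]
    by (simp_all add: H_eq E_defs polar_simps)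
  obtain s3 where s3: "cos s3 * H ?b y2 + (-1) * sin s3 * H W y2 = 0" "-1 * (cos s3 * H W y2 - (-1) * sin s3 * H ?b y2) \<ge> 0"
    by (rule ex_turn_angle[of "-1" "-1"]) auto
  define g3 y3 where "g3 = g2 ** V.turn ?b W (- s3)" and "y3 = V.turn ?b W s3 *v y2"
  have g3: "g3 \<in> ?G" unfolding g3_def by (intro V.SO_mult[OF g2] V.turn_SO) (simp_all add: H_basis Hb)
  have y3: "g3 *v y3 = ee" unfolding g3_def y3_def by (intro turn_move y2) (simp_all add: H_basis Hb)
  have y31: "H ?b y3 = 0" unfolding y3_def using s3(1) by (subst turn_coords(1)[where \<alpha> = "-1"]) (simp_all add: H_basis Hb)
  have y32: "H W y3 \<le> 0" unfolding y3_def using s3(2) by (subst turn_coords(2)[where \<alpha> = "-1"]) (simp_all add: H_basis Hb)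
  have y33: "H U y3 \<ge> 0" unfolding y3_def using y23 by (subst turn_coords(3)[where \<alpha> = "-1"]) (simp_all add: H_basis Hb)
  have "\<exists>\<gamma>. mid y3 = \<gamma> *\<^sub>R b"
  proof -
    have "mid y3 = \<beta> *\<^sub>R b + (sin s3 * H W y2) *\<^sub>R b + ((1 - cos s3) * H ?b y2) *\<^sub>R b"
      unfolding y3_def V.turn_def V.rot_mult[OF Hb(2)] by (simp add: b(3) H_basis Hb algebra_simps) (simp add: W_def algebra_simps)
    thus ?thesis by (metis scaleR_add_left)
  qed
  then obtain \<gamma> where \<gamma>: "mid y3 = \<gamma> *\<^sub>R b" by blast
  have "\<gamma> = 0" using y31 b(2) by (simp add: H_eq \<gamma> polar_simps)
  hence mid3: "mid y3 = 0" by (simp add: \<gamma>)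
  define p r where "p = e_coord y3" and "r = f_coord y3"
  have y3_eq: "y3 = vec_of p 0 r" using mid3 by (intro vec_eqI) (simp_all add: p_def r_def)
  have "hyp q (g3 *v y3) = hyp q y3" using g3 by (simp add: SO_def)
  \<comment> \<open>The vector p e + r f is isotropic and nonzero, so exactly one of p, r vanishes.
    The two sign conditions leave only r = 0 < p, the ray of e rather than that of -e or the line of
    f.\<close>
  hence "p * r = 0" unfolding y3 by (simp add: hyp_def y3_eq E_defs)
  moreover have "p \<noteq> 0 \<or> r \<noteq> 0"
  proof (rule ccontr)
    assume "\<not> (p \<noteq> 0 \<or> r \<noteq> 0)"
    hence "y3 = 0" by (simp add: y3_eq vec_of_linear)
    hence "ee = 0" using y3 by simp
    hence "e_coord ee = 0" by simp
    thus False by (simp add: ee_def)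
  qed
  moreover have "r - p \<le> 0"
  proof -
    have "H W y3 = (r - p) / sqrt 2" by (simp add: H_eq y3_eq E_defs polar_simps field_simps)
    thus ?thesis using y32 by (simp add: divide_le_0_iff)
  qed
  moreover have "r + p \<ge> 0"
  proof -
    have "H U y3 = (r + p) / sqrt 2" by (simp add: H_eq y3_eq E_defs polar_simps field_simps)
    thus ?thesis using y33 by (simp add: zero_le_divide_iff)
  qed
  ultimately have p: "p > 0" "r = 0" by auto
  have "y3 = p *\<^sub>R ee" by (simp add: y3_eq p E_defs vec_of_linear)
  hence "p *\<^sub>R (g3 *v ee) = ee" using y3 by (simp add: matrix_vector_algebra)
  hence "g3 *v ee = (1 / p) *\<^sub>R ee" using p by (metis divide_inverse mult_1 scaleR_scaleR left_inverse less_irrefl scaleR_one)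
  moreover have "1 / p \<noteq> 0" using p by simp
  ultimately obtain x m where xm: "m \<in> SO q" "g3 = nmat q x ** diag_mat (1 / p) m"
    by (rule stabilizer_decomposition[OF g3])
  have "Z g3" unfolding xm(2) using p xm(1) by (intro N M diag_SO) auto
  hence "Z g2" unfolding g3_def using turnW[OF g2 b(1,2)] by blast
  hence "Z g1" unfolding g2_def using turn[OF g1] by blast
  thus "Z g" unfolding g1_def using turn[OF g] by blast
qed

end

section \<open>The case of negative norm\<close>

context whittaker
begin

lemma polar_\<eta>:
  assumes "m \<in> SO q" shows "polar q \<eta> (m *v v) = polar q (matrix_inv m *v \<eta>) v"
  using SO_polar[OF assms, of "matrix_inv m *v \<eta>" v] by (simp add: matrix_vector_mul_assoc SO_inv[OF assms])

text \<open>|u| measures the V2-component of \<open>matrix_inv m *v \<eta>\<close>; so u vanishes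
  exactly when that vector lies in Vn, which is a statement about the sign of
  \<open>(\<eta>, \<eta>)\<close>.\<close>

lemma cmod_u_sq:
  assumes "m \<in> SO q"
  shows "(cmod (u 1 m))\<^sup>2 = 2 * polar q (pos_part (matrix_inv m *v \<eta>)) (pos_part (matrix_inv m *v \<eta>))"
proof -
  have "(cmod (u 1 m))\<^sup>2 = 2 * ((polar q \<eta> (m *v v1))\<^sup>2 + (polar q \<eta> (m *v v2))\<^sup>2)"
    by (simp add: u_def norm_mult power_mult_distrib complex_norm)
  thus ?thesis unfolding polar_\<eta>[OF assms] polar_commute[of "matrix_inv m *v \<eta>"]
    by (simp add: pos_part_def polar_simps v_facts(2-4) v21 power2_eq_square)
qed

lemma u_eq_0_iff: "m \<in> SO q \<Longrightarrow> u 1 m = 0 \<longleftrightarrow> pos_part (matrix_inv m *v \<eta>) = 0"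
  using cmod_u_sq[of m] v_facts(12)[OF pos_part_in, of "matrix_inv m *v \<eta>"] q_scale[of 0 0]
  by (cases "pos_part (matrix_inv m *v \<eta>) = 0") (auto simp: polar_simps polar_self)

lemma cmod_u_boost:
  assumes m: "m \<in> SO q" and w: "w \<in> Vpos" "polar q w w = 1" and b: "b \<in> Vn" "polar q b b = -1"
    and \<eta>: "matrix_inv m *v \<eta> = A *\<^sub>R w + B *\<^sub>R b"
  shows "cmod (u 1 (m ** boost w b s)) = sqrt 2 * \<bar>A * cosh s + B * sinh s\<bar>"
proof -
  have wb: "polar q w b = 0" "polar q b w = 0" using polar_Vpos_Vn[OF w(1) b(1)] by auto
  have bv: "polar q b v1 = 0" "polar q b v2 = 0" using polar_Vpos_Vn[OF v_facts(5) b(1)] polar_Vpos_Vn[OF v_facts(6) b(1)] by auto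
  have p: "polar q \<eta> ((m ** boost w b s) *v v) = (A * cosh s + B * sinh s) * polar q w v" if "polar q b v = 0" for v
    unfolding matrix_vector_mul_assoc[symmetric] polar_\<eta>[OF m] \<eta> boost_def rot_mult[OF wb(1)]
    using that w b wb by (simp add: polar_simps algebra_simps)
  have "pos_part w = w" using w(1) by (simp add: Vpos_iff)
  hence "polar q (pos_part w) (pos_part w) = 1" using w(2) by simp
  hence c: "(polar q w v1)\<^sup>2 + (polar q w v2)\<^sup>2 = 1"
    by (simp add: pos_part_def polar_simps v_facts(2-4) v21 polar_commute[of w] power2_eq_square)
  have h: "sqrt (((A * cosh s + B * sinh s) * polar q w v1)\<^sup>2 + ((A * cosh s + B * sinh s) * polar q w v2)\<^sup>2) = \<bar>A * cosh s + B * sinh s\<bar>"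
    unfolding power_mult_distrib distrib_left[symmetric] c by simp
  have "cmod (u 1 (m ** boost w b s)) = \<bar>sqrt 2 * 1\<bar> * \<bar>A * cosh s + B * sinh s\<bar>"
    unfolding u_def p[OF bv(1)] p[OF bv(2)] norm_mult norm_minus_cancel norm_of_real complex_norm h ..
  thus ?thesis by simp
qed

lemma isCont_\<phi>_boost:
  assumes "m \<in> SO q" "t \<noteq> 0" "polar q w b = 0" "polar q w w * polar q b b = -1"
  shows "isCont (\<lambda>s. \<phi> j t (m ** boost w b s)) s"
  using boost_curve[OF assms, of j s] has_vector_derivative_continuous by blast

text \<open>Stated on a convex set of parameters because u may have a zero on the full line.\<close>

lemma cst_boost_const:
  assumes m: "m \<in> SO q" and w: "w \<in> Vpos" "polar q w w = 1" and b: "b \<in> Vn" "polar q b b = -1"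
    and S: "convex S" "0 \<in> S" "s \<in> S" "\<And>s. s \<in> S \<Longrightarrow> u 1 (m ** boost w b s) \<noteq> 0"
  shows "cst (m ** boost w b s) = cst m"
proof -
  have "((\<lambda>s. cst (m ** boost w b s)) has_derivative (\<lambda>h. 0)) (at x within S)" if "x \<in> S" for x
    using cst_boost_deriv[OF m b w S(4)[OF that]]
    by (auto simp: has_vector_derivative_def intro: has_derivative_at_withinI)
  then obtain c where "\<And>x. x \<in> S \<Longrightarrow> cst (m ** boost w b x) = c"
    using has_derivative_zero_constant[OF S(1)] by metis
  from this[OF S(2)] this[OF S(3)] show ?thesis by (simp add: boost_zero)
qed

lemma F_diag_eq_0:
  assumes "m \<in> SO q" "t \<noteq> 0" "\<And>j. j \<le> k2 \<Longrightarrow> \<phi> j t m = 0" shows "F (diag_mat t m) = 0"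
proof (rule poly_eqI)
  fix j
  show "coeff (F (diag_mat t m)) j = coeff 0 j"
  proof (cases "j \<le> k2")
    case True thus ?thesis using assms(3)[of j] by (simp add: \<phi>_def)
  next
    case False thus ?thesis using F_forms[OF diag_SO[OF assms(1,2)]] by (simp add: forms_def coeff_eq_0)
  qed
qed

text \<open>Along a single boost \<open>u\<close> shrinks to \<open>0\<close>, where \<open>K\<^sub>1\<close> blows up while \<open>F\<close> stays bounded.\<close>
lemma cst_negative:
  assumes neg: "polar q \<eta> \<eta> < 0" and m: "m \<in> SO q" and u0: "u 1 m \<noteq> 0"
  shows "cst m = 0"
proof -
  define z where "z = matrix_inv m *v \<eta>"
  have zz: "polar q z z < 0" using neg SO_polar[OF SO_inv(1)[OF m]] by (simp add: z_def)
  have "pos_part z \<noteq> 0" using u0 u_eq_0_iff[OF m] by (simp add: z_def)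
  then obtain w A where w: "A > 0" "w \<in> Vpos" "polar q w w = 1" "pos_part z = A *\<^sub>R w"
    using Vpos_unit[OF pos_part_in] by metis
  have "z - pos_part z \<noteq> 0"
  proof
    assume "z - pos_part z = 0"
    hence "z = A *\<^sub>R w" using w(4) by simp
    hence "polar q z z = A * A" using w by (simp add: polar_simps)
    thus False using zz by (simp add: not_less)
  qed
  then obtain b B where b: "B > 0" "b \<in> Vn" "polar q b b = -1" "z - pos_part z = B *\<^sub>R b"
    using Vn_unit[OF neg_part_in] by metis
  have wb: "polar q w b = 0" "polar q b w = 0" "polar q w w * polar q b b = -1" using polar_Vpos_Vn[OF w(2) b(2)] w b by auto
  have z: "z = A *\<^sub>R w + B *\<^sub>R b" using w(4) b(4) by (metis add.commute diff_add_cancel)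
  have "A * A < B * B" using zz unfolding z by (simp add: polar_simps w b wb)
  hence "\<bar>A\<bar> < \<bar>B\<bar>" using w(1) b(1) mult_mono[of B A B A] by force
  \<comment> \<open>u vanishes exactly at -s0 on this boost. The base point 0 lies to the right of
    it, so C is constant on the open half line up to the zero.\<close>
  then obtain s0 where s0: "B * sinh s0 = A * cosh s0" by (rule ex_tanh_eq)
  have "B * sinh s0 > 0" unfolding s0 using w(1) by simp
  hence s0p: "s0 > 0" using b(1) by (simp add: zero_less_mult_iff)
  define f where "f = (\<lambda>s. A * cosh s + B * sinh s)"
  have fs: "f s * cosh s0 = B * sinh (s0 + s)" for s
    unfolding sinh_add f_def distrib_left mult.assoc[symmetric] s0 by (simp add: algebra_simps)
  have f0: "f (- s0) = 0" using fs[of "- s0"] by simp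
  have N: "cmod (u 1 (m ** boost w b s)) = sqrt 2 * \<bar>f s\<bar>" for s
    unfolding f_def by (rule cmod_u_boost[OF m w(2,3) b(2,3) z[unfolded z_def]])
  have fpos: "f s > 0" if "s > - s0" for s
  proof -
    have "f s * cosh s0 > 0" unfolding fs using that b(1) by simp
    thus ?thesis using cosh_real_pos[of s0] by (simp add: zero_less_mult_iff)
  qed
  define C where "C = cst m"
  have cst: "cst (m ** boost w b s) = C" if "s > - s0" for s
    unfolding C_def
  proof (rule cst_boost_const[OF m w(2,3) b(2,3), of "{- s0<..}"])
    show "u 1 (m ** boost w b x) \<noteq> 0" if "x \<in> {- s0<..}" for x
      using N[of x] fpos[of x] that by auto
  qed (use that s0p in \<open>auto simp: convex_real_interval\<close>)
  have mS: "m ** boost w b s \<in> SO q" for s by (rule SO_mult[OF m boost_SO[OF wb(1,3)]])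
  \<comment> \<open>\<open>R\<close> is |u| times the coefficient next to the middle: it vanishes at
    -s0 by continuity of F, but equals |C| y \<open>K_1(y)\<close> with y = |u| to the right of it,
    which stays above |C| \<open>K_1(1)\<close> near -s0.\<close>
  define R where "R = (\<lambda>s. sqrt 2 * \<bar>f s\<bar> * norm (\<phi> (l + 1) 1 (m ** boost w b s)))"
  have fc: "isCont f s" for s unfolding f_def by (intro continuous_intros)
  have "isCont R (- s0)"
    unfolding R_def by (intro continuous_intros fc isCont_\<phi>_boost[OF m _ wb(1,3)]) simp
  hence lim: "(R \<longlongrightarrow> R (- s0)) (at_right (- s0))"
    unfolding isCont_def by (rule tendsto_mono[OF at_le, rotated]) auto
  have "\<forall>\<^sub>F s in at_right (- s0). sqrt 2 * \<bar>f s\<bar> < 1"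
  proof (rule order_tendstoD(2))
    have "isCont (\<lambda>s. sqrt 2 * \<bar>f s\<bar>) (- s0)" by (intro continuous_intros fc)
    thus "((\<lambda>s. sqrt 2 * \<bar>f s\<bar>) \<longlongrightarrow> sqrt 2 * \<bar>f (- s0)\<bar>) (at_right (- s0))"
      unfolding isCont_def by (rule tendsto_mono[OF at_le, rotated]) auto
    show "sqrt 2 * \<bar>f (- s0)\<bar> < 1" by (simp add: f0)
  qed
  hence "\<forall>\<^sub>F s in at_right (- s0). norm C * bessel_K 1 1 \<le> R s"
    using eventually_at_right_less[of "- s0"]
  proof eventually_elim
    case (elim s)
    define y where "y = sqrt 2 * \<bar>f s\<bar>"
    have y: "0 < y" "y \<le> 1" using elim fpos[of s] by (auto simp: y_def)
    have yN: "cmod (u 1 (m ** boost w b s)) = y" using N by (simp add: y_def)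
    hence un0: "u 1 (m ** boost w b s) \<noteq> 0" using y by auto
    have "\<phi> (l + 1) 1 (m ** boost w b s) = C * (of_real y / u 1 (m ** boost w b s)) * of_real (bessel_K 1 y)"
      using ray_solution_cst[OF mS un0, of 1 "l + 1"] l1 cst[OF elim(2)] by (simp add: yN)
    hence "norm (\<phi> (l + 1) 1 (m ** boost w b s)) = norm C * bessel_K 1 y"
      using y bessel_K_pos[OF y(1), of 1] by (simp add: norm_mult norm_divide yN)
    hence "R s = norm C * (y * bessel_K 1 y)" by (simp add: R_def y_def)
    moreover have "y * bessel_K 1 y \<ge> bessel_K 1 1" using bessel_K1_lower[OF y] y by (simp add: field_simps)
    ultimately show ?case by (simp add: mult_left_mono)
  qed
  from tendsto_lowerbound[OF lim this] have "norm C * bessel_K 1 1 \<le> 0" by (simp add: R_def f0)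
  hence "norm C \<le> 0" using bessel_K_pos[of 1 1] by (simp add: mult_le_0_iff)
  thus ?thesis by (simp add: C_def)
qed

lemma F_diag_negative:
  assumes \<eta>0: "\<eta> \<noteq> 0" and neg: "polar q \<eta> \<eta> < 0" and m: "m \<in> SO q" and t: "t > 0"
  shows "F (diag_mat t m) = 0"
proof (rule F_diag_eq_0[OF m])
  have gen: "\<phi> j t m = 0" if "m \<in> SO q" "u 1 m \<noteq> 0" "j \<le> k2" for j m
    using ray_solution_cst[OF that(1,2) t that(3)] cst_negative[OF neg that(1,2)] by simp
  fix j assume j: "j \<le> k2"
  show "\<phi> j t m = 0"
  proof (cases "u 1 m = 0")
    case False thus ?thesis using gen[OF m] j by blast
  next
    \<comment> \<open>At a zero of u the vector \<open>z\<close> lies in Vn. A boost in the plane of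
      v1 and z makes u nonzero for every s other than 0, so the value at s = 0 follows by
      continuity.\<close>
    case True
    define z where "z = matrix_inv m *v \<eta>"
    have "m *v z = \<eta>" by (simp add: z_def matrix_vector_mul_assoc SO_inv[OF m])
    hence z0: "z \<noteq> 0" using \<eta>0 by auto
    have "pos_part z = 0" using True u_eq_0_iff[OF m] by (simp add: z_def)
    hence "z \<in> Vn" using neg_part_in[of z] by simp
    then obtain b B where b: "B > 0" "b \<in> Vn" "polar q b b = -1" "z = B *\<^sub>R b" using Vn_unit[OF _ z0] by metis
    have wb: "polar q v1 b = 0" "polar q v1 v1 * polar q b b = -1" using polar_Vpos_Vn[OF v_facts(5) b(2)] b v_facts(2) by auto
    have z: "matrix_inv m *v \<eta> = 0 *\<^sub>R v1 + B *\<^sub>R b" using b(4) by (simp add: z_def)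
    have "\<phi> j t (m ** boost v1 b s) = 0" if "s \<noteq> 0" for s
    proof (rule gen[OF SO_mult[OF m boost_SO[OF wb]] _ j])
      have "cmod (u 1 (m ** boost v1 b s)) \<noteq> 0"
        unfolding cmod_u_boost[OF m v_facts(5,2) b(2,3) z] using that b(1) by simp
      thus "u 1 (m ** boost v1 b s) \<noteq> 0" by auto
    qed
    hence "\<forall>\<^sub>F s in at 0. \<phi> j t (m ** boost v1 b s) = 0" by (simp add: eventually_at_filter)
    hence "((\<lambda>s. \<phi> j t (m ** boost v1 b s)) \<longlongrightarrow> 0) (at 0)" by (rule tendsto_eventually)
    moreover have "((\<lambda>s. \<phi> j t (m ** boost v1 b s)) \<longlongrightarrow> \<phi> j t m) (at 0)"
      using isCont_\<phi>_boost[OF m _ wb, where t = t and j = j and s = 0] t by (simp add: isCont_def boost_zero)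
    ultimately show ?thesis using tendsto_unique[OF trivial_limit_at] by blast
  qed
qed (use t in auto)

text \<open>K acts linearly, so a zero at gk gives a zero at g. Equivariance asks for a lift of the
  inverse of \<open>k'\<close>, which is \<open>k\<close> itself.\<close>

lemma F_K_eq_0:
  assumes "g \<in> G" "k \<in> G" "k' \<in> Kgroup q v1 v2" "k' ** k = mat 1" "k ** k' = mat 1" "F (g ** k) = 0" "spin_lift v1 v2 k A \<epsilon>"
  shows "F g = 0"
proof -
  have "F ((g ** k) ** k') = smult (\<epsilon> ^ l) (sym_act k2 A (F (g ** k)))"
    by (rule F_K_apply[OF V.SO_mult[OF assms(1,2)] assms(3,4,7)])
  thus ?thesis using assms(5,6) by (simp add: sym_act_def matrix_mul_assoc[symmetric])
qed

lemma F_negative: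
  assumes \<eta>0: "\<eta> \<noteq> 0" and neg: "polar q \<eta> \<eta> < 0" and g: "g \<in> G"
  shows "F g = 0"
proof (rule Iwasawa_induct[OF n1 g, of "\<lambda>g. F g = 0"])
  fix g v s assume g: "g \<in> G" and v: "v = E1 \<or> v = E2" and F: "F (g ** V.turn v U s) = 0"
  have vU: "H v U = 0" "H v v * H U U = 1" "iota q v1 v2 v = 1 *\<^sub>R v" using v by (auto simp: H_basis iota_basis)
  obtain A where sl: "spin_lift v1 v2 (V.turn v U s) A 1" using v spin_lift_turn1 spin_lift_turn2 by blast
  show "F g = 0"
    by (rule F_K_eq_0[OF g V.turn_SO[OF vU(1,2)] turn_K[OF vU iota_basis(3), of "- s"] _ _ F sl])
       (simp_all add: V.turn_add[OF vU(1,2)] V.turn_zero)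
next
  fix g b s assume g: "g \<in> G" and b: "b \<in> Vn" "polar q b b = -1" and F: "F (g ** V.turn (vec_of 0 b 0) W s) = 0"
  let ?b = "vec_of 0 b 0"
  have Hb: "H ?b W = 0" "H ?b ?b * H W W = 1" "H ?b E1 = 0" "H ?b E2 = 0" "H ?b U = 0"
    using b polar_Vpos_Vn[OF v_facts(5) b(1)] polar_Vpos_Vn[OF v_facts(6) b(1)]
    by (simp_all add: H_basis) (simp_all add: H_eq E_defs polar_simps)
  have sl: "spin_lift v1 v2 (V.turn ?b W s) (mat 1) 1"
    by (rule spin_lift_trivial) (simp_all add: V.turn_def V.rot_mult[OF Hb(1)] H_basis Hb)
  show "F g = 0"
    by (rule F_K_eq_0[OF g V.turn_SO[OF Hb(1,2)] turn_K[OF Hb(1,2) iota_basis(5)[OF b(1)] iota_basis(4), of "- s"] _ _ F sl])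
       (simp_all add: V.turn_add[OF Hb(1,2)] V.turn_zero)
qed (use F_N F_diag_negative[OF \<eta>0 neg] in auto)

section \<open>The case of nonnegative norm\<close>

lemma u_nonzero:
  assumes \<eta>0: "\<eta> \<noteq> 0" and pos: "polar q \<eta> \<eta> \<ge> 0" and m: "m \<in> SO q"
  shows "u 1 m \<noteq> 0"
proof
  assume "u 1 m = 0"
  hence "pos_part (matrix_inv m *v \<eta>) = 0" using u_eq_0_iff[OF m] by simp
  hence z: "matrix_inv m *v \<eta> \<in> Vn" using neg_part_in[of "matrix_inv m *v \<eta>"] by simp
  have "m *v (matrix_inv m *v \<eta>) = \<eta>" by (simp add: matrix_vector_mul_assoc SO_inv[OF m])
  hence "matrix_inv m *v \<eta> \<noteq> 0" using \<eta>0 by auto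
  hence "q (matrix_inv m *v \<eta>) < 0" using v_facts(11) z by blast
  thus False using pos SO_polar[OF SO_inv(1)[OF m], of \<eta> \<eta>] by (simp add: polar_self)
qed

text \<open>Numerator and denominator are both invariant: the middle coefficient by
  \<open>spin_lift_diag\<close>, and |u| because k commutes with the projection to V2.\<close>

lemma cst_stab:
  assumes m: "m \<in> SO q" and k: "k \<in> SO q" "\<And>x. x \<in> Vpos \<Longrightarrow> k *v x \<in> Vpos"
  shows "cst (m ** k) = cst m"
proof -
  note ki = SO_inv(1)[OF k(1)] stab_Vpos_inv[OF k]
  obtain A \<epsilon> where A: "spin_lift v1 v2 (diag_mat 1 (matrix_inv k)) A \<epsilon>"
    "\<And>l p. coeff (smult (\<epsilon> ^ l) (sym_act (2 * l) A p)) l = coeff p l"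
    using spin_lift_diag[OF ki] by blast
  have "diag_mat 1 (m ** k) = diag_mat 1 m ** diag_mat 1 k" by (simp add: diag_mat_compose)
  moreover have "F (diag_mat 1 m ** diag_mat 1 k) = smult (\<epsilon> ^ l) (sym_act k2 A (F (diag_mat 1 m)))"
    by (rule F_K_apply[OF diag_SO[OF m] diag_K[OF k] _ A(1)]) (simp_all add: diag_mat_compose SO_inv[OF k(1)] diag_mat_one)
  ultimately have \<phi>: "\<phi> l 1 (m ** k) = \<phi> l 1 m" by (simp only: \<phi>_def A(2))
  have inv: "matrix_inv (m ** k) *v \<eta> = matrix_inv k *v (matrix_inv m *v \<eta>)"
  proof -
    note mk = SO_mult[OF m k(1)]
    have "(m ** k) *v (matrix_inv (m ** k) *v \<eta>) = \<eta>" by (simp add: matrix_vector_mul_assoc SO_inv[OF mk])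
    hence "matrix_inv k *v (matrix_inv m *v ((m ** k) *v (matrix_inv (m ** k) *v \<eta>))) = matrix_inv k *v (matrix_inv m *v \<eta>)" by simp
    moreover have "matrix_inv k *v (matrix_inv m *v ((m ** k) *v v)) = v" for v
    proof -
      have "matrix_inv m *v ((m ** k) *v v) = (matrix_inv m ** m) *v (k *v v)" by (simp only: matrix_vector_mul_assoc matrix_mul_assoc)
      hence "matrix_inv m *v ((m ** k) *v v) = k *v v" by (simp add: SO_inv[OF m])
      thus ?thesis by (simp add: matrix_vector_mul_assoc SO_inv[OF k(1)])
    qed
    ultimately show ?thesis by simp
  qed
  have "(cmod (u 1 (m ** k)))\<^sup>2 = (cmod (u 1 m))\<^sup>2"
    by (simp only: cmod_u_sq[OF m] cmod_u_sq[OF SO_mult[OF m k(1)]] inv stab_pos_part[OF ki(1) ki(2)] SO_polar[OF ki(1)])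
  hence "cmod (u 1 (m ** k)) = cmod (u 1 m)" by (simp add: power2_eq_iff_nonneg)
  thus ?thesis by (simp add: cst_def \<phi>)
qed

text \<open>diag(-1, 1, -1) lies in K, which carries t > 0 over to t < 0. Its lift diag(i, -i) acts
  on coefficient j by (-1)^(j+l), and \<epsilon>^l removes the part depending on l.\<close>

lemma \<phi>_minus:
  assumes m: "m \<in> SO q" and t: "t \<noteq> 0" and j: "j \<le> k2"
  shows "\<phi> j (- t) m = (-1) ^ j * \<phi> j t m"
proof -
  have "diag_mat (- t) m = diag_mat t m ** diag_mat (-1) (mat 1)" by (simp add: diag_mat_compose)
  moreover have "F (diag_mat t m ** diag_mat (-1) (mat 1)) = smult ((-1) ^ l) (sym_act k2 (mat2 \<i> 0 0 (- \<i>)) (F (diag_mat t m)))"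
    by (rule F_K_apply[OF diag_SO[OF m t] diag_K[OF SO_one] _ spin_lift_minus]) (simp_all add: diag_mat_compose diag_mat_one)
  moreover have "coeff (sym_act k2 (mat2 \<i> 0 0 (- \<i>)) p) j = (-1) ^ j * (-1) ^ l * coeff p j" for p
  proof -
    have "(- \<i>) ^ (k2 - j) = (-1) ^ (k2 - j) * \<i> ^ (k2 - j)" by (rule power_minus)
    moreover have "(-1) ^ (k2 - j) = ((-1) ^ j :: complex)" using j by (simp add: minus_one_power_iff)
    moreover have "\<i> ^ j * \<i> ^ (k2 - j) = (-1) ^ l" using j by (simp flip: power_add)
    ultimately show ?thesis using j by (simp add: coeff_sym_act_diagonal mult_ac)
  qed
  ultimately have "coeff (F (diag_mat (- t) m)) j = (-1) ^ l * (-1) ^ l * ((-1) ^ j * coeff (F (diag_mat t m)) j)"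
    by (simp add: mult_ac)
  moreover have "(-1) ^ l * (-1) ^ l = (1 :: complex)" by (simp flip: power_mult_distrib)
  ultimately show ?thesis by (simp add: \<phi>_def)
qed

lemma coeff_W_eta:
  assumes "j \<le> k2"
  shows "fact j * fact (k2 - j) * coeff (W_eta q v1 v2 l \<eta> t m) j
    = of_real (t ^ l * \<bar>t\<bar>) * bess j t m"
proof -
  define c where "c = (\<lambda>v. (of_real (cmod (u t m)) / u t m) powi v * of_real (bessel_K v (cmod (u t m))))"
  have "coeff (W_eta q v1 v2 l \<eta> t m) j = of_real (t ^ l * \<bar>t\<bar>) *
     (\<Sum>v\<in>{- int l..int l}. c v * (if nat (int l + v) = j then 1 / (fact (nat (int l + v)) * fact (nat (int l - v))) else 0))"
    by (simp add: W_eta_def u_eta_eq coeff_sum c_def)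
  also have "(\<Sum>v\<in>{- int l..int l}. c v * (if nat (int l + v) = j then 1 / (fact (nat (int l + v)) * fact (nat (int l - v))) else 0))
     = (\<Sum>v\<in>{- int l..int l}. if v = int j - int l then c v * (1 / (fact (nat (int l + v)) * fact (nat (int l - v)))) else 0)"
    by (intro sum.cong refl) auto
  also have "\<dots> = c (int j - int l) * (1 / (fact j * fact (k2 - j)))"
  proof -
    have "nat (int l - (int j - int l)) = k2 - j" by simp
    thus ?thesis using assms by (simp add: sum.delta)
  qed
  finally show ?thesis by (simp add: c_def)
qed

lemma F_diag_positive:
  assumes \<eta>0: "\<eta> \<noteq> 0" and pos: "polar q \<eta> \<eta> \<ge> 0" and m: "m \<in> SO q" and t: "t \<noteq> 0"
  shows "F (diag_mat t m) = smult (cst (mat 1)) (W_eta q v1 v2 l \<eta> t m)"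
proof -
  have C: "cst m = cst (mat 1)" if "m \<in> SO q" for m
  proof (rule SO_invariant_const[OF _ cst_stab that])
    fix m w b s assume m: "m \<in> SO q" and w: "w \<in> Vpos" "polar q w w = 1" and b: "b \<in> Vn" "polar q b b = -1"
    have "m ** boost w b s \<in> SO q" for s using polar_Vpos_Vn[OF w(1) b(1)] w b by (intro SO_mult[OF m boost_SO]) auto
    \<comment> \<open>Here u has no zero, so the whole real line serves as the convex set.\<close>
    thus "cst (m ** boost w b s) = cst m"
      by (intro cst_boost_const[OF m w b convex_UNIV UNIV_I UNIV_I] u_nonzero[OF \<eta>0 pos])
  qed
  have pos_t: "\<phi> j t m = cst (mat 1) * (fact j * fact (k2 - j) * coeff (W_eta q v1 v2 l \<eta> t m) j)" if "t > 0" "j \<le> k2" for t j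
    unfolding coeff_W_eta[OF that(2)] using ray_solution_cst[OF m u_nonzero[OF \<eta>0 pos m] that] that(1) by (simp add: C[OF m] mult_ac)
  have "\<phi> j t m = cst (mat 1) * (fact j * fact (k2 - j) * coeff (W_eta q v1 v2 l \<eta> t m) j)" if j: "j \<le> k2" for j
  proof (cases "t > 0")
    case True thus ?thesis using pos_t j by blast
  next
    case False
    define s where "s = - t"
    have s: "s > 0" "t = - s" using False t by (auto simp: s_def)
    have u: "u t m = - u s m" by (simp add: u_def s)
    hence cu: "cmod (u t m) = cmod (u s m)" by simp
    have sgn: "(- 1) powi (int j - int l) = ((-1) ^ j * (-1) ^ l :: complex)"
      by (simp add: power_int_diff divide_inverse flip: power_inverse)
    have p: "(of_real (cmod (u t m)) / u t m) powi (int j - int l) = (- 1) powi (int j - int l) * (of_real (cmod (u s m)) / u s m) powi (int j - int l)"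
    proof -
      have "of_real (cmod (u t m)) / u t m = (-1) * (of_real (cmod (u s m)) / u s m)" by (simp add: u)
      thus ?thesis by (simp only: power_int_mult_distrib)
    qed
    \<comment> \<open>The prefactor t^l |t| contributes (-1)^l and the phase (-1)^(j-l), which
      together match the sign in \<open>\<phi>_minus\<close>.\<close>
    have "fact j * fact (k2 - j) * coeff (W_eta q v1 v2 l \<eta> t m) j = (-1) ^ j * (fact j * fact (k2 - j) * coeff (W_eta q v1 v2 l \<eta> s m) j)"
    proof -
      have tl: "complex_of_real (t ^ l * \<bar>t\<bar>) = (-1) ^ l * of_real (s ^ l * \<bar>s\<bar>)"
        unfolding s(2) by (simp add: power_minus[of s] power_minus[of "complex_of_real s"])
      have 1: "(-1) ^ l * (-1) ^ l = (1 :: complex)" by (simp flip: power_mult_distrib)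
      have cancel: "x * a * (y * x * b * c) = y * (a * (b * c))" if "x * x = 1" for x a y b c :: complex
        using that by algebra
      show ?thesis
        unfolding coeff_W_eta[OF j] p unfolding sgn tl cu by (rule cancel[OF 1])
    qed
    moreover have "\<phi> j t m = (-1) ^ j * \<phi> j s m" unfolding s(2) using s(1) by (intro \<phi>_minus[OF m _ j]) simp
    ultimately show ?thesis using pos_t[OF s(1) j] by simp
  qed
  note \<phi> = this
  show ?thesis
  proof (rule poly_eqI)
    fix j
    show "coeff (F (diag_mat t m)) j = coeff (smult (cst (mat 1)) (W_eta q v1 v2 l \<eta> t m)) j"
    proof (cases "j \<le> k2")
      case True
      thus ?thesis using \<phi>[OF True] by (simp add: \<phi>_def)
    next
      case False
      have "coeff (W_eta q v1 v2 l \<eta> t m) j = 0"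
        using False by (auto simp: W_eta_def coeff_sum intro!: sum.neutral split: if_splits)
      moreover have "coeff (F (diag_mat t m)) j = 0"
        using False F_forms[OF diag_SO[OF m t]] by (simp add: forms_def coeff_eq_0)
      ultimately show ?thesis by simp
    qed
  qed
qed

end

theorem theorem3p4:
  fixes q :: "real^'m \<Rightarrow> real" and V2 Vn :: "(real^'m) set" and v1 v2 \<eta> :: "real^'m"
    and n l :: nat and F :: "real^('m + bool)^('m + bool) \<Rightarrow> complex poly"
  assumes "n \<ge> 1"
    and "signature_split q n V2 Vn v1 v2"
    and "l \<ge> 1"
    and "\<eta> \<noteq> 0"
    and "gen_whittaker q Vn v1 v2 l \<eta> F"
  shows "(polar q \<eta> \<eta> < 0 \<longrightarrow> (\<forall>g\<in>SO (hyp q). F g = 0)) \<and>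
    (polar q \<eta> \<eta> \<ge> 0 \<longrightarrow>
      (\<exists>C::complex. \<forall>t m. t \<noteq> 0 \<longrightarrow> m \<in> SO q \<longrightarrow>
         F (diag_mat t m) = smult C (W_eta q v1 v2 l \<eta> t m)))"
proof -
  interpret whittaker q n V2 Vn v1 v2 l \<eta> F
    by unfold_locales (fact assms)+
  show ?thesis using F_negative F_diag_positive assms(4) by blast
qed

end
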